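(* Let $\mathfrak{g}$ be a finite-dimensional complex simple Lie algebra with canonical basis $\mathcal{A}$ as in the context. If $\phi:\mathfrak{g}\to\mathfrak{gl}(V)$ and $\psi:\mathfrak{g}\to\mathfrak{gl}(W)$ are finite-dimensional representations with $f_\phi=f_\psi$, then $V$ and $W$ are isomorphic as $\mathfrak{g}$-modules. That is, the $\mathfrak{g}$-module structure of a finite-dimensional representation is uniquely determined (up to isomorphism) by its characteristic polynomial.
   Context: Fix a Cartan subalgebra $\mathfrak{h}$ of $\mathfrak{g}$ with root system $\Phi$, simple roots $\alpha_1,\dots,\alpha_n$, coroots $h_{\alpha_1},\dots,h_{\alpha_n}$ (a basis of $\mathfrak{h}$) and root vectors $E_\alpha$, $\alpha\in\Phi$; the canonical basis is $\mathcal{A}=(h_{\alpha_1},\dots,h_{\alpha_n},E_\alpha\ (\alpha\in\Phi))$. For a finite-dimensional representation $\phi:\mathfrak{g}\to\mathfrak{gl}(V)$, its characteristic polynomial is $f_\phi(z)=\det\big(z_0I+\sum_{i=1}^n z_i\phi(h_{\alpha_i})+\sum_{\alpha\in\Phi}z_\alpha\phi(E_\alpha)\big)$ in indeterminates $z_0,z_1,\dots,z_n,z_\alpha$ ($\alpha\in\Phi$). *)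

theory Defs
  imports "HOL-Analysis.Analysis"
begin

text \<open>The Lie algebra g is modelled (up to isomorphism) as the complex vector space
  complex^'d with a bracket B. Representations are maps into complex matrices
  complex^'v^'v, i.e. into gl(V) with V = complex^'v.\<close>

definition clin :: "(complex^'a \<Rightarrow> complex^'b) \<Rightarrow> bool" where
  "clin f \<longleftrightarrow> Vector_Spaces.linear (*s) (*s) f"

definition lie_algebra :: "(complex^'d \<Rightarrow> complex^'d \<Rightarrow> complex^'d) \<Rightarrow> bool" where
  "lie_algebra B \<longleftrightarrow>
     (\<forall>x. clin (B x)) \<and> (\<forall>y. clin (\<lambda>x. B x y)) \<and> (\<forall>x. B x x = 0) \<and>
     (\<forall>x y z. B x (B y z) + B y (B z x) + B z (B x y) = 0)"

definition lie_ideal :: "(complex^'d \<Rightarrow> complex^'d \<Rightarrow> complex^'d) \<Rightarrow> (complex^'d) set \<Rightarrow> bool" where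
  "lie_ideal B I \<longleftrightarrow> vec.subspace I \<and> (\<forall>x i. i \<in> I \<longrightarrow> B x i \<in> I)"

text \<open>Simple: non-abelian with no ideals other than 0 and g.\<close>
definition simple_lie :: "(complex^'d \<Rightarrow> complex^'d \<Rightarrow> complex^'d) \<Rightarrow> bool" where
  "simple_lie B \<longleftrightarrow> lie_algebra B \<and> (\<exists>x y. B x y \<noteq> 0) \<and>
     (\<forall>I. lie_ideal B I \<longrightarrow> I = {0} \<or> I = UNIV)"

definition lie_subalgebra :: "(complex^'d \<Rightarrow> complex^'d \<Rightarrow> complex^'d) \<Rightarrow> (complex^'d) set \<Rightarrow> bool" where
  "lie_subalgebra B H \<longleftrightarrow> vec.subspace H \<and> (\<forall>x\<in>H. \<forall>y\<in>H. B x y \<in> H)"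

text \<open>Lower central series of a subalgebra H.\<close>
fun lcs :: "(complex^'d \<Rightarrow> complex^'d \<Rightarrow> complex^'d) \<Rightarrow> (complex^'d) set \<Rightarrow> nat \<Rightarrow> (complex^'d) set" where
  "lcs B H 0 = H"
| "lcs B H (Suc k) = vec.span {B x y | x y. x \<in> H \<and> y \<in> lcs B H k}"

definition normalizer :: "(complex^'d \<Rightarrow> complex^'d \<Rightarrow> complex^'d) \<Rightarrow> (complex^'d) set \<Rightarrow> (complex^'d) set" where
  "normalizer B H = {x. \<forall>y\<in>H. B x y \<in> H}"

text \<open>Cartan subalgebra: nilpotent self-normalizing subalgebra.\<close>
definition cartan_subalgebra :: "(complex^'d \<Rightarrow> complex^'d \<Rightarrow> complex^'d) \<Rightarrow> (complex^'d) set \<Rightarrow> bool" where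
  "cartan_subalgebra B H \<longleftrightarrow> lie_subalgebra B H \<and> (\<exists>k. lcs B H k = {0}) \<and> normalizer B H = H"

text \<open>Functionals on h are represented by functions on g that vanish outside H.\<close>
definition root_space :: "(complex^'d \<Rightarrow> complex^'d \<Rightarrow> complex^'d) \<Rightarrow> (complex^'d) set
    \<Rightarrow> (complex^'d \<Rightarrow> complex) \<Rightarrow> (complex^'d) set" where
  "root_space B H \<alpha> = {x. \<forall>h\<in>H. B h x = \<alpha> h *s x}"

definition roots :: "(complex^'d \<Rightarrow> complex^'d \<Rightarrow> complex^'d) \<Rightarrow> (complex^'d) set
    \<Rightarrow> (complex^'d \<Rightarrow> complex) set" where
  "roots B H = {\<alpha>. (\<forall>x. x \<notin> H \<longrightarrow> \<alpha> x = 0) \<and> (\<exists>h\<in>H. \<alpha> h \<noteq> 0) \<and>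
                    root_space B H \<alpha> \<noteq> {0}}"

text \<open>A base (set of simple roots) of the root system.\<close>
definition is_base :: "(complex^'d \<Rightarrow> complex) set \<Rightarrow> (complex^'d) set \<Rightarrow> (complex^'d \<Rightarrow> complex) set \<Rightarrow> bool" where
  "is_base \<Phi> H \<Delta> \<longleftrightarrow> \<Delta> \<subseteq> \<Phi> \<and> finite \<Delta> \<and>
     (\<forall>c. (\<forall>h\<in>H. (\<Sum>\<alpha>\<in>\<Delta>. c \<alpha> * \<alpha> h) = 0) \<longrightarrow> (\<forall>\<alpha>\<in>\<Delta>. c \<alpha> = 0)) \<and>
     (\<forall>\<beta>\<in>\<Phi>. \<exists>k :: (complex^'d \<Rightarrow> complex) \<Rightarrow> int.
        ((\<forall>\<alpha>\<in>\<Delta>. k \<alpha> \<ge> 0) \<or> (\<forall>\<alpha>\<in>\<Delta>. k \<alpha> \<le> 0)) \<and>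
        (\<forall>h\<in>H. \<beta> h = (\<Sum>\<alpha>\<in>\<Delta>. of_int (k \<alpha>) * \<alpha> h)))"

text \<open>Coroot h_alpha: the element of [g_alpha, g_(-alpha)] (inside h) with alpha(h_alpha) = 2.\<close>
definition is_coroot :: "(complex^'d \<Rightarrow> complex^'d \<Rightarrow> complex^'d) \<Rightarrow> (complex^'d) set
    \<Rightarrow> (complex^'d \<Rightarrow> complex) \<Rightarrow> complex^'d \<Rightarrow> bool" where
  "is_coroot B H \<alpha> h \<longleftrightarrow> h \<in> H \<and> \<alpha> h = 2 \<and>
     h \<in> vec.span {B x y | x y. x \<in> root_space B H \<alpha> \<and> y \<in> root_space B H (\<lambda>v. - \<alpha> v)}"

text \<open>Data of a canonical basis: Cartan subalgebra H, simple roots alpha 0..alpha (n-1),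
  coroots hc i = h_(alpha i), root vectors E beta for beta in Phi.\<close>
definition canonical_data :: "(complex^'d \<Rightarrow> complex^'d \<Rightarrow> complex^'d) \<Rightarrow> (complex^'d) set \<Rightarrow> nat
    \<Rightarrow> (nat \<Rightarrow> complex^'d \<Rightarrow> complex) \<Rightarrow> (nat \<Rightarrow> complex^'d) \<Rightarrow> ((complex^'d \<Rightarrow> complex) \<Rightarrow> complex^'d) \<Rightarrow> bool" where
  "canonical_data B H n al hc E \<longleftrightarrow> cartan_subalgebra B H \<and>
     inj_on al {..<n} \<and> is_base (roots B H) H (al ` {..<n}) \<and>
     (\<forall>i<n. is_coroot B H (al i) (hc i)) \<and>
     (\<forall>\<beta>\<in>roots B H. E \<beta> \<in> root_space B H \<beta> \<and> E \<beta> \<noteq> 0)"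

definition smat :: "complex \<Rightarrow> complex^'v^'v \<Rightarrow> complex^'v^'v" where
  "smat c M = (\<chi> i j. c * M $ i $ j)"

definition is_rep :: "(complex^'d \<Rightarrow> complex^'d \<Rightarrow> complex^'d) \<Rightarrow> (complex^'d \<Rightarrow> complex^'v^'v) \<Rightarrow> bool" where
  "is_rep B \<phi> \<longleftrightarrow> (\<forall>x y. \<phi> (x + y) = \<phi> x + \<phi> y) \<and> (\<forall>c x. \<phi> (c *s x) = smat c (\<phi> x)) \<and>
     (\<forall>x y. \<phi> (B x y) = \<phi> x ** \<phi> y - \<phi> y ** \<phi> x)"

text \<open>Characteristic polynomial f_phi, as a polynomial function of the indeterminates
  z0, z_i (i < n), z_beta (beta in Phi).\<close>
definition char_fun :: "(complex^'d \<Rightarrow> complex^'d \<Rightarrow> complex^'d) \<Rightarrow> (complex^'d) set \<Rightarrow> nat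
    \<Rightarrow> (nat \<Rightarrow> complex^'d) \<Rightarrow> ((complex^'d \<Rightarrow> complex) \<Rightarrow> complex^'d) \<Rightarrow> (complex^'d \<Rightarrow> complex^'v^'v)
    \<Rightarrow> complex \<Rightarrow> (nat \<Rightarrow> complex) \<Rightarrow> ((complex^'d \<Rightarrow> complex) \<Rightarrow> complex) \<Rightarrow> complex" where
  "char_fun B H n hc E \<phi> z0 zh zr =
     det (mat z0 + (\<Sum>i<n. smat (zh i) (\<phi> (hc i))) + (\<Sum>\<beta>\<in>roots B H. smat (zr \<beta>) (\<phi> (E \<beta>))))"

end

theory Submission
  imports Defs "HOL-Computational_Algebra.Fundamental_Theorem_Algebra"
begin

text \<open>The coroots and root vectors span \<open>g\<close>, so equality of the characteristic polynomials
  gives \<open>tr \<phi>(x)^k = tr \<psi>(x)^k\<close> for all \<open>x\<close> and \<open>k\<close>. By polarization, and since reordering a word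
  only produces shorter words, the traces of all words in the \<open>\<phi>(x)\<close> and the \<open>\<psi>(x)\<close> agree. Take an
  intertwiner \<open>T\<close> with minimal kernel and an equivariant \<open>Y\<close> with \<open>T Y T = T\<close>. If \<open>1 - Y T\<close> is not
  zero, a trace comparison on \<open>Hom\<close> spaces yields a nonzero intertwiner between the summands
  complementary to those matched by \<open>T\<close>, and adding it to \<open>T\<close> shrinks the kernel. Complete
  reducibility enters only through elements \<open>u\<close> of the free algebra with constant term 1 and
  \<open>x u = 0\<close> for all \<open>x\<close>, which Casimir elements provide. Nondegeneracy of trace forms and the
  structure of root spaces come from weight idempotents of the given Cartan subalgebra.\<close>

subsection \<open>Complex square matrices as a ring\<close>

text \<open>\<open>H\<close> is only nilpotent and self-normalizing, so the diagonalizability of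
  \<open>ad h\<close> is not given, yet spanning by coroots and root vectors rests on it and on
  one-dimensional root spaces. Generalized weights and the Killing form supply both. Power traces
  come from determinants: det q(\<phi>(x)) follows for each polynomial q from its linear factors,
  and the derivative of det(1 + s M) at s = 0 is the trace of M. Word traces suffice because on
  Hom(V, W) each x multiplies by \<psi>(x) on the left and by \<phi>(x) on the right, so the trace
  of a word there is a signed sum of products of word traces on W and on V. Hence Hom(V, V) and
  Hom(V, W) cannot be told apart by traces, while the first has the identity as an invariant. An
  element with constant term 1 that maps into the invariants fixes them, and it is zero where there
  are none. This replaces a comparison of irreducible constituents.\<close>

typedef (overloaded) 'n cmat = "UNIV :: (complex^'n::finite^'n) set"
  morphisms mat_of Cm by simp

setup_lifting type_definition_cmat

text \<open>On this separate type \<open>*\<close>, \<open>1\<close> and \<open>^\<close> can denote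
  the matrix product, the identity matrix and matrix powers, so the ring rules apply.\<close>

instantiation cmat :: (finite) ring_1
begin
lift_definition zero_cmat :: "'a cmat" is 0 .
lift_definition one_cmat :: "'a cmat" is "mat 1" .
lift_definition plus_cmat :: "'a cmat \<Rightarrow> 'a cmat \<Rightarrow> 'a cmat" is "(+)" .
lift_definition minus_cmat :: "'a cmat \<Rightarrow> 'a cmat \<Rightarrow> 'a cmat" is "(-)" .
lift_definition uminus_cmat :: "'a cmat \<Rightarrow> 'a cmat" is "uminus" .
lift_definition times_cmat :: "'a cmat \<Rightarrow> 'a cmat \<Rightarrow> 'a cmat" is "(**)" .
instance
proof
  show "(0::'a cmat) \<noteq> 1"
    by transfer (simp add: mat_def vec_eq_iff)
  fix a b c :: "'a cmat"
  show "a * b * c = a * (b * c)" by transfer (rule matrix_mul_assoc[symmetric])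
  show "(a + b) * c = a * c + b * c"
    by transfer (simp add: matrix_matrix_mult_def vec_eq_iff distrib_right sum.distrib)
  show "a * (b + c) = a * b + a * c" by transfer (rule matrix_add_ldistrib)
  show "1 * a = a" by transfer (rule matrix_mul_lid)
  show "a * 1 = a" by transfer (rule matrix_mul_rid)
qed (transfer; simp)+
end

lift_definition cs :: "complex \<Rightarrow> 'n::finite cmat" is mat .
lift_definition act :: "'n::finite cmat \<Rightarrow> complex^'n \<Rightarrow> complex^'n" is "(*v)" .
lift_definition tr :: "'n::finite cmat \<Rightarrow> complex" is trace .
lift_definition endo :: "(complex^'n \<Rightarrow> complex^'n) \<Rightarrow> 'n::finite cmat" is matrix .

lemma cs_add: "cs (a + b) = cs a + (cs b :: 'n::finite cmat)"
  by transfer (simp add: mat_def vec_eq_iff)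

lemma cs_0 [simp]: "cs 0 = 0" by transfer (simp add: mat_def vec_eq_iff)
lemma cs_1 [simp]: "cs 1 = 1" by transfer simp

lemma cs_diff: "cs (a - b) = cs a - (cs b :: 'n::finite cmat)"
  by transfer (simp add: mat_def vec_eq_iff)

lemma cs_minus: "cs (- b) = - (cs b :: 'n::finite cmat)"
  by transfer (simp add: mat_def vec_eq_iff)

lemma smat_mat: "smat c M = mat c ** M"
  by (simp add: smat_def mat_def matrix_matrix_mult_def vec_eq_iff if_distrib if_distribR sum.delta cong: if_cong)

lemma smat_mat': "smat c M = M ** mat c"
  by (simp add: smat_def mat_def matrix_matrix_mult_def vec_eq_iff if_distrib if_distribR sum.delta mult.commute cong: if_cong)

lemma cs_commute: "cs a * X = X * cs a"
  by transfer (metis smat_mat smat_mat')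

lemma cs_mult: "cs (a * b) = cs a * (cs b :: 'n::finite cmat)"
  by transfer (auto simp add: vec_eq_iff simp flip: smat_mat, auto simp: smat_def mat_def)

lemma cs_left_commute: "X * (cs a * Y) = cs a * (X * Y)"
  by (metis cs_commute mult.assoc)

lemma cs_power: "cs (a ^ n) = (cs a :: 'n::finite cmat) ^ n"
  by (induction n) (auto simp: cs_mult)

lemma cs_cancel: "a \<noteq> 0 \<Longrightarrow> cs a * X = 0 \<Longrightarrow> X = 0"
  by (metis cs_1 cs_mult left_inverse mult.assoc mult_1 mult_zero_right)

lemma act_add: "act (X + Y) v = act X v + act Y v"
  by transfer (simp add: matrix_vector_mult_add_rdistrib)
lemma act_diff: "act (X - Y) v = act X v - act Y v"
  by transfer (simp add: matrix_vector_mult_diff_rdistrib)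
lemma act_0 [simp]: "act 0 v = 0" by transfer simp
lemma act_1 [simp]: "act 1 v = v" by transfer simp
lemma act_mult: "act (X * Y) v = act X (act Y v)"
  by transfer (simp add: matrix_vector_mul_assoc)
lemma act_cs [simp]: "act (cs c) v = c *s v"
  by transfer (simp add: mat_def matrix_vector_mult_def vec_eq_iff if_distrib if_distribR sum.delta cong: if_cong)
lemma act_vadd: "act X (v + w) = act X v + act X w"
  by transfer (simp add: matrix_vector_right_distrib)
lemma act_vdiff: "act X (v - w) = act X v - act X w"
  by transfer (simp add: matrix_vector_mult_diff_distrib)
lemma act_v0 [simp]: "act X 0 = 0" by transfer simp
lemma act_scale: "act X (c *s v) = c *s act X v"
  by (metis act_cs act_mult cs_commute)
lemma act_sum: "act (\<Sum>i\<in>I. X i) v = (\<Sum>i\<in>I. act (X i) v)"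
  by (induction I rule: infinite_finite_induct) (auto simp: act_add)
lemma act_vsum: "act X (\<Sum>i\<in>I. v i) = (\<Sum>i\<in>I. act X (v i))"
  by (induction I rule: infinite_finite_induct) (auto simp: act_vadd)
lemma cmat_ext: "(\<And>v. act X v = act Y v) \<Longrightarrow> X = Y"
  by transfer (simp add: matrix_eq)

lemma clin_add: "clin f \<Longrightarrow> f (x + y) = f x + f y"
  by (simp add: clin_def vec.linear_add)
lemma clin_scale: "clin f \<Longrightarrow> f (c *s x) = c *s f x"
  by (simp add: clin_def vec.linear_scale)
lemma clin_0: "clin f \<Longrightarrow> f 0 = 0"
  by (simp add: clin_def vec.linear_0)
lemma clin_minus: "clin f \<Longrightarrow> f (- y) = - f y"
  by (simp add: clin_def vec.linear_neg)
lemma clinI: "(\<And>x y. f (x + y) = f x + f y) \<Longrightarrow> (\<And>c x. f (c *s x) = c *s f x) \<Longrightarrow> clin f"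
  unfolding clin_def
  by (meson Vector_Spaces.linear_def module_hom.intro module_hom_axioms.intro vec.module_axioms vec.vector_space_axioms vector_space_def)

lemma act_clin: "clin (act X)"
  by (rule clinI) (simp_all add: act_vadd act_scale)

lemma act_endo: "clin f \<Longrightarrow> act (endo f) v = f v"
  unfolding clin_def by transfer (simp add: matrix_works)

lemma tr_add: "tr (X + Y) = tr X + tr Y" by transfer (simp add: trace_add)
lemma tr_diff: "tr (X - Y) = tr X - tr Y" by transfer (simp add: trace_sub)
lemma tr_0 [simp]: "tr 0 = 0" by transfer (simp add: trace_def)
lemma tr_comm: "tr (X * Y) = tr (Y * X)" by transfer (rule trace_mul_sym)
lemma tr_cs: "tr (cs c * X) = c * tr X"
  by transfer (simp add: trace_def sum_distrib_left flip: smat_mat, simp add: smat_def)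
lemma tr_sum: "tr (\<Sum>i\<in>I. X i) = (\<Sum>i\<in>I. tr (X i))"
  by (induction I rule: infinite_finite_induct) (auto simp: tr_add)

section \<open>Kronecker products and vectorized matrices\<close>

lift_definition kron :: "'n::finite cmat \<Rightarrow> 'n cmat \<Rightarrow> ('n \<times> 'n) cmat" is
  "\<lambda>a b. \<chi> s t. a $ fst s $ fst t * b $ snd t $ snd s" .
lift_definition vecm :: "'n::finite cmat \<Rightarrow> complex^('n \<times> 'n)" is
  "\<lambda>Z. \<chi> s. Z $ fst s $ snd s" .

lemma sum_prod_univ: "(\<Sum>s\<in>UNIV. f (s::'a::finite\<times>'b::finite)) = (\<Sum>i\<in>UNIV. \<Sum>j\<in>UNIV. f (i,j))"
  by (simp add: sum.cartesian_product flip: UNIV_Times_UNIV)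

text \<open>\<open>kron\<close> stores its second factor transposed, so that it multiplies from the
  right here; hence the reversed order of \<open>d\<close> and \<open>b\<close> in
  \<open>kron_mult\<close>.\<close>

lemma kron_vecm: "act (kron a b) (vecm Z) = vecm (a * Z * b)"
  apply transfer
  apply (simp add: vec_eq_iff matrix_vector_mult_def matrix_matrix_mult_def sum_prod_univ sum_distrib_right)
  apply (intro allI)
  apply (subst sum.swap)
  apply (simp add: ac_simps)
  done

lemma kron_mult: "kron a b * kron c d = kron (a * c) (d * b)"
  apply transfer
  apply (simp add: vec_eq_iff matrix_matrix_mult_def sum_prod_univ sum_product)
  apply (simp add: ac_simps)
  done

lemma kron_add1: "kron (a + b) c = kron a c + kron b c"
  by transfer (simp add: vec_eq_iff algebra_simps)
lemma kron_add2: "kron c (a + b) = kron c a + kron c b"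
  by transfer (simp add: vec_eq_iff algebra_simps)
lemma kron_diff1: "kron (a - b) c = kron a c - kron b c"
  by transfer (simp add: vec_eq_iff algebra_simps)
lemma kron_diff2: "kron c (a - b) = kron c a - kron c b"
  by transfer (simp add: vec_eq_iff algebra_simps)
lemma kron_cs1: "kron (cs k * a) c = cs k * kron a c"
  by transfer (simp add: vec_eq_iff flip: smat_mat, simp add: smat_def)
lemma kron_cs2: "kron c (cs k * a) = cs k * kron c a"
  by transfer (simp add: vec_eq_iff flip: smat_mat, simp add: smat_def)
lemma kron_1: "kron 1 1 = 1"
  by transfer (auto simp add: vec_eq_iff mat_def)
lemma tr_kron: "tr (kron a b) = tr a * tr b"
  by transfer (simp add: trace_def sum_prod_univ sum_product)

lemma vecm_surj: "\<exists>Z. v = vecm Z"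
proof
  show "v = vecm (Cm (\<chi> i j. v $ (i,j)))"
    by (simp add: vecm_def Cm_inverse vec_eq_iff)
qed
lemma vecm_inj: "vecm Z = vecm Y \<longleftrightarrow> Z = Y"
  by transfer (auto simp: vec_eq_iff)
lemma vecm_add: "vecm (Z + Y) = vecm Z + vecm Y" by transfer (simp add: vec_eq_iff)
lemma vecm_diff: "vecm (Z - Y) = vecm Z - vecm Y" by transfer (simp add: vec_eq_iff)
lemma vecm_0: "vecm 0 = 0" by transfer (simp add: vec_eq_iff)
lemma vecm_cs: "vecm (cs c * Z) = c *s vecm Z"
  by transfer (simp add: vec_eq_iff flip: smat_mat, simp add: smat_def)
lemma vecm_sum: "vecm (\<Sum>i\<in>I. X i) = (\<Sum>i\<in>I. vecm (X i))"
  by (induction I rule: infinite_finite_induct) (auto simp: vecm_add vecm_0)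

subsection \<open>Polynomials in a matrix\<close>

definition mat_poly :: "complex poly \<Rightarrow> 'n::finite cmat \<Rightarrow> 'n cmat" where
  "mat_poly p X = fold_coeffs (\<lambda>a y. cs a + X * y) p 0"

lemma mat_poly_0 [simp]: "mat_poly 0 X = 0" by (simp add: mat_poly_def)
lemma mat_poly_pCons [simp]: "mat_poly (pCons a p) X = cs a + X * mat_poly p X"
  by (cases "a = 0 \<and> p = 0") (auto simp: mat_poly_def)
lemma mat_poly_1 [simp]: "mat_poly 1 X = 1" by (simp add: one_pCons)
lemma mat_poly_add: "mat_poly (p + q) X = mat_poly p X + mat_poly q X"
proof (induction p arbitrary: q)
  case (pCons a p) then show ?case by (cases q) (simp add: cs_add algebra_simps)
qed simp
lemma mat_poly_smult: "mat_poly (smult c p) X = cs c * mat_poly p X"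
  by (induction p) (auto simp: cs_mult distrib_left cs_left_commute)
lemma mat_poly_mult: "mat_poly (p * q) X = mat_poly p X * mat_poly q X"
proof (induction p)
  case (pCons a p)
  then show ?case by (simp add: mat_poly_add mat_poly_smult algebra_simps)
qed simp
lemma mat_poly_power: "mat_poly (p ^ n) X = mat_poly p X ^ n"
  by (induction n) (auto simp: mat_poly_mult)
lemma mat_poly_commute: "X * Y = Y * X \<Longrightarrow> mat_poly p X * Y = Y * mat_poly p X"
proof (induction p)
  case (pCons a p)
  have "X * mat_poly p X * Y = Y * (X * mat_poly p X)" using pCons by (metis mult.assoc)
  then show ?case using cs_commute[of a Y] by (simp add: algebra_simps)
qed simp
lemma mat_poly_sum: "mat_poly (\<Sum>i\<in>I. p i) X = (\<Sum>i\<in>I. mat_poly (p i) X)"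
  by (induction I rule: infinite_finite_induct) (auto simp: mat_poly_add)
lemma mat_poly_monom: "mat_poly (monom c n) X = cs c * X ^ n"
  by (induction n) (auto simp: monom_Suc monom_0 cs_left_commute)

lemma annihilating_poly:
  fixes X :: "'n::finite cmat"
  shows "\<exists>q. q \<noteq> 0 \<and> mat_poly q X = 0"
\<comment> \<open>A repeated power yields a polynomial at once. Otherwise the first n + 1 powers
  form a set of full cardinality in dimension n.\<close>
proof (cases "inj (\<lambda>i. X ^ i)")
  case False
  then obtain i j where "i \<noteq> j" "X ^ i = X ^ j" by (auto simp: inj_on_def)
  then have "monom 1 i - monom 1 j \<noteq> (0::complex poly)"
    by (metis coeff_monom eq_iff_diff_eq_0 zero_neq_one)
  moreover have "mat_poly (monom 1 i + smult (-1) (monom 1 j)) X = 0"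
    using \<open>X ^ i = X ^ j\<close> by (simp only: mat_poly_add mat_poly_smult mat_poly_monom) (simp add: cs_minus)
  ultimately show ?thesis by (intro exI[of _ "monom 1 i - monom 1 j"]) (simp add: smult_minus_left)
next
  case True
  define n where "n = CARD('n \<times> 'n)"
  let ?g = "\<lambda>i. vecm (X ^ i)"
  have inj: "inj_on ?g {..n}" using True by (auto simp: inj_on_def vecm_inj)
  have "vec.dependent (?g ` {..n})"
  proof (rule vec.dependent_biggerset_general)
    have "vec.dim (?g ` {..n}) \<le> n"
      unfolding n_def vec_dim_card[symmetric, where 'a=complex] by (rule vec.dim_subset) simp
    then show "vec.dim (?g ` {..n}) < card (?g ` {..n})"
      by (simp add: card_image[OF inj])
  qed
  then obtain u where u: "\<exists>v\<in>?g ` {..n}. u v \<noteq> 0" "(\<Sum>v\<in>?g ` {..n}. u v *s v) = 0"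
    using vec.dependent_finite[of "?g ` {..n}"] by auto
  define q where "q = (\<Sum>i\<le>n. monom (u (?g i)) i)"
  have "mat_poly q X = (\<Sum>i\<le>n. cs (u (?g i)) * X ^ i)"
    by (simp add: q_def mat_poly_sum mat_poly_monom)
  moreover have "vecm \<dots> = (\<Sum>v\<in>?g ` {..n}. u v *s v)"
    by (simp add: vecm_sum vecm_cs sum.reindex[OF inj])
  ultimately have "mat_poly q X = 0" using u(2) by (metis vecm_0 vecm_inj)
  moreover have "q \<noteq> 0"
  proof
    assume "q = 0"
    from u(1) obtain i where i: "i \<le> n" "u (?g i) \<noteq> 0" by auto
    have "coeff q i = u (?g i)" using i(1)
      by (simp add: q_def coeff_sum coeff_monom sum.delta)
    with i \<open>q = 0\<close> show False by simp
  qed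
  ultimately show ?thesis by blast
qed

subsection \<open>Idempotents and nilpotents\<close>

lemma power_absorb:
  fixes X :: "'a::ring_1"
  assumes "X ^ N * Y = X ^ N"
  shows "X ^ N * Y ^ j = X ^ N"
proof (induction j)
  case (Suc j)
  then show ?case using assms by (simp add: power_Suc mult.assoc[symmetric])
qed simp

text \<open>Write an annihilating polynomial as t^m r with r(0) not 0, and normalize r to r0 (1 - t
  d). Then X d(X) acts as 1 behind X^N, and g = (t d)^N yields the projection onto the part where X
  is invertible, along the part where it is nilpotent.\<close>

lemma fitting:
  fixes X :: "'n::finite cmat"
  obtains g d :: "complex poly" and N where
    "poly g 0 = 0" "mat_poly g X * mat_poly g X = mat_poly g X" "X ^ N * mat_poly g X = X ^ N" "mat_poly g X = X ^ N * mat_poly d X" "N > 0"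
proof -
  obtain q where q: "q \<noteq> 0" "mat_poly q X = 0" using annihilating_poly by blast
  from order_decomp[OF q(1), of 0] obtain r where r: "q = [:0,1:] ^ order 0 q * r" "\<not> [:0,1:] dvd r"
    by auto
  obtain r0 r1 where r01: "r = pCons r0 r1" by (cases r)
  have r0: "r0 \<noteq> 0" using r(2) r01 poly_eq_0_iff_dvd[of r 0] by auto
  \<comment> \<open>One more than the multiplicity of the root 0, so that N > 0 and g(0) = 0 even
    for invertible X.\<close>
  define N where "N = Suc (order 0 q)"
  define d where "d = smult (- 1 / r0) r1"
  have "X ^ order 0 q * mat_poly r X = 0"
    using q(2) r(1) mat_poly_mult[of "[:0,1:] ^ order 0 q" r X] by (simp add: mat_poly_power)
  then have Nr: "X ^ N * mat_poly r X = 0" by (simp add: N_def mult.assoc)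
  have "cs r0 * (X ^ N * (1 - X * mat_poly d X)) = X ^ N * (cs r0 * (1 - X * mat_poly d X))"
    by (rule cs_left_commute[symmetric])
  also have "cs r0 * (1 - X * mat_poly d X) = mat_poly r X"
  proof -
    have "cs r0 * cs (- 1 / r0) = - (1 :: 'n cmat)"
      using r0 by (simp add: cs_minus flip: cs_mult)
    moreover have "cs r0 * (X * mat_poly d X) = cs r0 * cs (- 1 / r0) * (X * mat_poly r1 X)"
      by (simp only: d_def mat_poly_smult cs_left_commute[of X] mult.assoc)
    ultimately have "cs r0 * (X * mat_poly d X) = - (X * mat_poly r1 X)" by simp
    then show ?thesis by (simp add: r01 algebra_simps)
  qed
  finally have "X ^ N * (1 - X * mat_poly d X) = 0" using Nr r0 cs_cancel by fastforce
  then have XN: "X ^ N * (X * mat_poly d X) = X ^ N" by (simp add: algebra_simps)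
  define g where "g = ([:0,1:] * d) ^ N"
  have g: "mat_poly g X = (X * mat_poly d X) ^ N" by (simp add: g_def mat_poly_power mat_poly_mult)
  have g2: "mat_poly g X = X ^ N * mat_poly (d ^ N) X"
    by (simp only: g_def power_mult_distrib mat_poly_mult mat_poly_power) simp
  have XNg: "X ^ N * mat_poly g X = X ^ N" unfolding g by (rule power_absorb[OF XN])
  have "mat_poly g X * mat_poly g X = X ^ N * mat_poly g X * mat_poly (d ^ N) X"
    using g2 by (metis mult.assoc mat_poly_commute)
  then have "mat_poly g X * mat_poly g X = mat_poly g X" using XNg g2 by simp
  moreover have "poly g 0 = 0" by (simp add: g_def N_def)
  ultimately show thesis using that[OF _ _ XNg g2] by (simp add: N_def)
qed

lemma von_neumann_regular:
  fixes X :: "'n::finite cmat"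
  obtains Y where "X * Y * X = X"
proof -
  have "Vector_Spaces.linear (*s) (*s) (act X)" using act_clin[of X] by (simp add: clin_def)
  from vec.linear_exists_right_inverse_on[OF this vec.subspace_UNIV]
  obtain g where g: "Vector_Spaces.linear (*s) (*s) g" "\<And>v. act X (g (act X v)) = act X v"
    by auto
  have "X * endo g * X = X"
    by (rule cmat_ext) (simp add: act_mult act_endo clin_def g)
  then show thesis by (rule that)
qed

text \<open>With e = X Y and e X = X, the matrix X e has the trace of X, while (X e)^N = X^N e =
  X^(N+1) Y for N > 0. So the exponent drops by one.\<close>

lemma tr_nilpotent: "X ^ N = 0 \<Longrightarrow> tr X = 0"
proof (induction N arbitrary: X)
  case (Suc N)
  obtain Y where Y: "X * Y * X = X" by (rule von_neumann_regular)
  define e where "e = X * Y"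
  have eX: "e * X = X" by (simp add: e_def Y)
  have pow: "(X * e) ^ Suc n = X ^ Suc n * e" for n
  proof (induction n)
    case (Suc n)
    have "(X * e) ^ Suc (Suc n) = X * (e * X) * X ^ n * e"
      by (simp only: power_Suc[of "X * e" "Suc n"] Suc) (simp add: mult.assoc)
    then show ?case by (simp add: eX mult.assoc)
  qed simp
  show ?case
  proof (cases N)
    case 0
    then show ?thesis using Suc.prems by simp
  next
    case (Suc n)
    have "X ^ N * e = X ^ N * X * Y" by (simp add: e_def mult.assoc)
    also have "\<dots> = 0" using Suc.prems by (metis mult_zero_left power_Suc2)
    finally have "(X * e) ^ N = 0" using pow[of n] Suc by simp
    then have "tr (X * e) = 0" by (rule Suc.IH)
    then show ?thesis using eX tr_comm by metis
  qed
qed simp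

text \<open>Induction on the rank: a nonzero e contains an idempotent q of trace 1 with e q = q e =
  q, and e - q has a smaller range.\<close>

lemma tr_idempotent_nat:
  fixes e :: "'n::finite cmat"
  shows "e * e = e \<Longrightarrow> \<exists>n. tr e = of_nat n \<and> (n = 0 \<longrightarrow> e = 0)"
proof (induction "vec.dim (range (act e))" arbitrary: e rule: less_induct)
  case less
  show ?case
  proof (cases "e = 0")
    case False
    then obtain v0 where "act e v0 \<noteq> 0" by (metis act_0 cmat_ext)
    define v where "v = act e v0"
    have v: "v \<noteq> 0" "act e v = v"
      using \<open>act e v0 \<noteq> 0\<close> less.prems by (simp_all add: v_def flip: act_mult)
    obtain i where i: "v $ i \<noteq> 0" using v(1) by (auto simp: vec_eq_iff)
    \<comment> \<open>The projection onto the line of v along the vectors with i-th coordinate 0;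
      composing it with e makes it commute with e.\<close>
    define q0 where "q0 = Cm (\<chi> a b. v $ a * (if b = i then 1 / v $ i else 0))"
    have q0: "act q0 w = (w $ i / v $ i) *s v" for w
      by (simp add: act_def q0_def Cm_inverse vec_eq_iff matrix_vector_mult_def if_distrib if_distribR sum.delta cong: if_cong)
    have trq0: "tr q0 = 1"
      using i by (simp add: tr_def q0_def Cm_inverse trace_def if_distrib if_distribR sum.delta cong: if_cong)
    define q where "q = q0 * e"
    have eq0: "e * q0 = q0"
      by (rule cmat_ext) (simp add: act_mult q0 act_scale v)
    have q0q0: "q0 * q0 = q0"
      using i by (intro cmat_ext) (simp add: act_mult q0)
    have q1: "q * e = q" "e * q = q" "q * q = q"
      using less.prems eq0 q0q0 by (simp_all add: q_def mult.assoc) (metis mult.assoc, metis mult.assoc)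
    have trq: "tr q = 1" unfolding q_def using trq0 eq0 tr_comm by metis
    have qv: "act q v = v" using i by (simp add: q_def act_mult v q0)
    have idem: "(e - q) * (e - q) = e - q"
      using less.prems q1 by (simp add: algebra_simps)
    have sub: "vec.subspace (range (act (X::'n cmat)))" for X
      using act_clin[of X] vec.subspace_UNIV by (metis clin_def vec.linear_subspace_image)
    have "range (act (e - q)) \<subseteq> range (act e)"
    proof
      fix w assume "w \<in> range (act (e - q))"
      then obtain u where "w = act (e - q) u" by auto
      then have "act e w = w" using less.prems q1 by (simp add: right_diff_distrib flip: act_mult)
      then show "w \<in> range (act e)" by (metis rangeI)
    qed
    moreover have "v \<notin> range (act (e - q))"
    proof
      assume "v \<in> range (act (e - q))"
      then obtain u where "v = act (e - q) u" by auto
      then have "act q v = 0" using q1 by (simp add: right_diff_distrib flip: act_mult)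
      then show False using qv v by simp
    qed
    moreover have "v \<in> range (act e)" using v(2) by (metis rangeI)
    ultimately have "range (act (e - q)) \<subset> range (act e)" by blast
    then have "vec.dim (range (act (e - q))) < vec.dim (range (act e))"
      by (intro vec.dim_psubset) (simp add: vec.span_eq_iff[THEN iffD2, OF sub])
    from less.hyps[OF this idem] obtain n where "tr (e - q) = of_nat n" by blast
    then have "tr e = of_nat (Suc n)" using trq by (simp add: tr_diff algebra_simps)
    then show ?thesis by blast
  qed (use tr_0 in force)
qed

text \<open>The trace of an idempotent is its rank; on other matrices the value is irrelevant.\<close>

definition rk :: "'n::finite cmat \<Rightarrow> nat" where
  "rk e = (SOME n. tr e = of_nat n)"

lemma tr_idempotent: "e * e = e \<Longrightarrow> tr e = of_nat (rk e)"
  unfolding rk_def using tr_idempotent_nat[of e] by (metis (mono_tags, lifting) someI_ex)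

lemma rk_pos: "e * e = e \<Longrightarrow> e \<noteq> 0 \<Longrightarrow> rk e > 0"
  using tr_idempotent[of e] tr_idempotent_nat[of e] by (metis gr0I of_nat_eq_iff)

text \<open>The Fitting idempotent g(X) has g(0) = 0, so it is a combination of positive powers and
  has trace 0. Thus it is 0, and X^N = X^N g(X) = 0.\<close>

lemma nilpotent_if_power_traces_0:
  fixes X :: "'n::finite cmat"
  assumes "\<And>k. tr (X ^ Suc k) = 0"
  shows "\<exists>N. X ^ N = 0"
proof -
  obtain g d N where g: "poly g 0 = 0" "mat_poly g X * mat_poly g X = mat_poly g X" "X ^ N * mat_poly g X = X ^ N"
    by (rule fitting)
  obtain g' where g': "g = pCons 0 g'" using g(1) by (cases g) auto
  have "tr (X ^ Suc j * mat_poly h X) = 0" for j h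
  proof (induction h arbitrary: j)
    case (pCons a h)
    have "tr (X ^ Suc j * (X * mat_poly h X)) = 0"
      using pCons(2)[of "Suc j"] by (metis mult.assoc power_Suc2)
    moreover have "tr (X ^ Suc j * cs a) = 0" using assms[of j] by (metis cs_commute mult_zero_right tr_cs)
    ultimately show ?case by (simp add: distrib_left tr_add)
  qed simp
  from this[of 0 g'] have "tr (mat_poly g X) = 0" by (simp add: g')
  then have "mat_poly g X = 0" using g(2) tr_idempotent_nat by fastforce
  then show ?thesis using g(3) by auto
qed

section \<open>The Sylvester operator and the transport of nilpotency\<close>

definition sylv :: "'a::ring_1 \<Rightarrow> 'a \<Rightarrow> 'a \<Rightarrow> 'a" where
  "sylv A B Z = A * Z - Z * B"

lemma sylv_left_mult: "C * A = A * C \<Longrightarrow> ((sylv A B) ^^ m) (C * Z) = C * ((sylv A B) ^^ m) Z"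
proof (induction m)
  case (Suc m)
  have "A * (C * W) = C * (A * W)" for W using Suc.prems by (metis mult.assoc)
  then show ?case using Suc by (simp add: sylv_def right_diff_distrib mult.assoc)
qed simp

lemma sylv_right_mult: "C * B = B * C \<Longrightarrow> ((sylv A B) ^^ m) (Z * C) = ((sylv A B) ^^ m) Z * C"
proof (induction m)
  case (Suc m)
  have "W * C * B = W * B * C" for W using Suc.prems by (metis mult.assoc)
  then show ?case using Suc by (simp add: sylv_def left_diff_distrib mult.assoc)
qed simp

text \<open>Left multiplication by A, right multiplication by B and \<open>sylv A B\<close> commute.
  In Z B = A Z - \<open>sylv A B Z\<close>, each summand improves one of the two bounds and keeps
  the other, so m + N goes down.\<close>

lemma sylv_nilpotent_right:
  assumes "((sylv A B) ^^ m) Z = 0" "A ^ N * Z = 0"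
  shows "Z * B ^ (m + N) = 0"
proof -
  have "\<And>m N Z. m + N = s \<Longrightarrow> ((sylv A B) ^^ m) Z = 0 \<Longrightarrow> A ^ N * Z = 0 \<Longrightarrow> Z * B ^ s = 0" for s
  proof (induction s)
    case (Suc s)
    show ?case
    proof (cases "m = 0 \<or> N = 0")
      case False
      then obtain m' N' where mN: "m = Suc m'" "N = Suc N'" by (metis not0_implies_Suc)
      have "A * Z * B ^ s = 0"
      proof (rule Suc.IH)
        show "m + N' = s" using Suc.prems(1) mN by simp
        show "((sylv A B) ^^ m) (A * Z) = 0" using Suc.prems(2) by (simp add: sylv_left_mult[OF refl])
        show "A ^ N' * (A * Z) = 0" using Suc.prems(3) mN by (simp add: mult.assoc[symmetric] power_commutes)
      qed
      moreover have "sylv A B Z * B ^ s = 0"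
      proof (rule Suc.IH)
        show "m' + N = s" using Suc.prems(1) mN by simp
        show "((sylv A B) ^^ m') (sylv A B Z) = 0" using Suc.prems(2) mN by (simp add: funpow_swap1)
        have "A ^ N * sylv A B Z = A * (A ^ N * Z) - A ^ N * Z * B"
          by (simp add: sylv_def right_diff_distrib mult.assoc[symmetric] power_commutes)
        then show "A ^ N * sylv A B Z = 0" using Suc.prems(3) by simp
      qed
      ultimately have "Z * B * B ^ s = 0" by (simp add: sylv_def left_diff_distrib)
      then show ?thesis by (simp add: mult.assoc)
    qed (use Suc.prems in auto)
  qed simp
  then show ?thesis using assms by blast
qed

lemma sylv_nilpotent_left:
  assumes "((sylv A B) ^^ m) Z = 0" "Z * B ^ N = 0"
  shows "A ^ (m + N) * Z = 0"
proof -
  have "\<And>m N Z. m + N = s \<Longrightarrow> ((sylv A B) ^^ m) Z = 0 \<Longrightarrow> Z * B ^ N = 0 \<Longrightarrow> A ^ s * Z = 0" for s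
  proof (induction s)
    case (Suc s)
    show ?case
    proof (cases "m = 0 \<or> N = 0")
      case False
      then obtain m' N' where mN: "m = Suc m'" "N = Suc N'" by (metis not0_implies_Suc)
      have "A ^ s * (Z * B) = 0"
      proof (rule Suc.IH)
        show "m + N' = s" using Suc.prems(1) mN by simp
        show "((sylv A B) ^^ m) (Z * B) = 0" using Suc.prems(2) by (simp add: sylv_right_mult[OF refl])
        show "Z * B * B ^ N' = 0" using Suc.prems(3) mN by (simp add: mult.assoc)
      qed
      moreover have "A ^ s * sylv A B Z = 0"
      proof (rule Suc.IH)
        show "m' + N = s" using Suc.prems(1) mN by simp
        show "((sylv A B) ^^ m') (sylv A B Z) = 0" using Suc.prems(2) mN by (simp add: funpow_swap1)
        have "sylv A B Z * B ^ N = A * (Z * B ^ N) - Z * B ^ N * B"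
          by (simp add: sylv_def left_diff_distrib mult.assoc power_commutes)
        then show "sylv A B Z * B ^ N = 0" using Suc.prems(3) by simp
      qed
      ultimately have "A ^ s * (A * Z) = 0" by (simp add: sylv_def right_diff_distrib)
      then show ?thesis by (metis mult.assoc power_Suc2)
    qed (use Suc.prems in auto)
  qed simp
  then show ?thesis using assms by blast
qed

lemma coprime_shift_vector:
  assumes "P - Q = cs c" "c \<noteq> 0" "act (P ^ m) v = 0" "act (Q ^ N) v = 0"
  shows "v = 0"
proof -
  have "\<And>m N v. m + N = s \<Longrightarrow> act (P ^ m) v = 0 \<Longrightarrow> act (Q ^ N) v = 0 \<Longrightarrow> v = 0" for s
  proof (induction s)
    case (Suc s)
    show ?case
    proof (cases "m = 0 \<or> N = 0")
      case False
      then obtain m' N' where mN: "m = Suc m'" "N = Suc N'" by (metis not0_implies_Suc)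
      have PQ: "P * Q = Q * P" using assms(1) by (metis add_diff_cancel cs_commute diff_add_cancel distrib_left distrib_right)
      have "act P v = 0"
      proof (rule Suc.IH)
        show "m' + N = s" using Suc.prems(1) mN by simp
        show "act (P ^ m') (act P v) = 0"
          using Suc.prems(2) mN by (simp flip: act_mult add: power_commutes)
        have "Q ^ N * P = P * Q ^ N" using PQ by (metis power_commuting_commutes)
        then show "act (Q ^ N) (act P v) = 0"
          using Suc.prems(3) by (metis act_mult act_v0)
      qed
      moreover have "act Q v = 0"
      proof (rule Suc.IH)
        show "m + N' = s" using Suc.prems(1) mN by simp
        show "act (Q ^ N') (act Q v) = 0"
          using Suc.prems(3) mN by (simp flip: act_mult add: power_commutes)
        have "P ^ m * Q = Q * P ^ m" using PQ by (metis power_commuting_commutes)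
        then show "act (P ^ m) (act Q v) = 0"
          using Suc.prems(2) by (metis act_mult act_v0)
      qed
      ultimately have "act (P - Q) v = 0" by (simp add: act_diff)
      then show ?thesis using assms by simp
    qed (use Suc.prems in auto)
  qed simp
  then show ?thesis using assms by blast
qed

text \<open>\<mu> is a root of the least polynomial that annihilates X on the range of e; cancelling
  its factor leaves a nonzero Z. The columns of Z are eigenvectors or 0.\<close>

lemma eigenvalue_on_idempotent:
  fixes X e :: "'n::finite cmat"
  assumes "e * e = e" "e \<noteq> 0" "X * e = e * X"
  obtains \<mu> Z where "Z \<noteq> 0" "e * Z = Z" "(X - cs \<mu>) * Z = 0"
proof -
  let ?P = "\<lambda>q. q \<noteq> 0 \<and> mat_poly q X * e = 0"
  have "\<exists>q. ?P q" using annihilating_poly[of X] by force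
  then obtain q where q: "?P q" and least: "\<And>r. ?P r \<Longrightarrow> degree q \<le> degree r"
    using ex_has_least_nat[of ?P _ degree] by metis
  have "degree q > 0"
  proof (rule ccontr)
    assume "\<not> degree q > 0"
    then obtain c where "q = [:c:]" by (metis degree_eq_zeroE not_gr_zero)
    with q assms(2) cs_cancel[of c e] show False by auto
  qed
  then obtain \<mu> where "poly q \<mu> = 0" using alg_closed_imp_poly_has_root by blast
  then obtain r where r: "q = [:-\<mu>,1:] * r" by (metis dvdE poly_eq_0_iff_dvd)
  have "r \<noteq> 0" using q r by auto
  then have "degree q = Suc (degree r)" unfolding r by (subst degree_mult_eq) auto
  then have "mat_poly r X * e \<noteq> 0" using least[of r] \<open>r \<noteq> 0\<close> by force
  moreover have "e * (mat_poly r X * e) = mat_poly r X * e"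
    using assms by (metis mult.assoc mat_poly_commute)
  moreover have "(X - cs \<mu>) * (mat_poly r X * e) = 0"
    using q r mat_poly_mult[of "[:-\<mu>,1:]" r X] by (simp add: cs_minus mult.assoc)
  ultimately show thesis using that by blast
qed

subsection \<open>Determinants and traces\<close>

lift_definition cdet :: "'n::finite cmat \<Rightarrow> complex" is det .

lemma cdet_mult: "cdet (X * Y) = cdet X * cdet Y"
  by transfer (rule det_mul)

lemma cdet_derivative_at_1:
  "((\<lambda>s. cdet (1 + cs s * M)) has_field_derivative tr M) (at 0)"
proof -
  define A where "A = mat_of M"
  let ?U = "UNIV :: 'a set"
  let ?d = "\<lambda>i j::'a. (if i = j then 1 else 0) :: complex"
  have comp: "mat_of (1 + cs s * M) $ i $ j = ?d i j + s * A $ i $ j" for s i j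
    by (simp add: plus_cmat.rep_eq times_cmat.rep_eq cs.rep_eq one_cmat.rep_eq A_def flip: smat_mat)
       (simp add: smat_def mat_def)
  have eq: "cdet (1 + cs s * M) = (\<Sum>p | p permutes ?U. of_int (sign p) * (\<Prod>i\<in>?U. ?d i (p i) + s * A $ i $ p i))" for s
    by (simp add: cdet.rep_eq det_def comp)
  have D: "((\<lambda>s. \<Prod>i\<in>?U. ?d i (p i) + s * A $ i $ p i) has_field_derivative
      (\<Sum>i\<in>?U. A $ i $ p i * (\<Prod>j\<in>?U - {i}. ?d j (p j)))) (at 0)" for p
    by (rule DERIV_cong[OF has_field_derivative_prod[where f' = "\<lambda>i. A $ i $ p i"]])
       (auto intro!: derivative_eq_intros)
  have "((\<lambda>s. cdet (1 + cs s * M)) has_field_derivative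
      (\<Sum>p | p permutes ?U. of_int (sign p) * (\<Sum>i\<in>?U. A $ i $ p i * (\<Prod>j\<in>?U - {i}. ?d j (p j))))) (at 0)"
    unfolding eq by (intro DERIV_sum DERIV_cmult D)
  also have "(\<Sum>p | p permutes ?U. of_int (sign p) * (\<Sum>i\<in>?U. A $ i $ p i * (\<Prod>j\<in>?U - {i}. ?d j (p j))))
      = (\<Sum>p | p permutes ?U. if p = id then tr M else 0)"
  proof (rule sum.cong[OF refl])
    fix p :: "'a \<Rightarrow> 'a" assume "p \<in> {p. p permutes ?U}"
    then have inj: "inj p" by (simp add: permutes_inj)
    show "of_int (sign p) * (\<Sum>i\<in>?U. A $ i $ p i * (\<Prod>j\<in>?U - {i}. ?d j (p j))) = (if p = id then tr M else 0)"
    proof (cases "p = id")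
      case True
      then show ?thesis by (simp add: sign_id tr_def trace_def A_def)
    next
      case False
      then obtain k where k: "p k \<noteq> k" by (auto simp: fun_eq_iff)
      \<comment> \<open>A permutation other than the identity moves both k and p k, so after the
        deletion of one factor an off-diagonal factor remains, which is 0 at s = 0.\<close>
      have "(\<Prod>j\<in>?U - {i}. ?d j (p j)) = 0" for i
      proof (cases "i = k")
        case True
        then have "p k \<in> ?U - {i}" "?d (p k) (p (p k)) = 0" using k inj by (auto simp: inj_eq)
        then show ?thesis by (intro prod_zero) (simp, blast)
      next
        case False
        then have "k \<in> ?U - {i}" "?d k (p k) = 0" using k by auto
        then show ?thesis by (intro prod_zero) (simp, blast)
      qed
      then show ?thesis using False by (simp only: mult_zero_right sum.neutral_const if_False)
    qed
  qed
  also have "\<dots> = tr M" by (simp add: sum.delta finite_permutations permutes_id)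
  finally show ?thesis .
qed

lemma cdet_cs: "cdet (cs c :: 'n::finite cmat) = c ^ CARD('n)"
  by (simp add: cdet.rep_eq cs.rep_eq det_diagonal mat_def)

text \<open>Splitting q into linear factors gives det q(X) = det q(Y) for all q; equal sizes enter
  through the constant factor. Differentiating at s = 0 for q = 1 + s t^k yields the traces.\<close>

lemma charpoly_eq_imp_power_traces_eq:
  fixes X :: "'n::finite cmat" and Y :: "'m::finite cmat"
  assumes ch: "\<And>z. cdet (cs z + X) = cdet (cs z + Y)" and card: "CARD('n) = CARD('m)"
  shows "tr (X ^ k) = tr (Y ^ k)"
proof -
  have "cdet (mat_poly q X) = cdet (mat_poly q Y)" for q
  proof (induction "degree q" arbitrary: q rule: less_induct)
    case less
    show ?case
    proof (cases "degree q = 0")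
      case True
      then obtain c where "q = [:c:]" by (metis degree_eq_zeroE)
      then show ?thesis by (simp add: cdet_cs card)
    next
      case False
      then obtain \<mu> where "poly q \<mu> = 0" using alg_closed_imp_poly_has_root by blast
      then obtain r where r: "q = [:-\<mu>,1:] * r" by (metis dvdE poly_eq_0_iff_dvd)
      have "r \<noteq> 0" using False r by auto
      then have "degree q = Suc (degree r)" unfolding r by (subst degree_mult_eq) auto
      then have "cdet (mat_poly r X) = cdet (mat_poly r Y)" using less by simp
      moreover have "cdet (mat_poly [:-\<mu>,1:] X) = cdet (mat_poly [:-\<mu>,1:] Y)" using ch by simp
      ultimately show ?thesis unfolding r mat_poly_mult cdet_mult by simp
    qed
  qed
  from this[of "1 + smult s (monom 1 k)" for s]
  have "cdet (1 + cs s * X ^ k) = cdet (1 + cs s * Y ^ k)" for s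
    by (simp add: mat_poly_add mat_poly_smult mat_poly_monom)
  then have "(\<lambda>s. cdet (1 + cs s * X ^ k)) = (\<lambda>s. cdet (1 + cs s * Y ^ k))" by blast
  then show ?thesis using cdet_derivative_at_1 DERIV_unique by metis
qed

section \<open>Vanishing by coprime shifts, and a stronger Fitting idempotent\<close>

lemma coprime_shift_right:
  assumes "P - Q = cs c" "c \<noteq> 0" "Z * P ^ m = 0" "Z * Q ^ N = 0"
  shows "Z = 0"
proof -
  have Q: "cs c = P - Q" using assms(1) by simp
  \<comment> \<open>With the scalar c = P - Q as left factor, \<open>sylv\<close> becomes W -> - W
    Q, so nilpotency under Q is nilpotency under \<open>sylv\<close>, and c^(N + m) Z = 0
    follows.\<close>
  have "((sylv (cs c) P) ^^ k) Z = (-1) ^ k * (Z * Q ^ k)" for k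
  proof (induction k)
    case (Suc k)
    have "sylv (cs c) P W = - (W * Q)" for W
      unfolding sylv_def cs_commute by (simp add: Q algebra_simps)
    with Suc show ?case by (simp add: mult.assoc power_commutes)
  qed simp
  then have "((sylv (cs c) P) ^^ N) Z = 0" using assms(4) by simp
  then have "cs c ^ (N + m) * Z = 0" using assms(3) by (rule sylv_nilpotent_left)
  then show ?thesis using assms(2) cs_cancel[of "c ^ (N + m)" Z] by (simp add: cs_power)
qed

lemma sylv_vector:
  assumes "((sylv A B) ^^ m) Z = 0" "act (B ^ N) y = 0"
  shows "act (A ^ (m + N)) (act Z y) = 0"
proof -
  have "\<And>m N Z y. m + N = s \<Longrightarrow> ((sylv A B) ^^ m) Z = 0 \<Longrightarrow> act (B ^ N) y = 0 \<Longrightarrow> act (A ^ s) (act Z y) = 0" for s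
  proof (induction s)
    case (Suc s)
    show ?case
    proof (cases "m = 0 \<or> N = 0")
      case False
      then obtain m' N' where mN: "m = Suc m'" "N = Suc N'" by (metis not0_implies_Suc)
      have "act (A ^ s) (act Z (act B y)) = 0"
        using Suc.prems mN by (intro Suc.IH[of m N']) (auto simp: power_commutes simp flip: act_mult)
      moreover have "act (A ^ s) (act (sylv A B Z) y) = 0"
        using Suc.prems mN by (intro Suc.IH[of m' N]) (auto simp: funpow_swap1)
      ultimately have "act (A ^ s) (act (A * Z) y) = 0"
        by (simp add: sylv_def act_diff act_vdiff act_mult)
      then show ?thesis by (simp only: act_mult power_Suc2)
    qed (use Suc.prems in auto)
  qed simp
  then show ?thesis using assms by blast
qed

text \<open>As g(X) is idempotent and divisible by X^N with N > 0, it equals g(X)^(M + 1) and is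
  divisible by X^M for every M, on either side. So it absorbs any nilpotency bound.\<close>

lemma fitting_idempotent:
  fixes X :: "'n::finite cmat"
  obtains g N where "poly g 0 = 0" "mat_poly g X * mat_poly g X = mat_poly g X" "X ^ N * mat_poly g X = X ^ N"
    "\<forall>M W. W * X ^ M = 0 \<longrightarrow> W * mat_poly g X = 0" "\<forall>M W. X ^ M * W = 0 \<longrightarrow> mat_poly g X * W = 0"
proof -
  obtain g d N where g: "poly g 0 = 0" "mat_poly g X * mat_poly g X = mat_poly g X" "X ^ N * mat_poly g X = X ^ N"
      "mat_poly g X = X ^ N * mat_poly d X" "N > 0"
    by (rule fitting)
  have p1: "\<exists>V. mat_poly g X = X ^ M * V \<and> mat_poly g X = V * X ^ M" for M
  proof -
    define v where "v = [:0,1:] ^ (N * Suc M - M) * d ^ Suc M"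
    have "M \<le> N * Suc M" using g(5) by (cases N) auto
    then have "([:0,1:] ^ N * d) ^ Suc M = [:0,1:] ^ M * v"
      by (simp only: v_def power_mult_distrib power_mult[symmetric] mult.assoc[symmetric] power_add[symmetric]) simp
    moreover have "mat_poly g X = mat_poly g X ^ Suc M" using g(2) by (induction M) (auto simp: mult.assoc[symmetric])
    moreover have "mat_poly g X = mat_poly ([:0,1:] ^ N * d) X" using g(4) by (simp add: mat_poly_mult mat_poly_power)
    ultimately have "mat_poly g X = mat_poly ([:0,1:] ^ M * v) X" by (metis mat_poly_power)
    then have "mat_poly g X = X ^ M * mat_poly v X" by (simp add: mat_poly_mult mat_poly_power)
    moreover have "mat_poly v X * X ^ M = X ^ M * mat_poly v X"
      by (rule mat_poly_commute) (simp add: power_commutes)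
    ultimately show ?thesis by metis
  qed
  show thesis
  proof (rule that[OF g(1-3)]; intro allI impI)
    fix M W assume "W * X ^ M = 0"
    then show "W * mat_poly g X = 0" using p1[of M] by (metis mult.assoc mult_zero_left)
  next
    fix M W assume "X ^ M * W = 0"
    then show "mat_poly g X * W = 0" using p1[of M] by (metis mult.assoc mult_zero_right)
  qed
qed

subsection \<open>Representations and weight decompositions\<close>

definition rep :: "(complex^'d \<Rightarrow> complex^'d \<Rightarrow> complex^'d) \<Rightarrow> (complex^'d \<Rightarrow> 'k::finite cmat) \<Rightarrow> bool" where
  "rep B \<rho> \<longleftrightarrow> (\<forall>x y. \<rho> (x + y) = \<rho> x + \<rho> y) \<and> (\<forall>c x. \<rho> (c *s x) = cs c * \<rho> x) \<and>
     (\<forall>x y. \<rho> (B x y) = \<rho> x * \<rho> y - \<rho> y * \<rho> x)"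

lemma rep_add: "rep B \<rho> \<Longrightarrow> \<rho> (x + y) = \<rho> x + \<rho> y"
  and rep_scale: "rep B \<rho> \<Longrightarrow> \<rho> (c *s x) = cs c * \<rho> x"
  and rep_bracket: "rep B \<rho> \<Longrightarrow> \<rho> (B x y) = \<rho> x * \<rho> y - \<rho> y * \<rho> x"
  by (auto simp: rep_def)

lemma rep_0: "rep B \<rho> \<Longrightarrow> \<rho> 0 = 0"
  using rep_scale[of B \<rho> 0 0] by simp
lemma rep_minus: "rep B \<rho> \<Longrightarrow> \<rho> (- x) = - \<rho> x"
  using rep_scale[of B \<rho> "-1" x] by (simp add: cs_minus)
lemma rep_diff: "rep B \<rho> \<Longrightarrow> \<rho> (x - y) = \<rho> x - \<rho> y"
  using rep_add[of B \<rho> x "- y"] by (simp add: rep_minus)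
lemma rep_sum: "rep B \<rho> \<Longrightarrow> \<rho> (\<Sum>i\<in>I. x i) = (\<Sum>i\<in>I. \<rho> (x i))"
  by (induction I rule: infinite_finite_induct) (auto simp: rep_add rep_0)

definition ad :: "(complex^'d \<Rightarrow> complex^'d \<Rightarrow> complex^'d) \<Rightarrow> complex^'d \<Rightarrow> 'd cmat" where
  "ad B x = endo (B x)"

locale lie_alg =
  fixes B :: "complex^'d \<Rightarrow> complex^'d \<Rightarrow> complex^'d"
  assumes lie: "lie_algebra B"
begin

lemma B_right: "clin (B x)" and B_left: "clin (\<lambda>x. B x y)"
  and B_self [simp]: "B x x = 0"
  and jacobi: "B x (B y z) + B y (B z x) + B z (B x y) = 0"
  using lie by (auto simp: lie_algebra_def)

lemma B_add_right: "B x (y + z) = B x y + B x z" using B_right by (rule clin_add)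
lemma B_add_left: "B (x + y) z = B x z + B y z" using clin_add[OF B_left] .
lemma B_scale_right: "B x (c *s z) = c *s B x z" using B_right by (rule clin_scale)
lemma B_scale_left: "B (c *s x) z = c *s B x z" using clin_scale[OF B_left] .
lemma B_0_right [simp]: "B x 0 = 0" using B_right by (rule clin_0)
lemma B_0_left [simp]: "B 0 x = 0" using clin_0[OF B_left] .
lemma B_minus_right: "B x (- z) = - B x z" using B_right by (rule clin_minus)
lemma B_sum_right: "B x (\<Sum>i\<in>I. z i) = (\<Sum>i\<in>I. B x (z i))"
  by (induction I rule: infinite_finite_induct) (auto simp: B_add_right)
lemma B_sum_left: "B (\<Sum>i\<in>I. z i) x = (\<Sum>i\<in>I. B (z i) x)"
  by (induction I rule: infinite_finite_induct) (auto simp: B_add_left)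

lemma B_anti: "B y x = - B x y"
proof -
  have "B x y + B y x = B (x + y) (x + y)" by (simp add: B_add_left B_add_right del: B_self) (simp)
  then show ?thesis by (metis B_self add_eq_0_iff)
qed

lemma act_ad [simp]: "act (ad B x) y = B x y"
  by (simp add: ad_def act_endo B_right)

lemma jacobi': "B x (B y z) = B (B x y) z + B y (B x z)"
proof -
  have "B y (B z x) = - B y (B x z)" by (metis B_anti B_minus_right)
  moreover have "B z (B x y) = - B (B x y) z" by (rule B_anti)
  ultimately show ?thesis using jacobi[of x y z] by (simp add: algebra_simps)
qed

lemma rep_ad: "rep B (ad B)"
  unfolding rep_def
proof (intro conjI allI cmat_ext)
  fix x y v
  show "act (ad B (B x y)) v = act (ad B x * ad B y - ad B y * ad B x) v"
    using jacobi'[of x y v] by (simp add: act_mult act_diff)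
qed (simp_all add: act_add act_mult B_add_left B_scale_left)

text \<open>Generalized weight spaces, with an exponent depending on \<open>h\<close> and
  \<open>x\<close>: diagonalizable action of \<open>H\<close> is established only in
  \<open>wspace_eigen\<close>.\<close>

definition wspace :: "(complex^'d) set \<Rightarrow> (complex^'d \<Rightarrow> complex) \<Rightarrow> (complex^'d) set" where
  "wspace H \<alpha> = {x. \<forall>h\<in>H. \<exists>N. act ((ad B h - cs (\<alpha> h)) ^ N) x = 0}"

text \<open>The commutator of \<open>\<rho> h\<close> and \<open>\<rho> y\<close> is
  \<open>\<rho> (B h y)\<close>, and \<nu>, \<mu> only add a shift. This turns nilpotency of
  \<open>ad B h\<close> on x into a statement about blocks of the matrix
  \<open>\<rho> x\<close>.\<close>

lemma rep_sylv:
  assumes "rep B \<rho>"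
  shows "((sylv (\<rho> h - cs \<nu>) (\<rho> h - cs \<mu>)) ^^ m) (\<rho> x) = \<rho> (act ((ad B h - cs (\<nu> - \<mu>)) ^ m) x)"
proof (induction m)
  case (Suc m)
  have "sylv (\<rho> h - cs \<nu>) (\<rho> h - cs \<mu>) (\<rho> y) = \<rho> (act (ad B h - cs (\<nu> - \<mu>)) y)" for y
    by (simp add: sylv_def act_diff rep_diff[OF assms] rep_bracket[OF assms] rep_scale[OF assms]
        left_diff_distrib right_diff_distrib cs_commute[of _ "\<rho> y"] cs_diff)
  with Suc show ?case by (simp add: act_mult)
qed simp

lemma wspace_cong: "(\<And>h. h \<in> H \<Longrightarrow> \<alpha> h = \<beta> h) \<Longrightarrow> wspace H \<alpha> = wspace H \<beta>"
  by (simp add: wspace_def)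

lemma wspace_add:
  assumes "x \<in> wspace H \<alpha>" "y \<in> wspace H \<alpha>"
  shows "x + y \<in> wspace H \<alpha>"
  unfolding wspace_def
proof safe
  fix h assume "h \<in> H"
  then obtain N M where N: "act ((ad B h - cs (\<alpha> h)) ^ N) x = 0" "act ((ad B h - cs (\<alpha> h)) ^ M) y = 0"
    using assms unfolding wspace_def by blast
  have "act ((ad B h - cs (\<alpha> h)) ^ (M + N)) x = 0" using N by (simp add: power_add act_mult)
  moreover have "act ((ad B h - cs (\<alpha> h)) ^ (M + N)) y = 0"
    using N by (subst add.commute) (simp add: power_add act_mult)
  ultimately show "\<exists>N. act ((ad B h - cs (\<alpha> h)) ^ N) (x + y) = 0"
    by (metis act_vadd add.right_neutral)
qed

lemma wspace_scale: "x \<in> wspace H \<alpha> \<Longrightarrow> c *s x \<in> wspace H \<alpha>"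
  by (fastforce simp: wspace_def act_scale)

lemma wspace_bracket:
  assumes "x \<in> wspace H \<alpha>" "y \<in> wspace H \<beta>"
  shows "B x y \<in> wspace H (\<lambda>h. \<alpha> h + \<beta> h)"
  unfolding wspace_def
proof safe
  fix h assume "h \<in> H"
  then obtain N M where N: "act ((ad B h - cs (\<alpha> h)) ^ N) x = 0" "act ((ad B h - cs (\<beta> h)) ^ M) y = 0"
    using assms unfolding wspace_def by blast
  have "((sylv (ad B h - cs (\<alpha> h + \<beta> h)) (ad B h - cs (\<beta> h))) ^^ N) (ad B x) = 0"
    by (subst rep_sylv[OF rep_ad]) (simp add: N rep_0[OF rep_ad])
  from sylv_vector[OF this N(2)] show "\<exists>N. act ((ad B h - cs (\<alpha> h + \<beta> h)) ^ N) (B x y) = 0"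
    by (metis act_ad)
qed

end

text \<open>A family of orthogonal idempotents with sum \<open>e\<close>, indexed by itself; several members may share a
  weight. Weights vanish outside \<open>H\<close>, as do the roots.\<close>

definition weight_system :: "(complex^'d \<Rightarrow> 'k::finite cmat) \<Rightarrow> (complex^'d) set \<Rightarrow> 'k cmat \<Rightarrow> 'k cmat set
    \<Rightarrow> ('k cmat \<Rightarrow> complex^'d \<Rightarrow> complex) \<Rightarrow> bool" where
  "weight_system \<rho> H e F wt \<longleftrightarrow> finite F \<and> \<Sum>F = e \<and>
     (\<forall>f\<in>F. f * f = f \<and> f \<noteq> 0 \<and> (\<forall>g\<in>F. f \<noteq> g \<longrightarrow> f * g = 0) \<and> (\<forall>h\<in>H. \<rho> h * f = f * \<rho> h) \<and>
       (\<forall>h\<in>H. \<exists>N. (\<rho> h - cs (wt f h)) ^ N * f = 0) \<and> (\<forall>x. x \<notin> H \<longrightarrow> wt f x = 0))"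

lemma weight_system_absorb:
  assumes "weight_system \<rho> H e F wt" "f \<in> F"
  shows "f * e = f" "e * f = f"
proof -
  have fin: "finite F" and e: "e = \<Sum>F" using assms by (auto simp: weight_system_def)
  have "f * e = (\<Sum>g\<in>F. if g = f then f else 0)"
    unfolding e sum_distrib_left using assms by (intro sum.cong) (auto simp: weight_system_def)
  then show "f * e = f" using fin assms(2) by simp
  have "e * f = (\<Sum>g\<in>F. if g = f then f else 0)"
    unfolding e sum_distrib_right using assms by (intro sum.cong) (auto simp: weight_system_def)
  then show "e * f = f" using fin assms(2) by simp
qed

lemma weight_system_union:
  assumes "weight_system \<rho> H e1 F1 w1" "weight_system \<rho> H e2 F2 w2" "e1 * e2 = 0" "e2 * e1 = 0"
  shows "\<exists>wt. weight_system \<rho> H (e1 + e2) (F1 \<union> F2) wt"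
proof -
  have z: "f * g = 0 \<and> g * f = 0" if "f \<in> F1" "g \<in> F2" for f g
  proof
    note ab = weight_system_absorb[OF assms(1) that(1)] weight_system_absorb[OF assms(2) that(2)]
    have "f * g = f * (e1 * e2) * g" using ab by (simp add: mult.assoc) (simp flip: mult.assoc)
    then show "f * g = 0" by (simp add: assms)
    have "g * f = g * (e2 * e1) * f" using ab by (simp add: mult.assoc) (simp flip: mult.assoc)
    then show "g * f = 0" by (simp add: assms)
  qed
  \<comment> \<open>A common member f would give f = f * f = 0.\<close>
  have disj: "F1 \<inter> F2 = {}"
    using z assms(1) by (fastforce simp: weight_system_def)
  have "weight_system \<rho> H (e1 + e2) (F1 \<union> F2) (\<lambda>f. if f \<in> F1 then w1 f else w2 f)"
    unfolding weight_system_def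
  proof (intro conjI ballI)
    show "finite (F1 \<union> F2)" using assms by (auto simp: weight_system_def)
    show "\<Sum>(F1 \<union> F2) = e1 + e2"
      using assms disj by (auto simp: weight_system_def sum.union_disjoint)
  qed (use assms z disj in \<open>auto simp: weight_system_def\<close>)
  then show ?thesis by blast
qed

lemma power_idempotent:
  fixes e :: "'a::ring_1"
  assumes "e * e = e" "A * e = e * A"
  shows "(A * e) ^ n * e = A ^ n * e" "e * (A * e) ^ n = A ^ n * e"
proof -
  have c: "e * A ^ n = A ^ n * e" for n using assms(2) by (metis power_commuting_commutes)
  show "(A * e) ^ n * e = A ^ n * e"
  proof (induction n)
    case (Suc n)
    have "(A * e) ^ Suc n * e = A * (e * A ^ n) * e" using Suc by (simp add: mult.assoc)
    also have "\<dots> = A ^ Suc n * (e * e)" unfolding c by (simp add: mult.assoc)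
    finally show ?case by (simp add: assms)
  qed simp
  show "e * (A * e) ^ n = A ^ n * e"
  proof (induction n)
    case (Suc n)
    have "e * (A * e) ^ Suc n = (e * (A * e) ^ n) * (A * e)" by (simp add: power_commutes mult.assoc)
    also have "\<dots> = A ^ n * (e * A) * e" using Suc by (simp add: mult.assoc)
    also have "\<dots> = A ^ Suc n * (e * e)" unfolding assms(2)[symmetric] by (simp add: mult.assoc power_commutes flip: mult.assoc[of _ A])
    finally show ?case by (simp add: assms)
  qed simp
qed

section \<open>Simultaneous block decomposition for a nilpotent subalgebra\<close>

locale nilp_sub = lie_alg B for B :: "complex^'d \<Rightarrow> complex^'d \<Rightarrow> complex^'d" +
  fixes H :: "(complex^'d) set"
  assumes H_sub: "lie_subalgebra B H" and H_nil: "\<exists>k. lcs B H k = {0}"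
begin

lemma H_add: "x \<in> H \<Longrightarrow> y \<in> H \<Longrightarrow> x + y \<in> H"
  and H_scale: "x \<in> H \<Longrightarrow> c *s x \<in> H"
  and H_B: "x \<in> H \<Longrightarrow> y \<in> H \<Longrightarrow> B x y \<in> H"
  and H_0: "0 \<in> H"
  using H_sub vec.subspace_add vec.subspace_scale vec.subspace_0 by (auto simp: lie_subalgebra_def)

lemma lcs_mem: "h \<in> H \<Longrightarrow> y \<in> lcs B H k \<Longrightarrow> B h y \<in> lcs B H (Suc k)"
  by (auto intro!: vec.span_base)

lemma ad_power_lcs: "h \<in> H \<Longrightarrow> y \<in> H \<Longrightarrow> act (ad B h ^ k) y \<in> lcs B H k"
  by (induction k) (auto simp: act_mult intro!: vec.span_base)

lemma H_wspace_0: "H \<subseteq> wspace H (\<lambda>_. 0)"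
  using ad_power_lcs H_nil unfolding wspace_def by (auto, metis singletonD)

text \<open>If some h has several eigenvalues on the range of e, the Fitting idempotent of the
  shifted \<open>\<rho> h\<close> on that range splits e into two proper pieces. Nilpotency of H
  makes the splitting stable under all of H, so induction on the rank applies.\<close>

lemma weight_system_exists:
  assumes rep: "rep B \<rho>"
  shows "e * e = e \<Longrightarrow> (\<And>h. h \<in> H \<Longrightarrow> \<rho> h * e = e * \<rho> h) \<Longrightarrow> \<exists>F wt. weight_system \<rho> H e F wt"
proof (induction "rk e" arbitrary: e rule: less_induct)
  case less
  note ee = less.prems(1) and com = less.prems(2)
  consider "e = 0" | "e \<noteq> 0" "\<forall>h\<in>H. \<exists>\<mu> N. (\<rho> h - cs \<mu>) ^ N * e = 0"
    | h where "e \<noteq> 0" "h \<in> H" "\<And>\<mu> N. (\<rho> h - cs \<mu>) ^ N * e \<noteq> 0" by blast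
  then show ?case
  proof cases
    case 1
    then show ?thesis by (auto simp: weight_system_def intro!: exI[of _ "{}"])
  next
    case 2
    then obtain w where w: "\<And>h. h \<in> H \<Longrightarrow> \<exists>N. (\<rho> h - cs (w h)) ^ N * e = 0" by metis
    have "weight_system \<rho> H e {e} (\<lambda>_ h. if h \<in> H then w h else 0)"
      using w ee com 2(1) by (auto simp: weight_system_def)
    then show ?thesis by blast
  next
    case 3
    obtain \<mu> Z where Z: "Z \<noteq> 0" "e * Z = Z" "(\<rho> h - cs \<mu>) * Z = 0"
      by (rule eigenvalue_on_idempotent[OF ee 3(1) com[OF 3(2)]])
    define A where "A = \<rho> h - cs \<mu>"
    have Ae: "A * e = e * A" using com[OF 3(2)] cs_commute[of \<mu> e] by (simp add: A_def algebra_simps)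
    define X where "X = A * e"
    have Xe: "X * e = X" "e * X = X"
      using power_idempotent[OF ee Ae, of 1] by (simp_all add: X_def ee mult.assoc)
    have Xpow: "X ^ n * e = A ^ n * e" "e * X ^ n = A ^ n * e" for n
      using power_idempotent[OF ee Ae] by (auto simp: X_def)
    obtain g N where g: "poly g 0 = 0" "mat_poly g X * mat_poly g X = mat_poly g X" "X ^ N * mat_poly g X = X ^ N"
      "\<forall>M W. W * X ^ M = 0 \<longrightarrow> W * mat_poly g X = 0" "\<forall>M W. X ^ M * W = 0 \<longrightarrow> mat_poly g X * W = 0"
      by (rule fitting_idempotent[of X])
    define p where "p = mat_poly g X"
    obtain g' where g': "g = pCons 0 g'" using g(1) by (cases g) auto
    have pe: "e * p = p" using Xe by (simp add: p_def g' flip: mult.assoc)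
    have pe': "p * e = p" using pe mat_poly_commute[of X e g] Xe by (simp add: p_def)
    have pA: "p * A = A * p"
      unfolding p_def by (rule mat_poly_commute) (metis Ae X_def mult.assoc)
    define e1 where "e1 = e - p"
    have pp: "p * p = p" using g(2) p_def by simp
    have ep: "e1 * e1 = e1" "e1 * p = 0" "p * e1 = 0" "e * e1 = e1" "e1 * e = e1"
      using ee pe pe' pp by (simp_all add: e1_def algebra_simps)
    have e1A: "e1 * A = A * e1" using pA Ae by (simp add: e1_def algebra_simps)
    have "p * Z = 0" using g(5)[rule_format, of 1 Z] Z by (simp add: X_def A_def mult.assoc p_def)
    then have "e1 * Z = Z" using Z by (simp add: e1_def algebra_simps)
    then have "e1 \<noteq> 0" using Z(1) by auto
    have "p \<noteq> 0"
    proof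
      assume "p = 0"
      then have "X ^ N = 0" using g(3) p_def by simp
      then have "A ^ N * e = 0" using Xpow by (metis mult_zero_left)
      then show False using 3(3) by (simp add: A_def)
    qed
    have Ne1: "A ^ N * e1 = 0"
    proof -
      have "A ^ N * e1 = A ^ N * e * e1" using ep(4) by (simp add: mult.assoc)
      also have "\<dots> = X ^ N * (e * e1)" by (simp add: mult.assoc flip: Xpow(1))
      also have "\<dots> = e * (X ^ N * e1)"
      proof -
        have "e * X ^ N = X ^ N * e" using Xpow by simp
        then have "e * (X ^ N * e1) = X ^ N * (e * e1)" by (metis mult.assoc)
        then show ?thesis ..
      qed
      also have "X ^ N * e1 = X ^ N * e - X ^ N" using g(3) by (simp add: e1_def p_def algebra_simps)
      also have "e * (X ^ N * e - X ^ N) = 0"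
        by (simp add: right_diff_distrib Xpow) (simp add: mult.assoc[symmetric] flip: Xpow(2), simp add: ee)
      finally show ?thesis .
    qed
    \<comment> \<open>Both off-diagonal blocks of \<open>\<rho> y\<close> vanish:
      \<open>ad B h\<close> kills y after finitely many steps, so nilpotency of A on the side of e1
      is carried to the side of p, where A is invertible.\<close>
    have comp: "\<rho> y * p = p * \<rho> y" if y: "y \<in> H" for y
    proof -
      obtain m where "act (ad B h ^ m) y = 0" using ad_power_lcs[OF 3(2) y] H_nil by (metis singletonD)
      then have s: "((sylv A A) ^^ m) (\<rho> y) = 0"
        unfolding A_def by (subst rep_sylv[OF rep]) (simp add: rep_0[OF rep])
      have "e1 * \<rho> y * p * A ^ (m + N) = 0"
      proof (rule sylv_nilpotent_right)
        show "((sylv A A) ^^ m) (e1 * \<rho> y * p) = 0"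
          by (simp add: sylv_right_mult[OF pA] sylv_left_mult[OF e1A] s mult.assoc[symmetric])
        show "A ^ N * (e1 * \<rho> y * p) = 0" using Ne1 by (simp flip: mult.assoc)
      qed
      moreover have "W * p * X ^ M = W * p * A ^ M * e" for M W
      proof -
        have "W * p * X ^ M = W * (p * e) * X ^ M" by (simp add: pe')
        also have "\<dots> = W * p * (e * X ^ M)" by (simp only: mult.assoc)
        finally show ?thesis by (simp add: Xpow mult.assoc)
      qed
      ultimately have "e1 * \<rho> y * p * X ^ (m + N) = 0" by simp
      then have "e1 * \<rho> y * p * p = 0" unfolding p_def by (rule g(4)[rule_format])
      then have 1: "e1 * \<rho> y * p = 0" using pp by (simp add: mult.assoc)
      have "A ^ (m + N) * (p * \<rho> y * e1) = 0"
      proof (rule sylv_nilpotent_left)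
        show "((sylv A A) ^^ m) (p * \<rho> y * e1) = 0"
          by (simp add: sylv_right_mult[OF e1A] sylv_left_mult[OF pA] s mult.assoc[symmetric])
        have "e1 * A ^ N = 0" using Ne1 e1A by (metis power_commuting_commutes)
        then show "p * \<rho> y * e1 * A ^ N = 0" by (simp add: mult.assoc)
      qed
      moreover have "X ^ M * (p * W) = A ^ M * (p * W)" for M W
      proof -
        have "X ^ M * (p * W) = X ^ M * (e * p) * W" by (simp add: pe mult.assoc)
        also have "\<dots> = X ^ M * e * (p * W)" by (simp only: mult.assoc)
        also have "\<dots> = A ^ M * (e * p * W)" unfolding Xpow by (simp add: mult.assoc)
        finally show ?thesis by (simp add: pe)
      qed
      ultimately have "X ^ (m + N) * (p * \<rho> y * e1) = 0"
        by (simp add: mult.assoc)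
      then have "p * (p * \<rho> y * e1) = 0" unfolding p_def by (rule g(5)[rule_format])
      then have 2: "p * \<rho> y * e1 = 0" using pp by (simp flip: mult.assoc)
      have "\<rho> y * p = e * \<rho> y * p" using com[OF y] pe by (metis mult.assoc)
      also have "\<dots> = p * \<rho> y * p" using 1 by (simp add: e1_def algebra_simps)
      also have "\<dots> = p * \<rho> y * e" using 2 by (simp add: e1_def algebra_simps)
      also have "\<dots> = p * \<rho> y" using com[OF y] pe' by (metis mult.assoc)
      finally show ?thesis .
    qed
    have come1: "\<rho> y * e1 = e1 * \<rho> y" if "y \<in> H" for y
      using comp[OF that] com[OF that] by (simp add: e1_def algebra_simps)
    have "tr e = tr e1 + tr p" by (simp add: e1_def tr_diff)
    then have "rk e = rk e1 + rk p"
      using tr_idempotent[OF ee] tr_idempotent[OF ep(1)] tr_idempotent[OF pp]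
      by (metis of_nat_add of_nat_eq_iff)
    then have "rk e1 < rk e" "rk p < rk e"
      using rk_pos[OF ep(1) \<open>e1 \<noteq> 0\<close>] rk_pos[OF pp \<open>p \<noteq> 0\<close>] by auto
    then have "\<exists>F w. weight_system \<rho> H e1 F w" "\<exists>F w. weight_system \<rho> H p F w"
      using less.hyps[OF _ ep(1) come1] less.hyps[OF _ pp comp] by blast+
    then obtain F1 w1 F2 w2 where "weight_system \<rho> H e1 F1 w1" "weight_system \<rho> H p F2 w2"
      by blast
    from weight_system_union[OF this ep(2,3)] show ?thesis
      by (auto simp: e1_def)
  qed
qed

end

section \<open>Weight blocks of a representation and their traces\<close>

locale weights = nilp_sub B H for B :: "complex^'d \<Rightarrow> complex^'d \<Rightarrow> complex^'d" and H +
  fixes \<rho> :: "complex^'d \<Rightarrow> 'k::finite cmat" and F wt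
  assumes rep: "rep B \<rho>" and ws: "weight_system \<rho> H 1 F wt"
begin

lemma F_fin: "finite F" and F_sum: "\<Sum>F = 1"
  using ws by (auto simp: weight_system_def)

lemma
  assumes "f \<in> F"
  shows F_idem: "f * f = f" and F_nz: "f \<noteq> 0"
    and F_orth: "g \<in> F \<Longrightarrow> f \<noteq> g \<Longrightarrow> f * g = 0"
    and F_comm: "h \<in> H \<Longrightarrow> \<rho> h * f = f * \<rho> h"
    and F_nil: "h \<in> H \<Longrightarrow> \<exists>N. (\<rho> h - cs (wt f h)) ^ N * f = 0"
    and wt_outside: "x \<notin> H \<Longrightarrow> wt f x = 0"
  using ws assms by (auto simp: weight_system_def)

lemma F_expand: "X = (\<Sum>f\<in>F. f * X)" "X = (\<Sum>f\<in>F. X * f)"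
  using F_sum by (simp_all flip: sum_distrib_left sum_distrib_right)

lemma F_tr: "tr X = (\<Sum>f\<in>F. tr (f * X * f))"
proof -
  have "tr X = (\<Sum>f\<in>F. tr (f * X))" by (subst F_expand(1)) (rule tr_sum)
  also have "\<dots> = (\<Sum>f\<in>F. tr (f * X * f))"
  proof (rule sum.cong[OF refl])
    fix f assume "f \<in> F"
    have "tr (f * X * f) = tr (f * (f * X))" by (rule tr_comm)
    then show "tr (f * X) = tr (f * X * f)" by (simp add: F_idem[OF \<open>f \<in> F\<close>] flip: mult.assoc)
  qed
  finally show ?thesis .
qed

lemma F_comm_shift: "f \<in> F \<Longrightarrow> h \<in> H \<Longrightarrow> (\<rho> h - cs a) * f = f * (\<rho> h - cs a)"
  using F_comm[of f h] cs_commute[of a f] by (simp add: algebra_simps)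

text \<open>The block is annihilated from the right by a power of \<open>\<rho> h\<close> shifted by
  \<open>wt f h - \<alpha> h\<close>, carried over from the left, and by a power shifted by
  \<open>wt g h\<close>. Different shifts would force it to be 0.\<close>

lemma shift:
  assumes x: "x \<in> wspace H \<alpha>" and f: "f \<in> F" and g: "g \<in> F" and nz: "f * \<rho> x * g \<noteq> 0" and h: "h \<in> H"
  shows "wt f h = wt g h + \<alpha> h"
proof (rule ccontr)
  assume ne: "wt f h \<noteq> wt g h + \<alpha> h"
  let ?A = "\<rho> h - cs (wt f h)" and ?P = "\<rho> h - cs (wt f h - \<alpha> h)" and ?Q = "\<rho> h - cs (wt g h)"
  obtain m where m: "act ((ad B h - cs (\<alpha> h)) ^ m) x = 0" using x h by (auto simp: wspace_def)
  obtain N where N: "?A ^ N * f = 0" using F_nil[OF f h] by blast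
  obtain K where K: "?Q ^ K * g = 0" using F_nil[OF g h] by blast
  have 1: "f * \<rho> x * g * ?P ^ (m + N) = 0"
  proof (rule sylv_nilpotent_right)
    have "((sylv ?A ?P) ^^ m) (\<rho> x) = 0" by (subst rep_sylv[OF rep]) (simp add: m rep_0[OF rep])
    then show "((sylv ?A ?P) ^^ m) (f * \<rho> x * g) = 0"
      by (simp add: sylv_right_mult[OF F_comm_shift[OF g h, symmetric]]
          sylv_left_mult[OF F_comm_shift[OF f h, symmetric]] mult.assoc[symmetric])
    show "?A ^ N * (f * \<rho> x * g) = 0" using N by (simp flip: mult.assoc)
  qed
  have 2: "f * \<rho> x * g * ?Q ^ K = 0"
  proof -
    have "g * ?Q ^ K = 0" using K F_comm_shift[OF g h] by (metis power_commuting_commutes)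
    then show ?thesis by (simp add: mult.assoc)
  qed
  have 3: "?P - ?Q = cs (wt g h + \<alpha> h - wt f h)"
    by (simp add: cs_diff cs_add algebra_simps)
  have "wt g h + \<alpha> h - wt f h \<noteq> 0" using ne by auto
  from coprime_shift_right[OF 3 this 1 2] have "f * \<rho> x * g = 0" .
  then show False using nz by simp
qed

lemma nil_part:
  assumes f: "f \<in> F" and h: "h \<in> H"
  defines "N \<equiv> (\<rho> h - cs (wt f h)) * f"
  shows "tr N = 0" "tr (N * N) = 0"
proof -
  obtain k where k: "(\<rho> h - cs (wt f h)) ^ k * f = 0" using F_nil[OF f h] by blast
  have "f * N ^ k = 0"
    unfolding N_def using power_idempotent(2)[OF F_idem[OF f] F_comm_shift[OF f h]] k by simp
  moreover have "N * f = N" by (simp add: N_def mult.assoc F_idem[OF f])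
  ultimately have k: "N ^ Suc k = 0" by (metis mult.assoc mult_zero_right power_Suc)
  then show "tr N = 0" by (rule tr_nilpotent)
  have "(N * N) ^ Suc k = 0" using k by (metis mult_zero_left power_add power_even_eq power2_eq_square power_mult mult_2)
  then show "tr (N * N) = 0" by (rule tr_nilpotent)
qed

lemma tr_wt:
  assumes f: "f \<in> F" and h: "h \<in> H"
  shows "tr (f * \<rho> h) = of_nat (rk f) * wt f h"
proof -
  have "\<rho> h * f = (\<rho> h - cs (wt f h)) * f + cs (wt f h) * f" by (simp add: algebra_simps)
  then have "tr (\<rho> h * f) = wt f h * tr f" using nil_part(1)[OF f h] by (simp add: tr_add tr_cs)
  then show ?thesis using tr_idempotent[OF F_idem[OF f]] tr_comm[of f "\<rho> h"] by simp
qed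

lemma tr_wt_square:
  assumes f: "f \<in> F" and h: "h \<in> H"
  shows "tr (f * (\<rho> h * \<rho> h)) = of_nat (rk f) * (wt f h)\<^sup>2"
proof -
  define w where "w = wt f h"
  define N where "N = (\<rho> h - cs w) * f"
  have "f * N = f * (\<rho> h - cs w) * f" by (simp add: N_def mult.assoc)
  also have "\<dots> = (\<rho> h - cs w) * (f * f)"
    unfolding F_comm_shift[OF f h, symmetric] by (rule mult.assoc)
  finally have Nf: "f * N = N" "N * f = N" by (simp_all add: N_def F_idem[OF f] mult.assoc)
  have hf: "\<rho> h * f = N + cs w * f" by (simp add: N_def algebra_simps)
  have "f * (\<rho> h * \<rho> h) = \<rho> h * (f * \<rho> h)" using F_comm[OF f h] by (metis mult.assoc)
  also have "\<dots> = (\<rho> h * f) * (\<rho> h * f)" using F_comm[OF f h] F_idem[OF f] by (metis mult.assoc)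
  also have "\<dots> = N * N + cs w * N + cs w * N + cs w * (cs w * f)"
    unfolding hf using Nf F_idem[OF f] cs_commute[of w N]
    by (simp add: distrib_left distrib_right mult.assoc) (metis cs_commute mult.assoc)
  finally have "tr (f * (\<rho> h * \<rho> h)) = w * (w * tr f)"
    using nil_part[OF f h] by (simp add: tr_add tr_cs N_def w_def)
  then show ?thesis using tr_idempotent[OF F_idem[OF f]] by (simp add: w_def power2_eq_square)
qed

text \<open>\<open>wt f h\<close> is the trace of \<open>\<rho> h\<close> on the block of f divided
  by the rank of f, and traces are additive. The definition of a weight system leaves linearity
  open.\<close>

lemma wt_add:
  assumes f: "f \<in> F" and h: "h \<in> H" "h' \<in> H"
  shows "wt f (h + h') = wt f h + wt f h'"
proof -
  have "of_nat (rk f) * wt f (h + h') = of_nat (rk f) * (wt f h + wt f h')"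
    using tr_wt[OF f H_add[OF h]] tr_wt[OF f h(1)] tr_wt[OF f h(2)]
    by (simp add: rep_add[OF rep] distrib_left tr_add)
  then show ?thesis using rk_pos[OF F_idem[OF f] F_nz[OF f]] by simp
qed

lemma wt_scale:
  assumes f: "f \<in> F" and h: "h \<in> H"
  shows "wt f (c *s h) = c * wt f h"
proof -
  have "of_nat (rk f) * wt f (c *s h) = tr (f * (cs c * \<rho> h))"
    using tr_wt[OF f H_scale[OF h, of c]] by (simp add: rep_scale[OF rep])
  also have "\<dots> = of_nat (rk f) * (c * wt f h)"
    using tr_wt[OF f h] by (simp add: cs_left_commute tr_cs)
  finally show ?thesis using rk_pos[OF F_idem[OF f] F_nz[OF f]] by simp
qed

lemma tr_square:
  assumes h: "h \<in> H"
  shows "tr (\<rho> h * \<rho> h) = (\<Sum>f\<in>F. of_nat (rk f) * (wt f h)\<^sup>2)"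
proof -
  have "tr (\<rho> h * \<rho> h) = (\<Sum>f\<in>F. tr (f * (\<rho> h * \<rho> h)))" by (subst F_expand(1)) (rule tr_sum)
  then show ?thesis using h by (simp add: tr_wt_square)
qed

text \<open>Polarization of \<open>tr_square\<close>: nilpotent parts of h and h' on a block are not
  known to commute, so only one element of H is treated at a time.\<close>

lemma tr_prod:
  assumes h: "h \<in> H" "h' \<in> H"
  shows "tr (\<rho> h * \<rho> h') = (\<Sum>f\<in>F. of_nat (rk f) * (wt f h * wt f h'))"
proof -
  have "2 * tr (\<rho> h * \<rho> h') = tr (\<rho> (h + h') * \<rho> (h + h')) - tr (\<rho> h * \<rho> h) - tr (\<rho> h' * \<rho> h')"
    using tr_comm[of "\<rho> h'" "\<rho> h"] by (simp add: rep_add[OF rep] distrib_left distrib_right tr_add)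
  also have "\<dots> = (\<Sum>f\<in>F. of_nat (rk f) * ((wt f h + wt f h')\<^sup>2 - (wt f h)\<^sup>2 - (wt f h')\<^sup>2))"
    using h by (simp add: tr_square H_add wt_add algebra_simps sum_subtractf sum.distrib)
  also have "\<dots> = 2 * (\<Sum>f\<in>F. of_nat (rk f) * (wt f h * wt f h'))"
    by (simp add: sum_distrib_left power2_eq_square algebra_simps)
  finally show ?thesis by simp
qed

lemma tr_orthogonal:
  assumes x: "x \<in> wspace H \<alpha>" and y: "y \<in> wspace H \<beta>" and h: "h \<in> H" "\<alpha> h + \<beta> h \<noteq> 0"
  shows "tr (\<rho> x * \<rho> y) = 0"
proof -
  have "f * (\<rho> x * \<rho> y) * f = 0" if f: "f \<in> F" for f
  proof -
    have "f * (\<rho> x * \<rho> y) * f = f * \<rho> x * (\<Sum>g\<in>F. g * (\<rho> y * f))"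
      by (subst (1) F_expand(1)[of "\<rho> y * f", symmetric]) (simp add: mult.assoc)
    also have "\<dots> = (\<Sum>g\<in>F. (f * \<rho> x * g) * (g * \<rho> y * f))"
      using F_idem by (simp add: sum_distrib_left mult.assoc) (simp flip: mult.assoc)
    also have "\<dots> = 0"
    proof (rule sum.neutral, rule ballI)
      fix g assume g: "g \<in> F"
      show "(f * \<rho> x * g) * (g * \<rho> y * f) = 0"
      proof (rule ccontr)
        assume "\<not> ?thesis"
        then have "f * \<rho> x * g \<noteq> 0" "g * \<rho> y * f \<noteq> 0" by auto
        from shift[OF x f g this(1) h(1)] shift[OF y g f this(2) h(1)] h(2) show False
          by (metis add.assoc add.commute add_cancel_right_right)
      qed
    qed
    finally show ?thesis .
  qed
  then show ?thesis by (subst F_tr) simp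
qed

text \<open>The commutator of opposite weight vectors has trace zero on each sum of weight spaces along
  an \<open>\<alpha>\<close>-string.\<close>

lemma string_ratio:
  assumes x: "x \<in> wspace H \<alpha>" and y: "y \<in> wspace H (\<lambda>h. - \<alpha> h)" and h: "B x y \<in> H" and f: "f \<in> F"
  shows "\<exists>r::real. wt f (B x y) = of_real r * \<alpha> (B x y)"
proof -
  \<comment> \<open>The whole class of f modulo integer multiples of \<alpha>. Neither x nor y leads
    out of it or into it, so the sum P of its members commutes with \<open>\<rho> x\<close>.\<close>
  define C where "C = {g \<in> F. \<exists>k::int. \<forall>h\<in>H. wt g h = wt f h + of_int k * \<alpha> h}"
  define P where "P = \<Sum>C"
  have CF: "C \<subseteq> F" "finite C" using F_fin by (auto simp: C_def)
  have fC: "f \<in> C" using f by (auto simp: C_def intro!: exI[of _ 0])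
  have Q: "1 - P = \<Sum>(F - C)" using F_sum CF F_fin by (simp add: P_def sum_diff)
  have closed: "g \<in> C" if "g' \<in> C" "g \<in> F" "\<And>h. h \<in> H \<Longrightarrow> wt g h = wt g' h + of_int s * \<alpha> h" for g g' s
  proof -
    obtain k :: int where "\<forall>h\<in>H. wt g' h = wt f h + of_int k * \<alpha> h" using \<open>g' \<in> C\<close> by (auto simp: C_def)
    then have "\<forall>h\<in>H. wt g h = wt f h + of_int (k + s) * \<alpha> h" using that(3) by (simp add: algebra_simps)
    then show ?thesis using that(2) unfolding C_def by blast
  qed
  have comm: "\<rho> z * P = P * \<rho> z" if z: "z \<in> wspace H (\<lambda>h. of_int s * \<alpha> h)" for z s
  proof -
    have "g * \<rho> z * g' = 0" if "g \<in> F - C" "g' \<in> C" for g g'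
      using shift[OF z, of g g'] closed[OF that(2), of g s] that CF by blast
    then have "(1 - P) * \<rho> z * P = 0"
      unfolding Q by (simp add: P_def sum_distrib_left sum_distrib_right)
    moreover have "g' * \<rho> z * g = 0" if "g \<in> F - C" "g' \<in> C" for g g'
    proof (rule ccontr)
      assume nz: "g' * \<rho> z * g \<noteq> 0"
      have "wt g h = wt g' h + of_int (- s) * \<alpha> h" if "h \<in> H" for h
        using shift[OF z _ _ nz \<open>h \<in> H\<close>] \<open>g \<in> F - C\<close> \<open>g' \<in> C\<close> CF by auto
      then show False using closed[OF \<open>g' \<in> C\<close>, of g "-s"] \<open>g \<in> F - C\<close> by blast
    qed
    then have "P * \<rho> z * (1 - P) = 0"
      unfolding Q by (simp add: P_def sum_distrib_left sum_distrib_right)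
    ultimately show ?thesis by (simp add: algebra_simps)
  qed
  have cx: "\<rho> x * P = P * \<rho> x" using comm[of x 1] x by simp
  \<comment> \<open>By cyclicity, P times the commutator has trace 0.\<close>
  have "tr (P * \<rho> (B x y)) = tr (P * \<rho> x * \<rho> y) - tr (P * \<rho> y * \<rho> x)"
    by (simp add: rep_bracket[OF rep] right_diff_distrib tr_diff mult.assoc)
  also have "tr (P * \<rho> y * \<rho> x) = tr (\<rho> x * P * \<rho> y)" using tr_comm[of "P * \<rho> y" "\<rho> x"] by (simp add: mult.assoc)
  finally have "0 = tr (P * \<rho> (B x y))" by (simp add: cx)
  also have "\<dots> = (\<Sum>g\<in>C. of_nat (rk g) * wt g (B x y))"
    using CF h by (simp add: P_def sum_distrib_right tr_sum tr_wt subset_iff)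
  finally have z: "(\<Sum>g\<in>C. of_nat (rk g) * wt g (B x y)) = 0" by simp
  have "\<forall>g\<in>C. \<exists>k::int. \<forall>h\<in>H. wt g h = wt f h + of_int k * \<alpha> h" by (auto simp: C_def)
  then obtain k :: "'k cmat \<Rightarrow> int" where k: "\<And>g h. g \<in> C \<Longrightarrow> h \<in> H \<Longrightarrow> wt g h = wt f h + of_int (k g) * \<alpha> h"
    unfolding bchoice_iff by blast
  define S where "S = (\<Sum>g\<in>C. rk g)"
  define T where "T = (\<Sum>g\<in>C. of_nat (rk g) * k g)"
  have "S \<ge> rk f" unfolding S_def using fC CF by (intro member_le_sum) auto
  then have "S > 0" using rk_pos[OF F_idem[OF f] F_nz[OF f]] by simp
  have "of_nat S * wt f (B x y) + of_int T * \<alpha> (B x y) = 0"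
  proof -
    have "of_nat S * wt f (B x y) + of_int T * \<alpha> (B x y)
        = (\<Sum>g\<in>C. of_nat (rk g) * (wt f (B x y) + of_int (k g) * \<alpha> (B x y)))"
      by (simp add: S_def T_def sum_distrib_right distrib_left sum.distrib mult.assoc)
    also have "\<dots> = (\<Sum>g\<in>C. of_nat (rk g) * wt g (B x y))"
      using k[OF _ h] by (intro sum.cong) auto
    finally show ?thesis using z by simp
  qed
  \<comment> \<open>S is the total rank of the class, hence positive. A real ratio has a nonnegative
    square, which is what \<open>trace_form_nonzero\<close> exploits.\<close>
  then have "wt f (B x y) = of_real (- of_int T / of_nat S) * \<alpha> (B x y)"
    using \<open>S > 0\<close> by (simp add: field_simps eq_neg_iff_add_eq_0)
  then show ?thesis by blast
qed

end

section \<open>Engel's theorem for the adjoint action of H\<close>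

context nilp_sub
begin

lemma wspace_subspace: "vec.subspace (wspace H \<alpha>)"
proof (rule vec.subspaceI)
  show "0 \<in> wspace H \<alpha>" by (simp add: wspace_def)
qed (auto intro: wspace_add wspace_scale)

lemma H_subspace: "vec.subspace H"
  using H_sub by (simp add: lie_subalgebra_def)

lemma lcs_subset_H: "lcs B H k \<subseteq> H"
proof (induction k)
  case (Suc k)
  then show ?case unfolding lcs.simps by (intro vec.span_minimal H_subspace) (auto intro!: H_B)
qed simp

text \<open>Engel's theorem on M/U without quotients: a nonzero class that K annihilates.
  Quantifying over all pairs U, M lets the property pass from K to a larger algebra.\<close>

definition engel :: "(complex^'d) set \<Rightarrow> bool" where
  "engel K \<longleftrightarrow> (\<forall>U M. vec.subspace U \<and> vec.subspace M \<and> U \<subset> M \<and>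
     (\<forall>k\<in>K. \<forall>x\<in>U. B k x \<in> U) \<and> (\<forall>k\<in>K. \<forall>x\<in>M. B k x \<in> M \<and> (\<exists>N. act (ad B k ^ N) x = 0))
     \<longrightarrow> (\<exists>x\<in>M - U. \<forall>k\<in>K. B k x \<in> U))"

lemma engelD:
  assumes "engel K" "vec.subspace U" "vec.subspace M" "U \<subset> M"
    and "\<And>k x. k \<in> K \<Longrightarrow> x \<in> U \<Longrightarrow> B k x \<in> U"
    and "\<And>k x. k \<in> K \<Longrightarrow> x \<in> M \<Longrightarrow> B k x \<in> M"
    and "\<And>k x. k \<in> K \<Longrightarrow> x \<in> M \<Longrightarrow> \<exists>N. act (ad B k ^ N) x = 0"
  shows "\<exists>x\<in>M - U. \<forall>k\<in>K. B k x \<in> U"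
  using assms(1)[unfolded engel_def, THEN spec, of U, THEN spec, of M] assms(2-) by (meson subsetD)

text \<open>The vectors of M that K sends into U are stable under \<open>ad B y\<close>, because y
  normalizes K. Starting from one outside U, the last iterate before U is first reached is sent into
  U by y as well.\<close>

lemma engel_extend:
  assumes K: "engel K" "vec.subspace K" "\<And>k. k \<in> K \<Longrightarrow> B y k \<in> K"
  shows "engel (vec.span (insert y K))"
  unfolding engel_def
proof (intro allI impI, elim conjE)
  fix U M
  let ?K = "vec.span (insert y K)"
  assume U: "vec.subspace U" and M: "vec.subspace M" and UM: "U \<subset> M"
    and KU: "\<forall>k\<in>?K. \<forall>x\<in>U. B k x \<in> U"
    and KM: "\<forall>k\<in>?K. \<forall>x\<in>M. B k x \<in> M \<and> (\<exists>N. act (ad B k ^ N) x = 0)"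
  have sub: "K \<subseteq> ?K" "y \<in> ?K" by (auto intro: vec.span_base)
  have "\<exists>x\<in>M - U. \<forall>k\<in>K. B k x \<in> U"
    by (rule engelD[OF K(1) U M UM]) (use KU KM sub in blast)+
  then obtain x0 where x0: "x0 \<in> M" "x0 \<notin> U" "\<And>k. k \<in> K \<Longrightarrow> B k x0 \<in> U" by blast
  have step: "B y x \<in> M \<and> (\<forall>k\<in>K. B k (B y x) \<in> U)" if x: "x \<in> M" "\<And>k. k \<in> K \<Longrightarrow> B k x \<in> U" for x
  proof (intro conjI ballI)
    show "B y x \<in> M" using KM x sub by blast
    fix k assume k: "k \<in> K"
    have "B k y = - B y k" by (rule B_anti)
    then have "B k y \<in> K" using K(3)[OF k] K(2) by (simp add: vec.subspace_neg)
    moreover have "B y (B k x) \<in> U" using KU x(2)[OF k] sub by blast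
    ultimately show "B k (B y x) \<in> U" using x(2) jacobi'[of k y x] U by (simp add: vec.subspace_add)
  qed
  have it: "act (ad B y ^ j) x0 \<in> M \<and> (\<forall>k\<in>K. B k (act (ad B y ^ j) x0) \<in> U)" for j
    by (induction j) (use x0 step in \<open>auto simp: act_mult\<close>)
  have "\<exists>N. act (ad B y ^ N) x0 = 0" using KM x0 sub by blast
  then have ex: "\<exists>N. act (ad B y ^ N) x0 \<in> U" using U vec.subspace_0 by metis
  define j where "j = (LEAST N. act (ad B y ^ N) x0 \<in> U)"
  have j: "act (ad B y ^ j) x0 \<in> U" unfolding j_def using ex by (rule LeastI_ex)
  have "j \<noteq> 0" using j x0(2) by (cases j) auto
  then obtain i where i: "j = Suc i" by (cases j) auto
  have ni: "act (ad B y ^ i) x0 \<notin> U" using not_less_Least[of i "\<lambda>N. act (ad B y ^ N) x0 \<in> U"] i by (simp add: j_def)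
  let ?z = "act (ad B y ^ i) x0"
  have "B y ?z \<in> U" using j by (simp add: i act_mult)
  have "B k ?z \<in> U" if "k \<in> ?K" for k
  proof -
    have "vec.subspace {k. B k ?z \<in> U}"
      using U by (auto intro!: vec.subspaceI simp: B_add_left B_scale_left vec.subspace_add vec.subspace_scale vec.subspace_0)
    moreover have "insert y K \<subseteq> {k. B k ?z \<in> U}" using \<open>B y ?z \<in> U\<close> it by auto
    ultimately have "?K \<subseteq> {k. B k ?z \<in> U}" by (intro vec.span_minimal)
    then show ?thesis using that by blast
  qed
  then show "\<exists>x\<in>M - U. \<forall>k\<in>?K. B k x \<in> U" using it ni by blast
qed

text \<open>Take a subalgebra K of H with the property and of maximal dimension. If it is proper,
  the lower central series supplies y outside K with [H, y] in K, and \<open>engel_extend\<close>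
  enlarges K.\<close>

lemma engel_H: "engel H"
proof -
  let ?P = "\<lambda>K. vec.subspace K \<and> K \<subseteq> H \<and> engel K \<and> (\<forall>x\<in>K. \<forall>y\<in>K. B x y \<in> K)"
  have "?P {0}" by (auto simp: engel_def H_0 vec.subspace_0 vec.subspace_single_0)
  moreover have "vec.dim K \<le> CARD('d)" for K :: "(complex^'d) set"
    by (metis vec.dim_subset subset_UNIV vec_dim_card)
  ultimately have "\<exists>K. ?P K \<and> (\<forall>K'. ?P K' \<longrightarrow> vec.dim K' \<le> vec.dim K)"
    by (intro ex_has_greatest_nat[where k = "{0}" and b = "Suc CARD('d)"]) (simp_all add: less_Suc_eq_le)
  then obtain K where KK: "?P K \<and> (\<forall>K'. ?P K' \<longrightarrow> vec.dim K' \<le> vec.dim K)" ..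
  note K = KK[THEN conjunct1] and max = KK[THEN conjunct2, rule_format]
  have "K = H"
  proof (rule ccontr)
    assume "K \<noteq> H"
    then have n0: "\<not> lcs B H 0 \<subseteq> K" using K by auto
    obtain m where "lcs B H m = {0}" using H_nil by blast
    then have "lcs B H m \<subseteq> K" using K vec.subspace_0 by auto
    then obtain j where j: "\<not> lcs B H j \<subseteq> K" "lcs B H (Suc j) \<subseteq> K"
      using n0 by (induction m) auto
    then obtain y where y: "y \<in> lcs B H j" "y \<notin> K" by blast
    have yH: "y \<in> H" using y lcs_subset_H by blast
    have yK: "B y k \<in> K" if "k \<in> K" for k
    proof -
      have "B k y \<in> K" using lcs_mem[of k y j] y j(2) K that by blast
      then show ?thesis using B_anti[of y k] K vec.subspace_neg by metis
    qed
    let ?K = "vec.span (insert y K)"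
    have "?P ?K"
    proof (intro conjI ballI)
      show "?K \<subseteq> H" using yH K H_subspace by (intro vec.span_minimal) auto
      show "engel ?K" using K yK by (intro engel_extend) auto
      fix a b assume "a \<in> ?K" "b \<in> ?K"
      have 1: "B c d \<in> ?K" if "c \<in> insert y K" "d \<in> insert y K" for c d
      proof -
        have "B k y \<in> K" if "k \<in> K" for k using yK[OF that] B_anti[of k y] K vec.subspace_neg by metis
        then have "B c d \<in> insert 0 K" using that yK K by auto
        then show ?thesis using vec.span_zero by (auto intro: vec.span_base)
      qed
      have 2: "B a d \<in> ?K" if "d \<in> insert y K" for d
        using \<open>a \<in> ?K\<close>
      proof (induction rule: vec.span_induct)
        show "vec.subspace {a. B a d \<in> ?K}"
          by (auto intro!: vec.subspaceI simp: B_add_left B_scale_left vec.span_add vec.span_scale vec.span_zero)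
      qed (use 1 that in blast)
      show "B a b \<in> ?K"
        using \<open>b \<in> ?K\<close>
      proof (induction rule: vec.span_induct)
        show "vec.subspace {b. B a b \<in> ?K}"
          by (auto intro!: vec.subspaceI simp: B_add_right B_scale_right vec.span_add vec.span_scale vec.span_zero)
      qed (use 2 in blast)
    qed simp
    then have "vec.dim ?K \<le> vec.dim K" by (rule max)
    moreover have "vec.span K \<subset> vec.span ?K"
      using y(2) K by (auto simp: vec.span_span vec.span_eq_iff[THEN iffD2] intro: vec.span_base)
    then have "vec.dim K < vec.dim ?K" by (rule vec.dim_psubset)
    ultimately show False by simp
  qed
  then show ?thesis using K by simp
qed

end

locale cartan = nilp_sub B H for B :: "complex^'d \<Rightarrow> complex^'d \<Rightarrow> complex^'d" and H +
  assumes norm_H: "normalizer B H = H"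
begin

text \<open>Otherwise Engel's theorem on the zero weight space modulo H gives x outside H with
  [H, x] in H, against self-normalization.\<close>

lemma wspace_0: "wspace H (\<lambda>_. 0) = H"
proof (rule ccontr)
  assume "wspace H (\<lambda>_. 0) \<noteq> H"
  then have "H \<subset> wspace H (\<lambda>_. 0)" using H_wspace_0 by blast
  moreover have "B h x \<in> wspace H (\<lambda>_. 0)" if "h \<in> H" "x \<in> wspace H (\<lambda>_. 0)" for h x
    using wspace_bracket[of h H "\<lambda>_. 0" x "\<lambda>_. 0"] H_wspace_0 that by auto
  moreover have "\<exists>N. act (ad B h ^ N) x = 0" if "h \<in> H" "x \<in> wspace H (\<lambda>_. 0)" for h x
    using that by (auto simp: wspace_def)
  ultimately have "\<exists>x\<in>wspace H (\<lambda>_. 0) - H. \<forall>h\<in>H. B h x \<in> H"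
    using H_B by (intro engelD[OF engel_H H_subspace wspace_subspace])
  then obtain x where x: "x \<notin> H" "\<And>h. h \<in> H \<Longrightarrow> B h x \<in> H" by blast
  have "x \<in> normalizer B H"
    unfolding normalizer_def
  proof (intro CollectI ballI)
    fix h assume "h \<in> H"
    then have "- B h x \<in> H" using x(2) H_subspace by (simp add: vec.subspace_neg)
    then show "B x h \<in> H" by (simp add: B_anti[of x h])
  qed
  then show False using x norm_H by simp
qed

end

subsection \<open>Elements of the free algebra acting in representations\<close>

text \<open>Formal expressions, since one and the same element has to act in several representations.\<close>

datatype 'a free_alg = Gen 'a | Con complex | Plus "'a free_alg" "'a free_alg" | Times "'a free_alg" "'a free_alg"

primrec ev :: "('a \<Rightarrow> 'k::finite cmat) \<Rightarrow> 'a free_alg \<Rightarrow> 'k cmat" where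
  "ev \<rho> (Gen x) = \<rho> x"
| "ev \<rho> (Con c) = cs c"
| "ev \<rho> (Plus u v) = ev \<rho> u + ev \<rho> v"
| "ev \<rho> (Times u v) = ev \<rho> u * ev \<rho> v"

text \<open>The constant term, that is, the action in the trivial representation.\<close>

primrec aug :: "'a free_alg \<Rightarrow> complex" where
  "aug (Gen x) = 0"
| "aug (Con c) = c"
| "aug (Plus u v) = aug u + aug v"
| "aug (Times u v) = aug u * aug v"

lemma free_alg_sum:
  fixes \<rho> :: "'a \<Rightarrow> 'k::finite cmat"
  assumes "finite I"
  shows "\<exists>v. ev \<rho> v = (\<Sum>i\<in>I. ev \<rho> (u i)) \<and> aug v = (\<Sum>i\<in>I. aug (u i))"
  using assms
proof induction
  case empty
  show ?case by (rule exI[of _ "Con 0"]) simp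
next
  case (insert i I)
  then obtain v where "ev \<rho> v = (\<Sum>i\<in>I. ev \<rho> (u i))" "aug v = (\<Sum>i\<in>I. aug (u i))" by blast
  then show ?case using insert by (intro exI[of _ "Plus (u i) v"]) simp
qed

lemma free_alg_poly: "\<exists>v. ev \<rho> v = mat_poly g (ev \<rho> u) \<and> aug v = poly g (aug u)"
proof (induction g)
  case 0
  show ?case by (rule exI[of _ "Con 0"]) simp
next
  case (pCons a g)
  then obtain v where "ev \<rho> v = mat_poly g (ev \<rho> u)" "aug v = poly g (aug u)" by blast
  then show ?case by (intro exI[of _ "Plus (Con a) (Times u v)"]) simp
qed

lemma ev_fixed_vector: "(\<And>x. act (\<rho> x) v = 0) \<Longrightarrow> act (ev \<rho> u) v = aug u *s v"
  by (induction u) (auto simp: act_add act_mult act_scale vec.scale_left_distrib)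

lemma ev_commute: "(\<And>x. \<rho> x * C = C * \<rho> x) \<Longrightarrow> ev \<rho> u * C = C * ev \<rho> u"
proof (induction u)
  case (Times u v)
  then show ?case by (simp add: mult.assoc) (simp flip: mult.assoc)
qed (auto simp: cs_commute algebra_simps)

lemma ev_intertwine: "(\<And>x. \<sigma> x * T = T * \<rho> x) \<Longrightarrow> ev \<sigma> u * T = T * ev \<rho> u"
proof (induction u)
  case (Times u v)
  then show ?case by (simp add: mult.assoc) (simp flip: mult.assoc)
qed (auto simp: cs_commute algebra_simps)

text \<open>On the range of e the matrices e X and X agree; the factor e discards the complement,
  where they may differ.\<close>

lemma mat_poly_idempotent_left:
  assumes "e * e = e" "X * e = e * X"
  shows "e * mat_poly g (e * X) = e * mat_poly g X"
proof (induction g)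
  case (pCons a g)
  have "e * (e * X * mat_poly g (e * X)) = X * (e * mat_poly g (e * X))"
    using assms by (metis mult.assoc)
  also have "\<dots> = e * (X * mat_poly g X)" using pCons assms by (metis mult.assoc)
  finally show ?case by (simp add: distrib_left)
qed simp

lemma (in weights) component_sum: "v = (\<Sum>f\<in>F. act f v)"
  by (simp add: F_sum flip: act_sum)

lemma (in weights) F_zero:
  assumes "\<And>f g. f \<in> F \<Longrightarrow> g \<in> F \<Longrightarrow> f * X * g = 0"
  shows "X = 0"
proof -
  have "f * X = 0" if "f \<in> F" for f
    by (subst F_expand(2)) (simp add: assms that)
  then show ?thesis by (subst F_expand(1)) simp
qed

subsection \<open>Trace forms of a simple Lie algebra\<close>

locale adj_weights = weights B H "ad B" F wt
  for B :: "complex^'d \<Rightarrow> complex^'d \<Rightarrow> complex^'d" and H F wt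
begin

lemma B_expand: "B x y = (\<Sum>f\<in>F. \<Sum>g\<in>F. B (act f x) (act g y))"
proof -
  have "B x y = B (\<Sum>f\<in>F. act f x) (\<Sum>g\<in>F. act g y)" by (simp only: component_sum[symmetric])
  also have "\<dots> = (\<Sum>f\<in>F. B (act f x) (\<Sum>g\<in>F. act g y))" by (rule B_sum_left)
  finally show ?thesis by (simp only: B_sum_right)
qed

lemma ad_component_wspace:
  assumes "f \<in> F"
  shows "act f x \<in> wspace H (wt f)"
  unfolding wspace_def
proof safe
  fix h assume "h \<in> H"
  then obtain N where "(ad B h - cs (wt f h)) ^ N * f = 0" using F_nil[OF assms] by blast
  then show "\<exists>N. act ((ad B h - cs (wt f h)) ^ N) (act f x) = 0" by (metis act_0 act_mult)
qed

end

locale simple_cartan = cartan B H for B :: "complex^'d \<Rightarrow> complex^'d \<Rightarrow> complex^'d" and H +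
  assumes simple: "simple_lie B"
begin

lemma ideal_trivial: "lie_ideal B I \<Longrightarrow> I = {0} \<or> I = UNIV"
  and non_abelian: "\<exists>x y. B x y \<noteq> 0"
  using simple by (auto simp: simple_lie_def)

lemma perfect: "vec.span {B x y |x y. True} = UNIV"
proof -
  have "lie_ideal B (vec.span {B x y |x y. True})"
    unfolding lie_ideal_def by (auto intro: vec.span_base)
  moreover obtain x y where "B x y \<noteq> 0" using non_abelian by blast
  then have "vec.span {B x y |x y. True} \<noteq> {0}" using vec.span_base[of "B x y" "{B x y |x y. True}"] by auto
  ultimately show ?thesis using ideal_trivial by blast
qed

lemma weights_exist:
  assumes "rep B \<rho>"
  shows "\<exists>F wt. weights B H \<rho> F wt"
proof -
  obtain F wt where "weight_system \<rho> H 1 F wt" using weight_system_exists[OF assms, of 1] by auto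
  then show ?thesis using assms by (metis weights.intro weights_axioms.intro nilp_sub_axioms)
qed

text \<open>g = [g, g], and every bracket is a sum of brackets of weight components.\<close>

lemma functional_zero:
  fixes L :: "complex^'d \<Rightarrow> complex"
  assumes add: "\<And>x y. L (x + y) = L x + L y" and sc: "\<And>c x. L (c *s x) = c * L x"
    and z: "\<And>\<alpha> \<beta> x y. x \<in> wspace H \<alpha> \<Longrightarrow> y \<in> wspace H \<beta> \<Longrightarrow> L (B x y) = 0"
  shows "L v = 0"
proof -
  obtain F wt where "weights B H (ad B) F wt" using weights_exist[OF rep_ad] by blast
  then interpret W: adj_weights B H F wt by (rule adj_weights.intro)
  have L0: "L 0 = 0" using sc[of 0 0] by simp
  have Ls: "L (\<Sum>i\<in>I. g i) = (\<Sum>i\<in>I. L (g i))" for I and g :: "'d cmat \<Rightarrow> _"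
    by (induction I rule: infinite_finite_induct) (auto simp: add L0)
  have "L (B x y) = 0" for x y
  proof -
    have "L (B x y) = (\<Sum>f\<in>F. \<Sum>g\<in>F. L (B (act f x) (act g y)))"
      by (subst W.B_expand) (simp only: Ls)
    also have "\<dots> = 0"
      using z[OF W.ad_component_wspace W.ad_component_wspace] by (intro sum.neutral ballI) blast
    finally show ?thesis .
  qed
  moreover have "vec.subspace {v. L v = 0}"
    by (rule vec.subspaceI) (auto simp: add sc L0)
  ultimately have "vec.span {B x y |x y. True} \<subseteq> {v. L v = 0}" by (intro vec.span_minimal) auto
  then show ?thesis using perfect by auto
qed

lemma kernel_trivial:
  assumes "rep B \<rho>" "\<rho> x \<noteq> 0" "\<rho> y = 0"
  shows "y = 0"
proof -
  have "lie_ideal B {y. \<rho> y = 0}"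
    unfolding lie_ideal_def
    by (auto intro!: vec.subspaceI simp: rep_add[OF assms(1)] rep_scale[OF assms(1)] rep_0[OF assms(1)] rep_bracket[OF assms(1)])
  from ideal_trivial[OF this] show ?thesis using assms(2,3) by blast
qed

text \<open>Every element of \<open>H\<close> arising as a bracket of opposite weight vectors acts on all weight
  spaces by real multiples of a single complex number, so a vanishing trace form forces all
  weights to vanish.\<close>

lemma trace_form_nonzero:
  fixes \<rho> :: "complex^'d \<Rightarrow> 'k::finite cmat"
  assumes rep: "rep B \<rho>" and tf: "\<And>x y. tr (\<rho> x * \<rho> y) = 0"
  shows "\<rho> x = 0"
proof -
  obtain F wt where "weights B H \<rho> F wt" using weights_exist[OF rep] by blast
  then interpret V: weights B H \<rho> F wt .
  have wt0: "wt f h = 0" if f: "f \<in> F" and h: "h \<in> H" for f h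
  proof -
    have "tr (f * \<rho> z) = 0" for z
    proof (rule functional_zero[of "\<lambda>z. tr (f * \<rho> z)"])
      fix \<alpha> \<beta> x y assume x: "x \<in> wspace H \<alpha>" and y: "y \<in> wspace H \<beta>"
      let ?z = "B x y"
      show "tr (f * \<rho> ?z) = 0"
      proof (cases "\<exists>h\<in>H. \<alpha> h + \<beta> h \<noteq> 0")
        case True
        then obtain k where k: "k \<in> H" "\<alpha> k + \<beta> k \<noteq> 0" by blast
        then have "f * \<rho> ?z * f = 0" using V.shift[OF wspace_bracket[OF x y] f f _ k(1)] by force
        moreover have "tr (f * \<rho> ?z) = tr (f * \<rho> ?z * f)"
          using tr_comm[of f "f * \<rho> ?z"] V.F_idem[OF f] by (metis mult.assoc)
        ultimately show ?thesis by simp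
      next
        case False
        then have y': "y \<in> wspace H (\<lambda>h. - \<alpha> h)" using y wspace_cong[of H \<beta> "\<lambda>h. - \<alpha> h"] by (metis add_eq_0_iff)
        have "?z \<in> wspace H (\<lambda>_. 0)" using wspace_bracket[OF x y'] by simp
        then have zH: "?z \<in> H" by (simp add: wspace_0)
        have "\<forall>g\<in>F. \<exists>r::real. wt g ?z = of_real r * \<alpha> ?z" using V.string_ratio[OF x y' zH] by blast
        then obtain r :: "'k cmat \<Rightarrow> real" where r: "\<And>g. g \<in> F \<Longrightarrow> wt g ?z = of_real (r g) * \<alpha> ?z"
          unfolding bchoice_iff by blast
        \<comment> \<open>All weights at the bracket are real multiples of \<alpha> there, so the
          trace form is the square of that one number times a sum of nonnegative reals.\<close>
        have "0 = (\<Sum>g\<in>F. of_nat (rk g) * (wt g ?z)\<^sup>2)" using V.tr_square[OF zH] tf by simp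
        also have "\<dots> = (\<Sum>g\<in>F. of_real (rk g * (r g)\<^sup>2) * (\<alpha> ?z)\<^sup>2)"
          by (rule sum.cong) (simp_all add: r power_mult_distrib)
        also have "\<dots> = of_real (\<Sum>g\<in>F. rk g * (r g)\<^sup>2) * (\<alpha> ?z)\<^sup>2"
          by (simp add: sum_distrib_right)
        finally have "of_real (\<Sum>g\<in>F. rk g * (r g)\<^sup>2) * (\<alpha> ?z)\<^sup>2 = 0" by (rule sym)
        then have "(\<Sum>g\<in>F. rk g * (r g)\<^sup>2) = 0 \<or> \<alpha> ?z = 0"
          by (simp only: mult_eq_0_iff of_real_eq_0_iff power_eq_0_iff) simp
        moreover have "r f = 0" if "(\<Sum>g\<in>F. rk g * (r g)\<^sup>2) = 0"
        proof -
          have "rk f * (r f)\<^sup>2 = 0"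
            using that V.F_fin f by (subst (asm) sum_nonneg_eq_0_iff) auto
          then show ?thesis using rk_pos[OF V.F_idem[OF f] V.F_nz[OF f]] by simp
        qed
        ultimately have "wt f ?z = 0" using r[OF f] by auto
        then show ?thesis using V.tr_wt[OF f zH] by simp
      qed
    qed (auto simp: rep_add[OF rep] rep_scale[OF rep] distrib_left tr_add cs_left_commute tr_cs)
    then have "of_nat (rk f) * wt f h = 0" using V.tr_wt[OF f h] by simp
    then show ?thesis using rk_pos[OF V.F_idem[OF f] V.F_nz[OF f]] by simp
  qed
  obtain F' wt' where "weights B H (ad B) F' wt'" using weights_exist[OF rep_ad] by blast
  then interpret A: adj_weights B H F' wt' by (rule adj_weights.intro)
  \<comment> \<open>Were all weights of the adjoint representation zero, g would equal H and be
    nilpotent, against g = [g, g].\<close>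
  have "\<exists>f\<in>F'. \<exists>h\<in>H. wt' f h \<noteq> 0"
  proof (rule ccontr)
    assume "\<not> ?thesis"
    then have "wspace H (wt' f) = H" if "f \<in> F'" for f using that wspace_cong[of H "wt' f" "\<lambda>_. 0"] wspace_0 by auto
    then have "act f v \<in> H" if "f \<in> F'" for f v using A.ad_component_wspace[OF that] that by blast
    then have "v \<in> H" for v using A.component_sum[of v] H_subspace by (metis vec.subspace_sum)
    then have "H = UNIV" by auto
    then have "lcs B H k = UNIV" for k using perfect by (induction k) auto
    moreover have "(UNIV :: (complex^'d) set) \<noteq> {0}" using non_abelian by auto
    ultimately show False using H_nil by auto
  qed
  then obtain f h where f: "f \<in> F'" "h \<in> H" "wt' f h \<noteq> 0" by blast
  obtain v where v: "act f v \<noteq> 0" using A.F_nz[OF f(1)] by (metis act_0 cmat_ext)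
  \<comment> \<open>\<open>act f v\<close> has a nonzero weight and must shift the weights of
    \<rho>, but these all vanish on H, so no block survives.\<close>
  have "g * \<rho> (act f v) * g' = 0" if "g \<in> F" "g' \<in> F" for g g'
    using V.shift[OF A.ad_component_wspace[OF f(1)] that _ f(2)] wt0 that f by force
  then have "\<rho> (act f v) = 0"
    by (rule V.F_zero)
  then show ?thesis using kernel_trivial[OF rep] v by blast
qed

lemma trace_form_invariant:
  assumes "rep B \<rho>"
  shows "tr (\<rho> (B x y) * \<rho> z) = tr (\<rho> x * \<rho> (B y z))"
  using tr_comm[of "\<rho> y" "\<rho> x * \<rho> z"]
  by (simp add: rep_bracket[OF assms] left_diff_distrib right_diff_distrib tr_diff mult.assoc)

lemma trace_form_nondegenerate:
  assumes rep: "rep B \<rho>" and nz: "\<rho> x0 \<noteq> 0" and z: "\<And>y. tr (\<rho> x * \<rho> y) = 0"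
  shows "x = 0"
proof -
  let ?I = "{x. \<forall>y. tr (\<rho> x * \<rho> y) = 0}"
  have "B w x \<in> ?I" if "x \<in> ?I" for w x
  proof -
    have "tr (\<rho> (B w x) * \<rho> y) = - tr (\<rho> (B x w) * \<rho> y)" for y
      by (simp add: B_anti[of w x] rep_minus[OF rep]) (metis add_cancel_right_left add_eq_0_iff diff_0 minus_mult_left tr_0 tr_diff)
    then show ?thesis using that by (simp add: trace_form_invariant[OF rep])
  qed
  then have "lie_ideal B ?I"
    unfolding lie_ideal_def
    by (auto intro!: vec.subspaceI simp: rep_add[OF rep] rep_scale[OF rep] rep_0[OF rep] distrib_right tr_add mult.assoc tr_cs)
  from ideal_trivial[OF this] show ?thesis
    using trace_form_nonzero[OF rep, of x0] nz z by auto
qed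

section \<open>Duality and Casimir elements\<close>

lemma trace_form_represents:
  fixes L :: "complex^'d \<Rightarrow> complex"
  assumes rep: "rep B \<rho>" and nz: "\<rho> x0 \<noteq> 0"
    and add: "\<And>x y. L (x + y) = L x + L y" and sc: "\<And>c x. L (c *s x) = c * L x"
  shows "\<exists>d. \<forall>y. tr (\<rho> d * \<rho> y) = L y"
proof -
  define T where "T = (\<lambda>d. \<chi> i. tr (\<rho> d * \<rho> (axis i 1)))"
  have "clin T"
    by (rule clinI) (simp_all add: T_def vec_eq_iff rep_add[OF rep] rep_scale[OF rep] distrib_right tr_add mult.assoc tr_cs)
  have ext: "M y = M' y" if "\<And>x y. M (x + y) = M x + M y" "\<And>c x. M (c *s x) = c * M x"
     "\<And>x y. M' (x + y) = M' x + M' y" "\<And>c x. M' (c *s x) = c * M' x" "\<And>i. M (axis i 1) = M' (axis i 1)"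
   for M M' :: "complex^'d \<Rightarrow> complex" and y
  proof -
    have s: "Q (\<Sum>i\<in>UNIV. y $ i *s axis i 1) = (\<Sum>i\<in>UNIV. y $ i * Q (axis i 1))"
      if "\<And>x y. Q (x + y) = Q x + Q y" "\<And>c x. Q (c *s x) = c * Q x" for Q :: "complex^'d \<Rightarrow> complex"
    proof -
      have "Q 0 = 0" using that(2)[of 0 0] by simp
      then have "Q (\<Sum>i\<in>I. y $ i *s axis i 1) = (\<Sum>i\<in>I. y $ i * Q (axis i 1))" for I
        by (induction I rule: infinite_finite_induct) (auto simp: that)
      then show ?thesis .
    qed
    show ?thesis using s[OF that(1,2)] s[OF that(3,4)] that(5) by (simp add: basis_expansion)
  qed
  have "inj T"
  proof (rule injI)
    fix a b assume "T a = T b"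
    then have eq: "tr (\<rho> a * \<rho> (axis i 1)) = tr (\<rho> b * \<rho> (axis i 1))" for i by (simp add: T_def vec_eq_iff)
    have "tr (\<rho> a * \<rho> y) = tr (\<rho> b * \<rho> y)" for y
      by (rule ext) (simp_all add: rep_add[OF rep] rep_scale[OF rep] distrib_left tr_add cs_left_commute tr_cs eq)
    then have "a - b = 0"
      by (intro trace_form_nondegenerate[OF rep nz]) (simp add: rep_diff[OF rep] left_diff_distrib tr_diff)
    then show "a = b" by simp
  qed
  then have "surj T" using \<open>clin T\<close> by (simp add: clin_def vec.linear_injective_imp_surjective)
  then obtain d where "T d = (\<chi> i. L (axis i 1))" by (metis surjD)
  then have eq: "tr (\<rho> d * \<rho> (axis i 1)) = L (axis i 1)" for i by (simp add: T_def vec_eq_iff)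
  have "tr (\<rho> d * \<rho> y) = L y" for y
    by (rule ext) (simp_all add: rep_add[OF rep] rep_scale[OF rep] distrib_left tr_add cs_left_commute tr_cs eq add sc)
  then show ?thesis by blast
qed

text \<open>C pairs the standard basis with its dual basis b for the trace form. By invariance x
  acts on dual bases by negative transposes, so the two sums in [x, C] cancel. The trace counts the
  dual pairs, so C is not nilpotent.\<close>

lemma casimir:
  assumes rep: "rep B \<rho>" and nz: "\<rho> x0 \<noteq> 0"
  shows "\<exists>b C. C = (\<Sum>i\<in>UNIV. \<rho> (axis i 1) * \<rho> (b i)) \<and> (\<forall>x. \<rho> x * C = C * \<rho> x) \<and> tr C = of_nat CARD('d)"
proof -
  define k where "k = (\<lambda>x y. tr (\<rho> x * \<rho> y))"
  have "\<exists>d. \<forall>y. tr (\<rho> d * \<rho> y) = y $ i" for i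
    by (rule trace_form_represents[OF rep nz]) simp_all
  then obtain b where b: "\<And>i y. k (b i) y = y $ i" unfolding k_def by metis
  define a where "a = (\<lambda>i::'d. axis i (1::complex))"
  have ksym: "k x y = k y x" for x y unfolding k_def by (rule tr_comm)
  have ks: "k (\<Sum>i\<in>UNIV. c i *s u i) z = (\<Sum>i\<in>UNIV. c i * k (u i) z)" for c u z
    by (simp add: k_def rep_sum[OF rep] rep_scale[OF rep] sum_distrib_right tr_sum tr_cs mult.assoc)
  have e1: "y = (\<Sum>j\<in>UNIV. k (b j) y *s a j)" for y by (simp add: b a_def basis_expansion)
  have e2: "y = (\<Sum>j\<in>UNIV. k (a j) y *s b j)" for y
  proof -
    have "k (y - (\<Sum>j\<in>UNIV. k (a j) y *s b j)) z = 0" for z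
    proof -
      have "k (y - w) z = k y z - k w z" for w
        by (simp add: k_def rep_diff[OF rep] left_diff_distrib tr_diff)
      moreover have "k (\<Sum>j\<in>UNIV. k (a j) y *s b j) z = (\<Sum>j\<in>UNIV. z $ j * k (a j) y)"
        by (simp add: ks b mult.commute)
      moreover have "\<dots> = k (\<Sum>j\<in>UNIV. z $ j *s a j) y" by (simp add: ks)
      moreover have "(\<Sum>j\<in>UNIV. z $ j *s a j) = z" by (simp add: a_def basis_expansion)
      ultimately show ?thesis using ksym[of y z] by simp
    qed
    then have "y - (\<Sum>j\<in>UNIV. k (a j) y *s b j) = 0"
      by (intro trace_form_nondegenerate[OF rep nz]) (simp add: k_def)
    then show ?thesis by simp
  qed
  let ?C = "\<Sum>i\<in>UNIV. \<rho> (a i) * \<rho> (b i)"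
  have inv: "k (a i) (B x (b j)) = - k (b j) (B x (a i))" for x i j
  proof -
    have "k (a i) (B x (b j)) = k (B (a i) x) (b j)" unfolding k_def by (rule trace_form_invariant[OF rep, symmetric])
    also have "\<dots> = - k (B x (a i)) (b j)"
      unfolding B_anti[of "a i" x] k_def rep_minus[OF rep] by (metis diff_0 minus_mult_left tr_0 tr_diff)
    finally show ?thesis using ksym by simp
  qed
  have "\<rho> x * ?C - ?C * \<rho> x = 0" for x
  proof -
    have "\<rho> x * ?C - ?C * \<rho> x = (\<Sum>i\<in>UNIV. \<rho> (B x (a i)) * \<rho> (b i) + \<rho> (a i) * \<rho> (B x (b i)))"
      by (simp add: sum_distrib_left sum_distrib_right rep_bracket[OF rep] algebra_simps flip: sum_subtractf)
    also have "\<dots> = (\<Sum>i\<in>UNIV. \<rho> (B x (a i)) * \<rho> (b i)) + (\<Sum>i\<in>UNIV. \<rho> (a i) * \<rho> (B x (b i)))"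
      by (rule sum.distrib)
    also have "(\<Sum>i\<in>UNIV. \<rho> (B x (a i)) * \<rho> (b i)) = (\<Sum>i\<in>UNIV. \<Sum>j\<in>UNIV. cs (k (b j) (B x (a i))) * (\<rho> (a j) * \<rho> (b i)))"
      by (subst e1) (simp add: rep_sum[OF rep] rep_scale[OF rep] sum_distrib_right mult.assoc)
    also have "(\<Sum>i\<in>UNIV. \<rho> (a i) * \<rho> (B x (b i))) = (\<Sum>i\<in>UNIV. \<Sum>j\<in>UNIV. cs (k (a j) (B x (b i))) * (\<rho> (a i) * \<rho> (b j)))"
      by (subst e2) (simp add: rep_sum[OF rep] rep_scale[OF rep] sum_distrib_left cs_left_commute)
    also have "\<dots> = (\<Sum>j\<in>UNIV. \<Sum>i\<in>UNIV. cs (k (a j) (B x (b i))) * (\<rho> (a i) * \<rho> (b j)))"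
      by (rule sum.swap)
    also have "\<dots> = - (\<Sum>i\<in>UNIV. \<Sum>j\<in>UNIV. cs (k (b j) (B x (a i))) * (\<rho> (a j) * \<rho> (b i)))"
      by (simp add: inv cs_minus sum_negf)
    finally show ?thesis by simp
  qed
  then have 1: "\<rho> x * ?C = ?C * \<rho> x" for x by simp
  have "tr ?C = (\<Sum>i\<in>UNIV. k (b i) (a i))"
    by (simp add: tr_sum k_def) (rule sum.cong, simp, rule tr_comm)
  then have 2: "tr ?C = of_nat CARD('d)" by (simp add: b a_def)
  show ?thesis using 1 2 unfolding a_def by blast
qed

text \<open>The element \<open>u\<close> maps onto the invariants and fixes them. It is a product of factors
  \<open>1 - g(C)\<close>, where \<open>C\<close> is a Casimir element and \<open>g(C)\<close> its Fitting idempotent; each factor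
  splits off a summand on which \<open>C\<close> is invertible, and since \<open>tr C \<noteq> 0\<close> the summand is not zero.\<close>

lemma reynolds_idempotent:
  assumes rep: "rep B \<rho>"
  shows "e * e = e \<Longrightarrow> (\<And>x. \<rho> x * e = e * \<rho> x) \<Longrightarrow> \<exists>u. aug u = 1 \<and> (\<forall>x. \<rho> x * ev \<rho> u * e = 0)"
proof (induction "rk e" arbitrary: e rule: less_induct)
  case less
  note ee = less.prems(1) and com = less.prems(2)
  show ?case
  proof (cases "\<forall>x. e * \<rho> x = 0")
    case True
    then show ?thesis using com by (intro exI[of _ "Con 1"]) simp
  next
    case False
    then obtain x0 where x0: "e * \<rho> x0 \<noteq> 0" by blast
    define \<sigma> where "\<sigma> = (\<lambda>x. e * \<rho> x)"
    have mul: "\<sigma> x * \<sigma> y = e * (\<rho> x * \<rho> y)" for x y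
    proof -
      have "\<sigma> x * \<sigma> y = e * (\<rho> x * e) * \<rho> y" by (simp add: \<sigma>_def mult.assoc)
      also have "\<dots> = (e * e) * \<rho> x * \<rho> y" unfolding com by (simp add: mult.assoc)
      finally show ?thesis by (simp add: ee mult.assoc)
    qed
    have rs: "rep B \<sigma>"
      unfolding rep_def mul unfolding \<sigma>_def
      by (auto simp: rep_add[OF rep] rep_scale[OF rep] rep_bracket[OF rep] cs_left_commute algebra_simps)
    have "\<sigma> x0 \<noteq> 0" using x0 by (simp add: \<sigma>_def)
    then obtain b C where C_def: "C = (\<Sum>i\<in>UNIV. \<sigma> (axis i 1) * \<sigma> (b i))"
        and b: "\<forall>x. \<sigma> x * C = C * \<sigma> x" "tr C = of_nat CARD('d)"
      using casimir[OF rs] by blast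
    \<comment> \<open>A formal Casimir sum: it acts as C on the range of e and has constant term
      0.\<close>
    obtain c where c: "ev \<rho> c = (\<Sum>i\<in>UNIV. ev \<rho> (Times (Gen (axis i 1)) (Gen (b i))))"
       "aug c = (\<Sum>i\<in>(UNIV::'d set). aug (Times (Gen (axis i (1::complex))) (Gen (b i))))"
      using free_alg_sum[of UNIV \<rho> "\<lambda>i. Times (Gen (axis i 1)) (Gen (b i))"] by auto
    have Cc: "C = e * ev \<rho> c" by (simp add: c C_def mul sum_distrib_left)
    have augc: "aug c = 0" using c(2) by simp
    have evcom: "ev \<rho> u * e = e * ev \<rho> u" for u using ev_commute[OF com] .
    have Ce: "e * C = C" "C * e = C" using evcom[of c] by (simp_all add: Cc ee mult.assoc) (simp_all flip: mult.assoc add: ee)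
    obtain g N where g: "poly g 0 = 0" "mat_poly g C * mat_poly g C = mat_poly g C" "C ^ N * mat_poly g C = C ^ N"
      "\<forall>M W. W * C ^ M = 0 \<longrightarrow> W * mat_poly g C = 0" "\<forall>M W. C ^ M * W = 0 \<longrightarrow> mat_poly g C * W = 0"
      by (rule fitting_idempotent[of C])
    obtain gc where gc: "ev \<rho> gc = mat_poly g (ev \<rho> c)" "aug gc = poly g (aug c)" using free_alg_poly by blast
    define p where "p = mat_poly g C"
    obtain g' where g': "g = pCons 0 g'" using g(1) by (cases g) auto
    have ep: "e * p = p" by (simp add: p_def g' Ce flip: mult.assoc)
    have "p = e * mat_poly g (e * ev \<rho> c)" using ep by (simp add: p_def Cc)
    also have "\<dots> = e * ev \<rho> gc" using mat_poly_idempotent_left[OF ee evcom] gc by metis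
    finally have pgc: "p = e * ev \<rho> gc" .
    have pe: "p * e = p" using ep pgc evcom by (metis mult.assoc ee)
    have pp: "p * p = p" using g(2) by (simp add: p_def)
    have pcom: "\<rho> x * p = p * \<rho> x" for x
    proof -
      have "\<sigma> x * p = p * \<sigma> x" unfolding p_def by (rule mat_poly_commute[symmetric]) (simp add: b)
      moreover have "\<sigma> x * p = \<rho> x * p" by (simp add: \<sigma>_def ep mult.assoc flip: com)
      moreover have "p * \<sigma> x = p * \<rho> x" by (simp add: \<sigma>_def pe flip: mult.assoc)
      ultimately show ?thesis by simp
    qed
    have "p \<noteq> 0"
    proof
      assume "p = 0"
      then have "C ^ N = 0" using g(3) by (simp add: p_def)
      then have "tr C = 0" by (rule tr_nilpotent)
      then show False using b(2) by simp
    qed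
    define e1 where "e1 = e - p"
    have e1: "e1 * e1 = e1" by (simp add: e1_def algebra_simps ee pe ep pp)
    have e1com: "\<rho> x * e1 = e1 * \<rho> x" for x by (simp add: e1_def algebra_simps com pcom)
    have "tr e = tr e1 + tr p" by (simp add: e1_def tr_diff)
    then have "rk e = rk e1 + rk p"
      using tr_idempotent[OF ee] tr_idempotent[OF e1] tr_idempotent[OF pp] by (metis of_nat_add of_nat_eq_iff)
    then have "rk e1 < rk e" using rk_pos[OF pp \<open>p \<noteq> 0\<close>] by simp
    from less.hyps[OF this e1 e1com] obtain u where u: "aug u = 1" "\<And>x. \<rho> x * ev \<rho> u * e1 = 0" by blast
    \<comment> \<open>The factor 1 - g(c) acts on the range of e as e - p, and its constant term is
      1 because c has constant term 0 and g(0) = 0.\<close>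
    let ?u = "Times u (Plus (Con 1) (Times (Con (- 1)) gc))"
    have "aug ?u = 1" using u(1) gc(2) augc g(1) by simp
    moreover have "\<rho> x * ev \<rho> ?u * e = 0" for x
    proof -
      have "(1 - ev \<rho> gc) * e = e1" by (simp add: e1_def pgc left_diff_distrib evcom)
      then have "\<rho> x * ev \<rho> u * ((1 - ev \<rho> gc) * e) = 0" using u(2) by simp
      then show ?thesis by (simp add: cs_minus mult.assoc)
    qed
    ultimately show ?thesis by blast
  qed
qed

lemma reynolds: "rep B \<rho> \<Longrightarrow> \<exists>u. aug u = 1 \<and> (\<forall>x. \<rho> x * ev \<rho> u = 0)"
  using reynolds_idempotent[of \<rho> 1] by simp

end

subsection \<open>Root spaces\<close>

locale root_setup = simple_cartan B H + adj_weights B H F wt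
  for B :: "complex^'d \<Rightarrow> complex^'d \<Rightarrow> complex^'d" and H F wt
begin

text \<open>The Killing form.\<close>

definition K :: "complex^'d \<Rightarrow> complex^'d \<Rightarrow> complex" where
  "K x y = tr (ad B x * ad B y)"

lemma ad_nonzero: "\<exists>x. ad B x \<noteq> 0"
  using non_abelian by (metis act_0 act_ad)

lemma K_nondegenerate: "(\<And>y. K x y = 0) \<Longrightarrow> x = 0"
  using ad_nonzero trace_form_nondegenerate[OF rep_ad] unfolding K_def by blast

lemma K_represents:
  fixes L :: "complex^'d \<Rightarrow> complex"
  assumes "\<And>x y. L (x + y) = L x + L y" "\<And>c x. L (c *s x) = c * L x"
  shows "\<exists>d. \<forall>y. K d y = L y"
  using ad_nonzero trace_form_represents[OF rep_ad _ assms] unfolding K_def by blast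

lemma K_invariant: "K (B x y) z = K x (B y z)"
  unfolding K_def by (rule trace_form_invariant[OF rep_ad])

lemma K_sym: "K x y = K y x" unfolding K_def by (rule tr_comm)

lemma K_add_right: "K x (y + z) = K x y + K x z"
  and K_scale_right: "K x (c *s y) = c * K x y"
  by (simp_all add: K_def rep_add[OF rep_ad] rep_scale[OF rep_ad] distrib_left tr_add cs_left_commute tr_cs)

lemma K_add_left: "K (y + z) x = K y x + K z x"
  and K_scale_left: "K (c *s y) x = c * K y x"
  using K_add_right K_scale_right K_sym by metis+

lemma K_0 [simp]: "K x 0 = 0" "K 0 x = 0"
  using K_scale_right[of x 0 0] K_scale_left[of 0 0 x] by simp_all

lemma K_minus_right: "K x (- y) = - K x y"
  using K_scale_right[of x "-1" y] by simp
lemma K_diff_right: "K x (y - z) = K x y - K x z"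
  using K_add_right[of x y "- z"] by (simp add: K_minus_right)
lemma K_diff_left: "K (y - z) x = K y x - K z x"
  using K_diff_right K_sym by metis

lemma K_sum_right: "K x (\<Sum>i\<in>I. y i) = (\<Sum>i\<in>I. K x (y i))"
  by (induction I rule: infinite_finite_induct) (auto simp: K_add_right)

lemma K_orthogonal:
  "x \<in> wspace H \<alpha> \<Longrightarrow> y \<in> wspace H \<beta> \<Longrightarrow> h \<in> H \<Longrightarrow> \<alpha> h + \<beta> h \<noteq> 0 \<Longrightarrow> K x y = 0"
  unfolding K_def by (rule tr_orthogonal)

lemma pairing_exists:
  assumes x: "x \<in> wspace H \<alpha>" "x \<noteq> 0"
  shows "\<exists>y \<in> wspace H (\<lambda>h. - \<alpha> h). K x y = 1"
proof -
  obtain z where z: "K x z \<noteq> 0" using K_nondegenerate x(2) by blast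
  have "K x z = (\<Sum>f\<in>F. K x (act f z))" by (subst component_sum) (rule K_sum_right)
  then obtain f where f: "f \<in> F" "K x (act f z) \<noteq> 0" using z by (metis (no_types, lifting) sum.neutral)
  have "\<forall>h\<in>H. \<alpha> h + wt f h = 0" using K_orthogonal[OF x(1) ad_component_wspace[OF f(1)]] f(2) by blast
  then have "wspace H (wt f) = wspace H (\<lambda>h. - \<alpha> h)" by (intro wspace_cong) (simp add: eq_neg_iff_add_eq_0 add.commute)
  then have "act f z \<in> wspace H (\<lambda>h. - \<alpha> h)" using ad_component_wspace[OF f(1)] by blast
  then have "(1 / K x (act f z)) *s act f z \<in> wspace H (\<lambda>h. - \<alpha> h)" by (rule wspace_scale)
  moreover have "K x ((1 / K x (act f z)) *s act f z) = 1" using f(2) by (simp add: K_scale_right)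
  ultimately show ?thesis by blast
qed

lemma K_nondegenerate_H:
  assumes "h \<in> H" "\<And>k. k \<in> H \<Longrightarrow> K h k = 0"
  shows "h = 0"
proof (rule ccontr)
  assume "h \<noteq> 0"
  have "h \<in> wspace H (\<lambda>_. 0)" using assms(1) wspace_0 by simp
  from pairing_exists[OF this \<open>h \<noteq> 0\<close>] show False using assms(2) wspace_0 by auto
qed

lemma weights_separate:
  assumes "h \<in> H" "\<And>f. f \<in> F \<Longrightarrow> wt f h = 0"
  shows "h = 0"
proof (rule K_nondegenerate_H[OF assms(1)])
  fix k assume "k \<in> H"
  then show "K h k = 0" unfolding K_def by (simp add: tr_prod assms)
qed

lemma component_wt:
  assumes z: "z \<in> wspace H \<gamma>" and f: "f \<in> F" and nz: "act f z \<noteq> 0" and h: "h \<in> H"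
  shows "wt f h = \<gamma> h"
proof (rule ccontr)
  assume ne: "wt f h \<noteq> \<gamma> h"
  let ?P = "ad B h - cs (\<gamma> h)" and ?Q = "ad B h - cs (wt f h)"
  obtain m where m: "act (?P ^ m) z = 0" using z h by (auto simp: wspace_def)
  obtain N where N: "act (?Q ^ N) (act f z) = 0" using ad_component_wspace[OF f, of z] h by (auto simp: wspace_def)
  have "?P ^ m * f = f * ?P ^ m" using F_comm_shift[OF f h] by (metis power_commuting_commutes)
  then have "act (?P ^ m) (act f z) = 0" using m by (metis act_mult act_v0)
  moreover have "?P - ?Q = cs (wt f h - \<gamma> h)" by (simp add: cs_diff)
  moreover have "wt f h - \<gamma> h \<noteq> 0" using ne by simp
  ultimately show False using coprime_shift_vector[OF _ _ _ N] nz by blast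
qed

text \<open>The semisimple part of \<open>ad h\<close> is a derivation, hence inner, say \<open>ad d\<close>. It kills \<open>H\<close>, so
  \<open>d\<close> normalizes \<open>H\<close>; as \<open>d\<close> and \<open>h\<close> have the same weights, \<open>d = h\<close>.\<close>

lemma wspace_eigen:
  assumes h: "h \<in> H" and x: "x \<in> wspace H \<gamma>"
  shows "B h x = \<gamma> h *s x"
proof -
  define D where "D = (\<Sum>f\<in>F. cs (wt f h) * f)"
  have D: "act D z = \<gamma> h *s z" if z: "z \<in> wspace H \<gamma>" for z \<gamma>
  proof -
    have "act D z = (\<Sum>f\<in>F. wt f h *s act f z)" by (simp add: D_def act_sum act_mult)
    also have "\<dots> = (\<Sum>f\<in>F. \<gamma> h *s act f z)"
    proof (rule sum.cong[OF refl])
      fix f assume "f \<in> F"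
      then show "wt f h *s act f z = \<gamma> h *s act f z"
        using component_wt[OF z \<open>f \<in> F\<close> _ h] by (cases "act f z = 0") auto
    qed
    also have "\<dots> = \<gamma> h *s (\<Sum>f\<in>F. act f z)" by (simp add: vec.scale_sum_right)
    also have "(\<Sum>f\<in>F. act f z) = z" by (rule component_sum[symmetric])
    finally show ?thesis .
  qed
  have deriv: "act D (B x y) = B (act D x) y + B x (act D y)" for x y
  proof -
    have Dx: "act D x = (\<Sum>f\<in>F. act D (act f x))" for x
      by (subst component_sum[of x]) (rule act_vsum)
    have "act D (B x y) = (\<Sum>f\<in>F. \<Sum>g\<in>F. act D (B (act f x) (act g y)))"
      by (subst B_expand) (simp only: act_vsum)
    also have "\<dots> = (\<Sum>f\<in>F. \<Sum>g\<in>F. B (act D (act f x)) (act g y) + B (act f x) (act D (act g y)))"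
    proof (intro sum.cong refl)
      fix f g assume fg: "f \<in> F" "g \<in> F"
      note gx = ad_component_wspace[OF fg(1), of x] and gy = ad_component_wspace[OF fg(2), of y]
      show "act D (B (act f x) (act g y)) = B (act D (act f x)) (act g y) + B (act f x) (act D (act g y))"
        by (simp add: D[OF gx] D[OF gy] D[OF wspace_bracket[OF gx gy]] B_scale_left B_scale_right vec.scale_left_distrib)
    qed
    also have "\<dots> = (\<Sum>f\<in>F. B (act D (act f x)) y) + (\<Sum>f\<in>F. B (act f x) (act D y))"
    proof -
      have "(\<Sum>g\<in>F. B a (act g y)) = B a y" for a using component_sum[of y] by (metis B_sum_right)
      moreover have "(\<Sum>g\<in>F. B a (act D (act g y))) = B a (act D y)" for a by (metis B_sum_right Dx)
      ultimately show ?thesis by (simp add: sum.distrib)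
    qed
    also have "(\<Sum>f\<in>F. B (act D (act f x)) y) = B (act D x) y" by (metis B_sum_left Dx)
    also have "(\<Sum>f\<in>F. B (act f x) (act D y)) = B x (act D y)" by (metis B_sum_left component_sum)
    finally show ?thesis .
  qed
  \<comment> \<open>d represents y -> tr(D ad y) under the Killing form; the derivation rule and
    nondegeneracy then give D = ad d.\<close>
  obtain d where d: "\<And>y. K d y = tr (D * ad B y)"
    using K_represents[of "\<lambda>y. tr (D * ad B y)"]
    by (auto simp: rep_add[OF rep_ad] rep_scale[OF rep_ad] distrib_left tr_add cs_left_commute tr_cs)
  have inner: "act D x = B d x" for x
  proof -
    have 1: "ad B (act D x) = D * ad B x - ad B x * D"
      by (rule cmat_ext) (simp add: act_diff act_mult deriv)
    have "K (act D x - B d x) y = 0" for y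
    proof -
      have "K (act D x) y = tr (D * ad B x * ad B y) - tr (ad B x * D * ad B y)"
        by (simp add: K_def 1 left_diff_distrib tr_diff)
      also have "tr (ad B x * D * ad B y) = tr (D * ad B y * ad B x)"
        using tr_comm[of "ad B x" "D * ad B y"] by (simp add: mult.assoc)
      finally have "K (act D x) y = tr (D * ad B (B x y))"
        by (simp add: rep_bracket[OF rep_ad] right_diff_distrib tr_diff mult.assoc)
      also have "\<dots> = K d (B x y)" by (simp add: d)
      also have "\<dots> = K (B d x) y" by (simp add: K_invariant)
      finally show ?thesis by (simp add: K_diff_left)
    qed
    then have "act D x - B d x = 0" by (rule K_nondegenerate)
    then show ?thesis by simp
  qed
  have "B d y \<in> H" if "y \<in> H" for y
  proof -
    have "act D y = 0" using D[of y "\<lambda>_. 0"] that wspace_0 by simp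
    then show ?thesis by (simp add: inner H_0)
  qed
  then have dH: "d \<in> H" using norm_H by (auto simp: normalizer_def)
  have adD: "ad B d = D" by (rule cmat_ext) (simp add: inner)
  have "wt f d = wt f h" if f: "f \<in> F" for f
  proof -
    have "f * D = (\<Sum>g\<in>F. if g = f then cs (wt f h) * f else 0)"
      unfolding D_def sum_distrib_left cs_left_commute
      by (intro sum.cong refl) (use F_orth[OF f] F_idem[OF f] in auto)
    then have "f * D = cs (wt f h) * f" using F_fin f by simp
    then have "of_nat (rk f) * wt f d = tr (cs (wt f h) * f)"
      using tr_wt[OF f dH] by (simp add: adD)
    also have "\<dots> = wt f h * of_nat (rk f)" by (simp add: tr_cs tr_idempotent[OF F_idem[OF f]])
    finally show ?thesis using rk_pos[OF F_idem[OF f] F_nz[OF f]] by simp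
  qed
  moreover have "wt f (d + (-1) *s h) = wt f d - wt f h" if "f \<in> F" for f
    using wt_add[OF that dH H_scale[OF h, of "-1"]] wt_scale[OF that h, of "-1"] by simp
  ultimately have "d + (-1) *s h = 0"
    by (intro weights_separate[OF H_add[OF dH H_scale[OF h]]]) simp
  then have "d = h" by (simp add: vec_eq_iff)
  then show ?thesis using D[OF x] by (simp add: inner)
qed

lemma wspace_root_space: "wspace H \<alpha> = root_space B H \<alpha>"
proof
  show "wspace H \<alpha> \<subseteq> root_space B H \<alpha>" using wspace_eigen by (auto simp: root_space_def)
  show "root_space B H \<alpha> \<subseteq> wspace H \<alpha>"
    by (auto simp: root_space_def wspace_def act_diff intro!: exI[of _ "1::nat"])
qed

lemma opposite_bracket:
  assumes x: "x \<in> wspace H \<alpha>" and y: "y \<in> wspace H (\<lambda>h. - \<alpha> h)"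
  shows "B x y \<in> H" "h \<in> H \<Longrightarrow> K (B x y) h = \<alpha> h * K x y"
proof -
  show "B x y \<in> H" using wspace_bracket[OF x y] wspace_0 by simp
  assume h: "h \<in> H"
  have "B y h = \<alpha> h *s y" using wspace_eigen[OF h y] B_anti[of y h] by simp
  then show "K (B x y) h = \<alpha> h * K x y" by (simp add: K_invariant K_scale_right)
qed

text \<open>If \<alpha> vanished at t = [x, y], \<open>string_ratio\<close> would make all weights
  vanish at t, so t = 0. But t represents \<alpha> on H under the Killing form, and \<alpha> k is
  not 0.\<close>

lemma root_coroot_nonzero:
  assumes x: "x \<in> wspace H \<alpha>" and y: "y \<in> wspace H (\<lambda>h. - \<alpha> h)" and xy: "K x y = 1"
    and nz: "k \<in> H" "\<alpha> k \<noteq> 0"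
  shows "\<alpha> (B x y) \<noteq> 0"
proof
  assume 0: "\<alpha> (B x y) = 0"
  have "B x y = 0"
    using string_ratio[OF x y opposite_bracket(1)[OF x y]] 0
    by (intro weights_separate opposite_bracket(1)[OF x y]) fastforce
  then have "\<alpha> k * K x y = 0" using opposite_bracket(2)[OF x y nz(1)] by simp
  then show False using xy nz by simp
qed

text \<open>If \<open>z\<close> in the root space of \<open>-\<alpha>\<close> is orthogonal to \<open>x\<close>, it is a highest weight vector of
  negative weight for the triple \<open>x, y, [x, y]\<close>, so its \<open>y\<close>-string never terminates.\<close>

lemma root_space_opposite:
  assumes x: "x \<in> wspace H \<alpha>" and y: "y \<in> wspace H (\<lambda>h. - \<alpha> h)" and xy: "K x y = 1"
    and nz: "k \<in> H" "\<alpha> k \<noteq> 0" and z: "z \<in> wspace H (\<lambda>h. - \<alpha> h)" and xz: "K x z = 0"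
  shows "z = 0"
proof (rule ccontr)
  assume z0: "z \<noteq> 0"
  define t where "t = B x y"
  define c where "c = \<alpha> t"
  have tH: "t \<in> H" unfolding t_def using opposite_bracket(1)[OF x y] .
  have c: "c \<noteq> 0" unfolding c_def t_def using root_coroot_nonzero[OF x y xy nz] .
  define s where "s = (\<lambda>n. act (ad B y ^ n) z)"
  have s_Suc: "s (Suc n) = B y (s n)" for n by (simp add: s_def act_mult)
  have s_wspace: "s n \<in> wspace H (\<lambda>h. - of_nat (Suc n) * \<alpha> h)" for n
  proof (induction n)
    case 0
    then show ?case using z by (simp add: s_def)
  next
    case (Suc n)
    have "wspace H (\<lambda>h. - \<alpha> h + - of_nat (Suc n) * \<alpha> h) = wspace H (\<lambda>h. - of_nat (Suc (Suc n)) * \<alpha> h)"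
      by (rule wspace_cong) (simp add: algebra_simps)
    then show ?case using wspace_bracket[OF y Suc] by (simp add: s_Suc)
  qed
  have ts: "B t (s n) = (- of_nat (Suc n) * c) *s s n" for n
    using wspace_eigen[OF tH s_wspace[of n]] by (simp add: c_def)
  have xz0: "B x z = 0"
    using opposite_bracket[OF x z] xz by (intro K_nondegenerate_H) auto
  \<comment> \<open>The coefficient sums the eigenvalues -c, -2c, ..., -(n + 1)c of t on
    \<open>s 0\<close>, ..., \<open>s n\<close>: a triangular number times -c.\<close>
  have xs: "B x (s (Suc n)) = (- c * (of_nat (Suc n) * of_nat (Suc (Suc n)) / 2)) *s s n" for n
  proof (induction n)
    case 0
    have "B x (s (Suc 0)) = B t (s 0) + B y (B x z)"
      unfolding s_Suc t_def using jacobi'[of x y "s 0"] by (simp add: s_def)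
    then show ?case by (simp add: xz0 ts)
  next
    case (Suc n)
    have "B x (s (Suc (Suc n))) = B t (s (Suc n)) + B y (B x (s (Suc n)))"
      unfolding s_Suc[of "Suc n"] t_def by (rule jacobi')
    also have "\<dots> = (- of_nat (Suc (Suc n)) * c + - c * (of_nat (Suc n) * of_nat (Suc (Suc n)) / 2)) *s s (Suc n)"
      unfolding ts Suc B_scale_right s_Suc[symmetric] by (simp add: vec.scale_left_distrib)
    also have "- of_nat (Suc (Suc n)) * c + - c * (of_nat (Suc n) * of_nat (Suc (Suc n)) / 2)
       = - c * (of_nat (Suc (Suc n)) * of_nat (Suc (Suc (Suc n))) / 2)"
      by (simp add: field_simps)
    finally show ?case .
  qed
  have snz: "s n \<noteq> 0" for n
  proof (induction n)
    case 0
    then show ?case using z0 by (simp add: s_def)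
  next
    case (Suc n)
    have "- c * (of_nat (Suc n) * of_nat (Suc (Suc n)) / 2) \<noteq> 0"
      using c by (simp del: of_nat_Suc)
    then have "B x (s (Suc n)) \<noteq> 0" using Suc unfolding xs by (metis vec.scale_eq_0_iff)
    then show ?case by auto
  qed
  have "\<exists>f\<in>F. act f (s n) \<noteq> 0" for n
    using snz[of n] component_sum[of "s n"] by (metis (no_types, lifting) sum.neutral)
  then obtain f where f: "\<And>n. f n \<in> F" "\<And>n. act (f n) (s n) \<noteq> 0" by metis
  have wt: "wt (f n) t = - of_nat (Suc n) * c" for n
    using component_wt[OF s_wspace f tH] by (simp add: c_def)
  have "inj f"
  proof (rule injI)
    fix m n assume "f m = f n"
    then have "- of_nat (Suc m) * c = - of_nat (Suc n) * c" using wt[of m] wt[of n] by metis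
    then show "m = n" using c by (simp del: of_nat_Suc)
  qed
  then have "infinite (range f)" by (rule range_inj_infinite)
  moreover have "range f \<subseteq> F" using f by auto
  ultimately show False using F_fin finite_subset by blast
qed

text \<open>\<open>root_space_opposite\<close> with \<alpha> and -\<alpha> exchanged: subtracting
  the right multiple of e makes z orthogonal to y.\<close>

lemma root_space_one_dimensional:
  assumes nz: "k \<in> H" "\<alpha> k \<noteq> 0" and e: "e \<in> wspace H \<alpha>" "e \<noteq> 0" and z: "z \<in> wspace H \<alpha>"
  shows "\<exists>c. z = c *s e"
proof -
  obtain y where y: "y \<in> wspace H (\<lambda>h. - \<alpha> h)" "K e y = 1" using pairing_exists[OF e] by blast
  have "z - K y z *s e = 0"
  proof (rule root_space_opposite[of y "\<lambda>h. - \<alpha> h" e k])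
    show "y \<in> wspace H (\<lambda>h. - \<alpha> h)" "e \<in> wspace H (\<lambda>h. - (- \<alpha> h))" "k \<in> H" "- \<alpha> k \<noteq> 0"
      using y e nz by simp_all
    show "K y e = 1" using y(2) K_sym by simp
    then show "K y (z - K y z *s e) = 0" by (simp add: K_diff_right K_scale_right)
    show "z - K y z *s e \<in> wspace H (\<lambda>h. - (- \<alpha> h))"
      using z e wspace_subspace by (simp add: vec.subspace_diff vec.subspace_scale)
  qed
  then show ?thesis by auto
qed

text \<open>Every bracket spanning the space of the coroot represents a multiple of \<alpha> on H,
  so v does too. A zero multiple would give v = 0, against \<alpha> v = 2.\<close>

lemma coroot_K:
  assumes co: "is_coroot B H \<alpha> v" and lin0: "\<alpha> 0 = 0"
  shows "\<exists>c. c \<noteq> 0 \<and> (\<forall>h\<in>H. K v h = c * \<alpha> h)"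
proof -
  let ?S = "{v. \<exists>c. \<forall>h\<in>H. K v h = c * \<alpha> h}"
  have "vec.subspace ?S"
  proof (rule vec.subspaceI)
    show "0 \<in> ?S" by (auto intro: exI[of _ 0])
    fix a b assume "a \<in> ?S" "b \<in> ?S"
    then obtain c d where "\<forall>h\<in>H. K a h = c * \<alpha> h" "\<forall>h\<in>H. K b h = d * \<alpha> h" by blast
    then show "a + b \<in> ?S" by (auto intro!: exI[of _ "c + d"] simp: K_add_left distrib_right)
  next
    fix r a assume "a \<in> ?S"
    then obtain c where "\<forall>h\<in>H. K a h = c * \<alpha> h" by blast
    then show "r *s a \<in> ?S" by (auto intro!: exI[of _ "r * c"] simp: K_scale_left)
  qed
  moreover have "B x y \<in> ?S" if "x \<in> wspace H \<alpha>" "y \<in> wspace H (\<lambda>v. - \<alpha> v)" for x y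
    using opposite_bracket(2)[OF that] by (auto intro!: exI[of _ "K x y"])
  ultimately have "vec.span {B x y |x y. x \<in> wspace H \<alpha> \<and> y \<in> wspace H (\<lambda>v. - \<alpha> v)} \<subseteq> ?S"
    by (intro vec.span_minimal) auto
  then have "v \<in> ?S" using co by (auto simp: is_coroot_def wspace_root_space)
  then obtain c where c: "\<forall>h\<in>H. K v h = c * \<alpha> h" by blast
  have "c \<noteq> 0"
  proof
    assume "c = 0"
    then have "v = 0" using c co by (intro K_nondegenerate_H) (auto simp: is_coroot_def)
    then show False using co lin0 by (simp add: is_coroot_def)
  qed
  then show ?thesis using c by blast
qed

text \<open>Linearity is not part of \<open>roots\<close>, so even the value at 0 has to be read off
  from a root vector.\<close>

lemma root_at_0: "\<beta> \<in> roots B H \<Longrightarrow> \<beta> 0 = 0"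
proof -
  assume "\<beta> \<in> roots B H"
  moreover have "0 \<in> root_space B H \<beta>" by (simp add: root_space_def)
  ultimately obtain x where x: "x \<in> root_space B H \<beta>" "x \<noteq> 0" unfolding roots_def by blast
  then have "B 0 x = \<beta> 0 *s x" using H_0 by (auto simp: root_space_def simp del: B_0_left)
  then show ?thesis using x(2) by (metis B_0_left vec.scale_eq_0_iff)
qed

lemma wt_root: "f \<in> F \<Longrightarrow> h \<in> H \<Longrightarrow> wt f h \<noteq> 0 \<Longrightarrow> wt f \<in> roots B H"
proof -
  assume f: "f \<in> F" "h \<in> H" "wt f h \<noteq> 0"
  obtain v where "act f v \<noteq> 0" using F_nz[OF f(1)] by (metis act_0 cmat_ext)
  then have "root_space B H (wt f) \<noteq> {0}" using ad_component_wspace[OF f(1), of v] by (auto simp: wspace_root_space)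
  then show ?thesis using f wt_outside[OF f(1)] by (auto simp: roots_def)
qed

lemma finite_roots: "finite (roots B H)"
proof -
  have "roots B H \<subseteq> wt ` F"
  proof
    fix \<beta> assume b: "\<beta> \<in> roots B H"
    moreover have "0 \<in> root_space B H \<beta>" by (simp add: root_space_def)
    ultimately obtain x where x: "x \<in> wspace H \<beta>" "x \<noteq> 0" unfolding roots_def wspace_root_space by blast
    then obtain f where f: "f \<in> F" "act f x \<noteq> 0" using component_sum[of x] by (metis (no_types, lifting) sum.neutral)
    have "\<beta> = wt f"
    proof
      fix h show "\<beta> h = wt f h"
        using component_wt[OF x(1) f] wt_outside[OF f(1)] b by (cases "h \<in> H") (auto simp: roots_def)
    qed
    then show "\<beta> \<in> wt ` F" using f by blast
  qed
  then show ?thesis using F_fin finite_surj by blast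
qed

section \<open>Spanning by coroots and root vectors\<close>

lemma orthogonal_complement_span:
  assumes T: "vec.subspace T" "T \<subseteq> H" and orth: "\<And>h. h \<in> H \<Longrightarrow> (\<And>t. t \<in> T \<Longrightarrow> K h t = 0) \<Longrightarrow> h = 0"
  shows "T = H"
proof (rule ccontr)
  assume "T \<noteq> H"
  then obtain h0 where h0: "h0 \<in> H" "h0 \<notin> T" using T by blast
  obtain A where A: "A \<subseteq> T" "vec.independent A" "T \<subseteq> vec.span A" using vec.maximal_independent_subset by blast
  have sA: "vec.span A \<subseteq> T" using A T by (intro vec.span_minimal)
  have "vec.independent (insert h0 A)" using A h0 sA by (intro vec.independent_insertI) auto
  from vec.linear_independent_extend[OF this, of "\<lambda>x. if x = h0 then h0 else 0"]
  obtain g where g: "Vector_Spaces.linear (*s) (*s) g" "\<forall>x\<in>insert h0 A. g x = (if x = h0 then h0 else 0)" by blast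
  have gl: "clin g" using g(1) by (simp add: clin_def)
  have gT: "g t = 0" if "t \<in> T" for t
  proof -
    have "vec.subspace {t. g t = 0}"
      by (rule vec.subspaceI) (auto simp: clin_add[OF gl] clin_scale[OF gl] clin_0[OF gl])
    moreover have "A \<subseteq> {t. g t = 0}" using g(2) h0 A by auto
    ultimately have "vec.span A \<subseteq> {t. g t = 0}" by (intro vec.span_minimal)
    then show ?thesis using that A by blast
  qed
  have "h0 \<noteq> 0" using h0 T vec.subspace_0 by blast
  then obtain i where i: "h0 $ i \<noteq> 0" by (auto simp: vec_eq_iff)
  obtain d where d: "\<And>y. K d y = g y $ i"
    using K_represents[of "\<lambda>y. g y $ i"] by (auto simp: clin_add[OF gl] clin_scale[OF gl])
  \<comment> \<open>d represents a functional that vanishes on T but not at h0. Its zero weight part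
    d' lies in H and, by orthogonality, pairs with H as d does; so d' is orthogonal to T.\<close>
  define d' where "d' = (\<Sum>f\<in>{f\<in>F. \<forall>h\<in>H. wt f h = 0}. act f d)"
  have "act f d \<in> H" if "f \<in> F" "\<forall>h\<in>H. wt f h = 0" for f
    using ad_component_wspace[OF that(1), of d] wspace_cong[of H "wt f" "\<lambda>_. 0"] that(2) wspace_0 by auto
  then have d'H: "d' \<in> H" unfolding d'_def by (intro vec.subspace_sum H_subspace) auto
  have dd': "K d h = K d' h" if h: "h \<in> H" for h
  proof -
    have "K h d = (\<Sum>f\<in>F. K h (act f d))" by (subst component_sum[of d]) (rule K_sum_right)
    also have "\<dots> = (\<Sum>f\<in>{f\<in>F. \<forall>h\<in>H. wt f h = 0}. K h (act f d))"
    proof (rule sum.mono_neutral_right[OF F_fin], blast, rule ballI)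
      fix f assume "f \<in> F - {f \<in> F. \<forall>h\<in>H. wt f h = 0}"
      then obtain k where "f \<in> F" "k \<in> H" "wt f k \<noteq> 0" by blast
      moreover have "h \<in> wspace H (\<lambda>_. 0)" using h wspace_0 by simp
      ultimately show "K h (act f d) = 0"
        by (intro K_orthogonal[of h "\<lambda>_. 0" _ "wt f" k] ad_component_wspace) simp_all
    qed
    also have "\<dots> = K h d'" unfolding d'_def by (rule K_sum_right[symmetric])
    finally show ?thesis using K_sym by metis
  qed
  have "K d' t = 0" if "t \<in> T" for t
    using dd'[of t] d[of t] gT[OF that] T that by auto
  then have "d' = 0" using orth[OF d'H] by blast
  then have "K d h0 = 0" using dd'[OF h0(1)] by simp
  then show False using d[of h0] g(2) i by simp
qed

lemma canonical_span:
  assumes cd: "canonical_data B H n al hc E"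
  shows "\<exists>zh zr. x = (\<Sum>i<n. zh i *s hc i) + (\<Sum>\<beta>\<in>roots B H. zr \<beta> *s E \<beta>)"
proof -
  let ?R = "roots B H"
  let ?S = "{x. \<exists>zh zr. x = (\<Sum>i<n. zh i *s hc i) + (\<Sum>\<beta>\<in>?R. zr \<beta> *s E \<beta>)}"
  have base: "is_base ?R H (al ` {..<n})" and co: "\<And>i. i < n \<Longrightarrow> is_coroot B H (al i) (hc i)"
    and Er: "\<And>\<beta>. \<beta> \<in> ?R \<Longrightarrow> E \<beta> \<in> root_space B H \<beta> \<and> E \<beta> \<noteq> 0"
    using cd by (auto simp: canonical_data_def)
  have alR: "al i \<in> ?R" if "i < n" for i using base that by (auto simp: is_base_def)
  have S: "vec.subspace ?S"
  proof (rule vec.subspaceI)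
    show "0 \<in> ?S" by (auto intro!: exI[of _ "\<lambda>_. 0"])
    fix a b assume "a \<in> ?S" "b \<in> ?S"
    then obtain zh zr wh wr where "a = (\<Sum>i<n. zh i *s hc i) + (\<Sum>\<beta>\<in>?R. zr \<beta> *s E \<beta>)"
       "b = (\<Sum>i<n. wh i *s hc i) + (\<Sum>\<beta>\<in>?R. wr \<beta> *s E \<beta>)" by blast
    then have "a + b = (\<Sum>i<n. (zh i + wh i) *s hc i) + (\<Sum>\<beta>\<in>?R. (zr \<beta> + wr \<beta>) *s E \<beta>)"
      by (simp add: vec.scale_left_distrib sum.distrib)
    then show "a + b \<in> ?S" by (intro CollectI exI)
  next
    fix c a assume "a \<in> ?S"
    then obtain zh zr where "a = (\<Sum>i<n. zh i *s hc i) + (\<Sum>\<beta>\<in>?R. zr \<beta> *s E \<beta>)" by blast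
    then have "c *s a = (\<Sum>i<n. (c * zh i) *s hc i) + (\<Sum>\<beta>\<in>?R. (c * zr \<beta>) *s E \<beta>)"
      by (simp add: vec.scale_right_distrib vec.scale_sum_right)
    then show "c *s a \<in> ?S" by (intro CollectI exI)
  qed
  have hcS: "hc i \<in> ?S" if "i < n" for i
  proof -
    have "(\<Sum>j<n. (if j = i then 1 else 0) *s hc j) = (\<Sum>j<n. if j = i then hc i else 0)"
      by (rule sum.cong) auto
    then have "hc i = (\<Sum>j<n. (if j = i then 1 else 0) *s hc j) + (\<Sum>\<beta>\<in>?R. 0 *s E \<beta>)"
      using that by simp
    then show ?thesis by (intro CollectI exI)
  qed
  have ES: "E \<beta> \<in> ?S" if "\<beta> \<in> ?R" for \<beta>
  proof -
    have "(\<Sum>\<gamma>\<in>?R. (if \<gamma> = \<beta> then 1 else 0) *s E \<gamma>) = (\<Sum>\<gamma>\<in>?R. if \<gamma> = \<beta> then E \<beta> else 0)"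
      by (rule sum.cong) auto
    then have "E \<beta> = (\<Sum>j<n. 0 *s hc j) + (\<Sum>\<gamma>\<in>?R. (if \<gamma> = \<beta> then 1 else 0) *s E \<gamma>)"
      using that finite_roots by simp
    then show ?thesis by (intro CollectI exI)
  qed
  \<comment> \<open>An h orthogonal to all coroots is killed by the simple roots, hence by all roots
    and all weights of \<open>ad\<close>, so h = 0.\<close>
  have spanH: "vec.span (hc ` {..<n}) = H"
  proof (rule orthogonal_complement_span)
    show "vec.span (hc ` {..<n}) \<subseteq> H"
      using co by (intro vec.span_minimal H_subspace) (auto simp: is_coroot_def)
    fix h assume h: "h \<in> H" and o: "\<And>t. t \<in> vec.span (hc ` {..<n}) \<Longrightarrow> K h t = 0"
    have al0: "al i h = 0" if i: "i < n" for i
    proof -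
      obtain c where "c \<noteq> 0" "\<forall>h\<in>H. K (hc i) h = c * al i h"
        using coroot_K[OF co[OF i] root_at_0[OF alR[OF i]]] by blast
      moreover have "K h (hc i) = 0" using i by (intro o vec.span_base) auto
      ultimately show ?thesis using h K_sym[of h] by auto
    qed
    show "h = 0"
    proof (rule weights_separate[OF h], rule ccontr)
      fix f assume f: "f \<in> F" and nz: "wt f h \<noteq> 0"
      then have "wt f \<in> ?R" using wt_root[OF f h] by blast
      then obtain k :: "_ \<Rightarrow> int" where "\<forall>h\<in>H. wt f h = (\<Sum>\<alpha>\<in>al ` {..<n}. of_int (k \<alpha>) * \<alpha> h)"
        using base unfolding is_base_def by blast
      then have "wt f h = (\<Sum>\<alpha>\<in>al ` {..<n}. of_int (k \<alpha>) * \<alpha> h)" using h by blast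
      also have "\<dots> = 0" using al0 by (intro sum.neutral) auto
      finally show False using nz by simp
    qed
  qed simp
  have "vec.span (hc ` {..<n}) \<subseteq> ?S" by (rule vec.span_minimal[OF _ S]) (use hcS in blast)
  then have HS: "H \<subseteq> ?S" unfolding spanH .
  have "act f x \<in> ?S" if f: "f \<in> F" for f
  proof (cases "\<exists>h\<in>H. wt f h \<noteq> 0")
    case True
    then obtain h where h: "h \<in> H" "wt f h \<noteq> 0" by blast
    then have R: "wt f \<in> ?R" using wt_root[OF f] by blast
    from Er[OF R] obtain c where "act f x = c *s E (wt f)"
      using root_space_one_dimensional[of h "wt f" "E (wt f)" "act f x", OF h] ad_component_wspace[OF f, of x]
      by (auto simp: wspace_root_space)
    then show ?thesis using ES[OF R] vec.subspace_scale[OF S] by simp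
  next
    case False
    then have "act f x \<in> H" using ad_component_wspace[OF f, of x] wspace_cong[of H "wt f" "\<lambda>_. 0"] wspace_0 by auto
    then show ?thesis using HS by blast
  qed
  then have "(\<Sum>f\<in>F. act f x) \<in> ?S" by (intro vec.subspace_sum S)
  then show ?thesis using component_sum[of x] by simp
qed

end

subsection \<open>Traces of words\<close>

primrec word :: "('a \<Rightarrow> 'k::finite cmat) \<Rightarrow> 'a list \<Rightarrow> 'k cmat" where
  "word \<rho> [] = 1"
| "word \<rho> (x # xs) = \<rho> x * word \<rho> xs"

lemma word_append: "word \<rho> (xs @ ys) = word \<rho> xs * word \<rho> ys"
  by (induction xs) (auto simp: mult.assoc)

lemma word_replicate: "word \<rho> (replicate n x) = \<rho> x ^ n"
  by (induction n) auto

text \<open>The coefficient of t collects the words with exactly one y replaced by z. The induction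
  moves the first letter into \<open>pre\<close>, which is therefore arbitrary.\<close>

lemma multilinear_poly:
  fixes F :: "(complex^'d) list \<Rightarrow> complex"
  assumes lin: "\<And>u x c y v. F (u @ (x + c *s y) # v) = F (u @ x # v) + c * F (u @ y # v)"
  shows "\<exists>p. (\<forall>t. F (pre @ replicate m (y + t *s z) @ zs) = poly p t) \<and>
    coeff p 0 = F (pre @ replicate m y @ zs) \<and>
    coeff p 1 = (\<Sum>i<m. F (pre @ replicate i y @ z # replicate (m - 1 - i) y @ zs))"
proof (induction m arbitrary: pre)
  case 0
  show ?case by (rule exI[of _ "[:F (pre @ zs):]"]) simp
next
  case (Suc m)
  obtain p where p: "\<And>t. F ((pre @ [y]) @ replicate m (y + t *s z) @ zs) = poly p t"
    "coeff p 0 = F ((pre @ [y]) @ replicate m y @ zs)"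
    "coeff p 1 = (\<Sum>i<m. F ((pre @ [y]) @ replicate i y @ z # replicate (m - 1 - i) y @ zs))"
    using Suc[of "pre @ [y]"] by blast
  obtain q where q: "\<And>t. F ((pre @ [z]) @ replicate m (y + t *s z) @ zs) = poly q t"
    "coeff q 0 = F ((pre @ [z]) @ replicate m y @ zs)"
    using Suc[of "pre @ [z]"] by blast
  show ?case
  proof (intro exI conjI allI)
    show "F (pre @ replicate (Suc m) (y + t *s z) @ zs) = poly (p + pCons 0 q) t" for t
      using p(1)[of t] q(1)[of t] lin[of pre y t z "replicate m (y + t *s z) @ zs"] by simp
    show "coeff (p + pCons 0 q) 0 = F (pre @ replicate (Suc m) y @ zs)" using p(2) by simp
    show "coeff (p + pCons 0 q) 1 = (\<Sum>i<Suc m. F (pre @ replicate i y @ z # replicate (Suc m - 1 - i) y @ zs))"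
      unfolding sum.lessThan_Suc_shift using p(3) q(2) by simp
  qed
qed

text \<open>Words are symmetric modulo shorter words, so by polarization the traces of powers
  determine the traces of all words.\<close>

lemma word_traces_eq:
  fixes \<phi> \<psi> :: "complex^'d \<Rightarrow> 'k::finite cmat"
  assumes rp: "rep B \<phi>" and rq: "rep B \<psi>" and pw: "\<And>x n. tr (\<phi> x ^ n) = tr (\<psi> x ^ n)"
  shows "tr (word \<phi> w) = tr (word \<psi> w)"
proof -
  define F where "F = (\<lambda>w. tr (word \<phi> w) - tr (word \<psi> w))"
  have lin: "F (u @ (x + c *s y) # v) = F (u @ x # v) + c * F (u @ y # v)" for u x c y v
    by (simp add: F_def word_append rep_add[OF rp] rep_add[OF rq] rep_scale[OF rp] rep_scale[OF rq]
        distrib_left distrib_right tr_add mult.assoc cs_left_commute tr_cs algebra_simps)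
  have swap: "F (u @ x # y # v) = F (u @ y # x # v) + F (u @ B x y # v)" for u x y v
    by (simp add: F_def word_append rep_bracket[OF rp] rep_bracket[OF rq] left_diff_distrib right_diff_distrib tr_diff mult.assoc)
  have "F w = 0" for w
  proof (induction "length w" arbitrary: w rule: less_induct)
    case less
    \<comment> \<open>Exchanging z with a neighbouring y changes F by its value at a shorter word,
      which is 0.\<close>
    have mv: "F (u @ replicate i y @ z # replicate k y @ zs) = F (u @ replicate (i + k) y @ z # zs)"
      if "length u + i + k + length zs < length w" for u i k y z zs
      using that
    proof (induction k arbitrary: i)
      case (Suc k)
      have "F (u @ replicate i y @ z # replicate (Suc k) y @ zs) = F ((u @ replicate i y) @ z # y # replicate k y @ zs)" by simp
      also have "\<dots> = F ((u @ replicate i y) @ y # z # replicate k y @ zs) + F ((u @ replicate i y) @ B z y # replicate k y @ zs)"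
        by (rule swap)
      also have "F ((u @ replicate i y) @ B z y # replicate k y @ zs) = 0"
        using Suc.prems by (intro less) simp
      also have "(u @ replicate i y) @ y # z # replicate k y @ zs = u @ replicate (Suc i) y @ z # replicate k y @ zs"
        by (simp add: replicate_app_Cons_same)
      also have "F \<dots> = F (u @ replicate (Suc i + k) y @ z # zs)" using Suc.prems by (intro Suc.IH) simp
      finally show ?case by simp
    qed simp
    \<comment> \<open>The induction turns zs, letter by letter, into repetitions of one leading
      letter, until only a power is left.\<close>
    have "F (replicate m y @ zs) = 0" if "m + length zs = length w" for m y zs
      using that
    proof (induction zs arbitrary: m y)
      case Nil
      then show ?case using pw by (simp add: F_def word_replicate)
    next
      case (Cons z zs)
      \<comment> \<open>F vanishes with y + t z repeated m + 1 times before zs, for every t. The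
        linear coefficient sums m + 1 values, all equal to that of y^m z zs, so that value is
        0.\<close>
      obtain p where p: "\<And>t. F ([] @ replicate (Suc m) (y + t *s z) @ zs) = poly p t"
        "coeff p 1 = (\<Sum>i<Suc m. F ([] @ replicate i y @ z # replicate (Suc m - 1 - i) y @ zs))"
        using multilinear_poly[OF lin, of "[]" "Suc m" y z zs] by blast
      have "poly p t = 0" for t
        using p(1)[of t] Cons.IH[of "Suc m"] Cons.prems by simp
      then have "p = 0" using poly_all_0_iff_0 by blast
      then have "0 = (\<Sum>i<Suc m. F ([] @ replicate i y @ z # replicate (Suc m - 1 - i) y @ zs))" using p(2) by simp
      also have "\<dots> = (\<Sum>i<Suc m. F ([] @ replicate m y @ z # zs))"
      proof (rule sum.cong[OF refl])
        fix i assume "i \<in> {..<Suc m}"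
        then show "F ([] @ replicate i y @ z # replicate (Suc m - 1 - i) y @ zs) = F ([] @ replicate m y @ z # zs)"
          using mv[of "[]" i "Suc m - 1 - i" zs y z] Cons.prems by simp
      qed
      also have "\<dots> = of_nat (Suc m) * F (replicate m y @ z # zs)" by simp
      finally show ?case by (metis mult_eq_0_iff nat.distinct(1) of_nat_eq_0_iff)
    qed
    from this[of 0 w] show ?case by simp
  qed
  then show ?thesis by (simp add: F_def)
qed

lemma ev_traces_eq:
  assumes words: "\<And>w. tr (P * word \<rho> w) = tr (Q * word \<sigma> w)"
  shows "tr (P * ev \<rho> u) = tr (Q * ev \<sigma> u)"
proof -
  \<comment> \<open>The word on the left and the factors X, Y on the right carry the context. For a
    product, the result for the right factor becomes the hypothesis for the left one.\<close>
  have "(\<And>w. tr (P * word \<rho> w * X) = tr (Q * word \<sigma> w * Y)) \<Longrightarrow>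
      tr (P * word \<rho> w * (ev \<rho> u * X)) = tr (Q * word \<sigma> w * (ev \<sigma> u * Y))" for w X Y
  proof (induction u arbitrary: w X Y)
    case (Gen x)
    show ?case using Gen[of "w @ [x]"] by (simp add: word_append mult.assoc)
  next
    case (Con c)
    show ?case using Con[of w] by (simp add: cs_left_commute tr_cs)
  next
    case (Plus u v)
    show ?case using Plus.IH(1)[OF Plus.prems, of w] Plus.IH(2)[OF Plus.prems, of w]
      by (simp add: distrib_left distrib_right tr_add)
  next
    case (Times u v)
    have "tr (P * word \<rho> w * (ev \<rho> u * (ev \<rho> v * X))) = tr (Q * word \<sigma> w * (ev \<sigma> u * (ev \<sigma> v * Y)))"
      by (rule Times.IH(1)) (rule Times.IH(2)[OF Times.prems])
    then show ?case by (simp add: mult.assoc)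
  qed
  from this[of 1 1 "[]"] words show ?thesis by simp
qed

subsection \<open>Intertwiners\<close>

text \<open>The action on linear maps, vectorized by \<open>vecm\<close>.\<close>

definition hom_rep :: "('a \<Rightarrow> 'k::finite cmat) \<Rightarrow> ('a \<Rightarrow> 'k cmat) \<Rightarrow> 'a \<Rightarrow> ('k \<times> 'k) cmat" where
  "hom_rep \<psi> \<phi> x = kron (\<psi> x) 1 - kron 1 (\<phi> x)"

lemma hom_rep_act: "act (hom_rep \<psi> \<phi> x) (vecm Z) = vecm (\<psi> x * Z - Z * \<phi> x)"
  by (simp add: hom_rep_def act_diff kron_vecm vecm_diff)

lemma hom_rep_act_0: "act (hom_rep \<psi> \<phi> x) (vecm Z) = 0 \<longleftrightarrow> \<psi> x * Z = Z * \<phi> x"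
  unfolding hom_rep_act by (metis eq_iff_diff_eq_0 vecm_0 vecm_inj)

lemma rep_hom_rep:
  assumes "rep B \<phi>" "rep B \<psi>"
  shows "rep B (hom_rep \<psi> \<phi>)"
  unfolding rep_def
proof (intro conjI allI)
  fix x y c
  show "hom_rep \<psi> \<phi> (x + y) = hom_rep \<psi> \<phi> x + hom_rep \<psi> \<phi> y"
    by (simp add: hom_rep_def rep_add[OF assms(1)] rep_add[OF assms(2)] kron_add1 kron_add2)
  show "hom_rep \<psi> \<phi> (c *s x) = cs c * hom_rep \<psi> \<phi> x"
    by (simp add: hom_rep_def rep_scale[OF assms(1)] rep_scale[OF assms(2)] kron_cs1 kron_cs2 right_diff_distrib)
  show "hom_rep \<psi> \<phi> (B x y) = hom_rep \<psi> \<phi> x * hom_rep \<psi> \<phi> y - hom_rep \<psi> \<phi> y * hom_rep \<psi> \<phi> x"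
    by (simp add: hom_rep_def rep_bracket[OF assms(1)] rep_bracket[OF assms(2)] left_diff_distrib right_diff_distrib
        kron_mult kron_diff1 kron_diff2)
qed

context simple_cartan
begin

text \<open>u makes an arbitrary generalized inverse Y0 equivariant. As Z -> T Z T commutes with the
  actions, T (u Y0) T = u (T Y0 T) = u T, which is T because T is invariant and u has constant term
  1.\<close>

lemma equivariant_regular:
  fixes \<phi> \<psi> :: "complex^'d \<Rightarrow> 'k::finite cmat"
  assumes rp: "rep B \<phi>" and rq: "rep B \<psi>" and T: "\<And>x. \<psi> x * T = T * \<phi> x"
  shows "\<exists>Y. (\<forall>x. \<phi> x * Y = Y * \<psi> x) \<and> T * Y * T = T"
proof -
  obtain Y0 where Y0: "T * Y0 * T = T" by (rule von_neumann_regular)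
  obtain u where u: "aug u = 1" "\<And>x. hom_rep \<phi> \<psi> x * ev (hom_rep \<phi> \<psi>) u = 0"
    using reynolds[OF rep_hom_rep[OF rq rp]] by blast
  obtain Y where Y: "act (ev (hom_rep \<phi> \<psi>) u) (vecm Y0) = vecm Y" using vecm_surj by blast
  have "act (hom_rep \<phi> \<psi> x) (vecm Y) = 0" for x using u(2) by (simp flip: Y act_mult)
  then have 1: "\<phi> x * Y = Y * \<psi> x" for x by (simp add: hom_rep_act_0)
  have it: "hom_rep \<psi> \<phi> x * kron T T = kron T T * hom_rep \<phi> \<psi> x" for x
    by (simp add: hom_rep_def left_diff_distrib right_diff_distrib kron_mult T)
  have "vecm (T * Y * T) = act (kron T T) (act (ev (hom_rep \<phi> \<psi>) u) (vecm Y0))"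
    by (simp add: Y kron_vecm)
  also have "\<dots> = act (ev (hom_rep \<psi> \<phi>) u) (vecm (T * Y0 * T))"
    by (simp add: ev_intertwine[OF it, symmetric] kron_vecm flip: act_mult) (simp add: act_mult kron_vecm)
  also have "\<dots> = vecm T"
    unfolding Y0 using ev_fixed_vector[of "hom_rep \<psi> \<phi>" "vecm T" u] u(1) by (simp add: hom_rep_act_0 T)
  finally show ?thesis using 1 by (auto simp: vecm_inj)
qed

text \<open>Otherwise an element \<open>u\<close> as in \<open>reynolds\<close> kills \<open>q Hom(\<phi>, \<psi>) p\<close>, so all its powers have
  trace zero there, hence also on \<open>p Hom(\<phi>, \<phi>) p\<close>; but it fixes the invariant \<open>p\<close>.\<close>

lemma intertwiner_exists:
  fixes \<phi> \<psi> :: "complex^'d \<Rightarrow> 'k::finite cmat"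
  assumes rp: "rep B \<phi>" and rq: "rep B \<psi>"
    and p: "p * p = p" "p \<noteq> 0" "\<And>x. \<phi> x * p = p * \<phi> x"
    and q: "q * q = q" "\<And>x. \<psi> x * q = q * \<psi> x"
    and words: "\<And>w. tr (p * word \<phi> w) = tr (q * word \<psi> w)"
  shows "\<exists>S. S \<noteq> 0 \<and> q * S * p = S \<and> (\<forall>x. \<psi> x * S = S * \<phi> x)"
proof (rule ccontr)
  assume none: "\<not> ?thesis"
  define \<rho> where "\<rho> = hom_rep \<phi> \<phi>"
  define \<sigma> where "\<sigma> = hom_rep \<psi> \<phi>"
  define P where "P = kron p p"
  define Q where "Q = kron q p"
  obtain u where u: "aug u = 1" "\<And>x. \<sigma> x * ev \<sigma> u = 0"
    unfolding \<sigma>_def using reynolds[OF rep_hom_rep[OF rp rq]] by blast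
  have Qu: "Q * ev \<sigma> u = 0"
  proof (rule cmat_ext)
    fix v
    obtain Z where Z: "act (ev \<sigma> u) v = vecm Z" using vecm_surj by blast
    have "act (\<sigma> x) (vecm Z) = 0" for x using u(2) by (simp flip: Z act_mult)
    then have inv: "\<psi> x * Z = Z * \<phi> x" for x by (simp add: \<sigma>_def hom_rep_act_0)
    have "\<psi> x * (q * Z * p) = (q * Z * p) * \<phi> x" for x
    proof -
      have "\<psi> x * (q * Z * p) = q * (\<psi> x * Z) * p" using q(2)[of x] by (simp flip: mult.assoc)
      also have "\<dots> = q * Z * (\<phi> x * p)" by (simp add: inv mult.assoc)
      finally show ?thesis by (simp add: p(3) mult.assoc)
    qed
    moreover have "q * (q * Z * p) * p = q * Z * p"
    proof -
      have "q * (q * Z * p) * p = (q * q) * Z * (p * p)" by (simp only: mult.assoc)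
      then show ?thesis by (simp add: p(1) q(1))
    qed
    ultimately have "q * Z * p = 0" using none by blast
    then show "act (Q * ev \<sigma> u) v = act 0 v" by (simp add: act_mult Z Q_def kron_vecm vecm_0)
  qed
  \<comment> \<open>Each letter in the Hom representation multiplies on one side, so words s and t
    collect on the left and on the right. At the end the trace factors: the t factor is common, and
    the s factors agree by \<open>words\<close>.\<close>
  have "tr (P * kron (word \<phi> s) (word \<phi> t) * word \<rho> w) = tr (Q * kron (word \<psi> s) (word \<phi> t) * word \<sigma> w)" for s t w
  proof (induction w arbitrary: s t)
    case Nil
    show ?case by (simp add: P_def Q_def kron_mult tr_kron words)
  next
    case (Cons x w)
    have "kron (word \<phi> s) (word \<phi> t) * \<rho> x = kron (word \<phi> (s @ [x])) (word \<phi> t) - kron (word \<phi> s) (word \<phi> (x # t))"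
      by (simp add: \<rho>_def hom_rep_def right_diff_distrib kron_mult word_append)
    moreover have "kron (word \<psi> s) (word \<phi> t) * \<sigma> x = kron (word \<psi> (s @ [x])) (word \<phi> t) - kron (word \<psi> s) (word \<phi> (x # t))"
      by (simp add: \<sigma>_def hom_rep_def right_diff_distrib kron_mult word_append)
    moreover have "P * K * word \<rho> (x # w) = P * (K * \<rho> x) * word \<rho> w" "Q * K * word \<sigma> (x # w) = Q * (K * \<sigma> x) * word \<sigma> w" for K
      by (simp_all add: mult.assoc)
    ultimately show ?case using Cons[of "s @ [x]" t] Cons[of s "x # t"]
      by (simp only: right_diff_distrib left_diff_distrib tr_diff)
  qed
  from this[of "[]" "[]"] have ww: "tr (P * word \<rho> w) = tr (Q * word \<sigma> w)" for w
    by (simp add: kron_1)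
  have Pc: "\<rho> x * P = P * \<rho> x" for x
    by (simp add: \<rho>_def P_def hom_rep_def left_diff_distrib right_diff_distrib kron_mult p(3))
  have PP: "P * P = P" by (simp add: P_def kron_mult p(1))
  define X where "X = P * ev \<rho> u"
  \<comment> \<open>P commutes with the action, so every positive power keeps u next to P; the
    matching product on the other side then contains Q u = 0.\<close>
  have Xpow: "\<exists>v. X ^ Suc k = P * ev \<rho> (Times u v)" for k
  proof (induction k)
    case 0
    show ?case by (rule exI[of _ "Con 1"]) (simp add: X_def)
  next
    case (Suc k)
    then obtain v where v: "X ^ Suc k = P * ev \<rho> (Times u v)" by blast
    have "X ^ Suc (Suc k) = P * (ev \<rho> u * P) * ev \<rho> (Times u v)"
      by (simp only: power_Suc[of X "Suc k"] v) (simp add: X_def mult.assoc)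
    also have "\<dots> = (P * P) * ev \<rho> (Times u (Times u v))"
      by (simp add: ev_commute[OF Pc] mult.assoc)
    finally show ?case unfolding PP by blast
  qed
  have "tr (X ^ Suc k) = 0" for k
  proof -
    obtain v where v: "X ^ Suc k = P * ev \<rho> (Times u v)" using Xpow by blast
    have "Q * ev \<sigma> (Times u v) = 0" using Qu by (simp flip: mult.assoc)
    then show ?thesis unfolding v ev_traces_eq[OF ww] by simp
  qed
  then obtain N where N: "X ^ N = 0" using nilpotent_if_power_traces_0 by blast
  have "act (ev \<rho> u) (vecm p) = vecm p"
    using ev_fixed_vector[of \<rho> "vecm p" u] u(1) by (simp add: \<rho>_def hom_rep_act_0 p(3))
  then have "act X (vecm p) = vecm p" by (simp add: X_def act_mult P_def kron_vecm p(1))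
  then have "act (X ^ n) (vecm p) = vecm p" for n by (induction n) (auto simp: act_mult)
  from this[of N] have "vecm p = 0" by (simp add: N)
  then show False using p(2) by (metis vecm_0 vecm_inj)
qed

lemma isomorphic_if_word_traces_eq:
  fixes \<phi> \<psi> :: "complex^'d \<Rightarrow> 'k::finite cmat"
  assumes rp: "rep B \<phi>" and rq: "rep B \<psi>" and words: "\<And>w. tr (word \<phi> w) = tr (word \<psi> w)"
  shows "\<exists>T Y. (\<forall>x. \<psi> x * T = T * \<phi> x) \<and> T * Y = 1 \<and> Y * T = 1"
proof -
  let ?ker = "\<lambda>T::'k cmat. {v. act T v = 0}"
  have kersub: "vec.subspace (?ker T)" for T
    by (rule vec.subspaceI) (auto simp: act_vadd act_scale)
  let ?I = "\<lambda>T. \<forall>x. \<psi> x * T = T * \<phi> x"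
  have "?I 0" by simp
  then obtain T where TT: "?I T \<and> (\<forall>T'. ?I T' \<longrightarrow> vec.dim (?ker T) \<le> vec.dim (?ker T'))"
    using ex_has_least_nat[of ?I 0 "\<lambda>T. vec.dim (?ker T)"] by blast
  then have T: "\<And>x. \<psi> x * T = T * \<phi> x" by blast
  obtain Y where Y: "\<And>x. \<phi> x * Y = Y * \<psi> x" "T * Y * T = T"
    using equivariant_regular[OF rp rq T] by blast
  define p where "p = 1 - Y * T"
  define q where "q = 1 - T * Y"
  have "Y * T * (Y * T) = Y * (T * Y * T)" by (simp only: mult.assoc)
  then have YTYT: "Y * T * (Y * T) = Y * T" by (simp only: Y(2))
  have TYTY: "T * Y * (T * Y) = T * Y" using Y(2) by (simp flip: mult.assoc)
  have pp: "p * p = p" by (simp add: p_def left_diff_distrib right_diff_distrib YTYT)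
  have qq: "q * q = q" by (simp add: q_def left_diff_distrib right_diff_distrib TYTY)
  have "\<phi> x * (Y * T) = (Y * T) * \<phi> x" for x
  proof -
    have "\<phi> x * (Y * T) = Y * (\<psi> x * T)" using Y(1)[of x] by (simp flip: mult.assoc)
    then show ?thesis by (simp add: T mult.assoc)
  qed
  then have pc: "\<phi> x * p = p * \<phi> x" for x by (simp add: p_def algebra_simps)
  have "\<psi> x * (T * Y) = (T * Y) * \<psi> x" for x
  proof -
    have "\<psi> x * (T * Y) = T * (\<phi> x * Y)" using T[of x] by (simp flip: mult.assoc)
    then show ?thesis by (simp add: Y(1) mult.assoc)
  qed
  then have qc: "\<psi> x * q = q * \<psi> x" for x by (simp add: q_def algebra_simps)
  have wT: "word \<psi> w * T = T * word \<phi> w" for w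
  proof (induction w)
    case (Cons x w)
    have "word \<psi> (x # w) * T = \<psi> x * T * word \<phi> w" using Cons by (simp add: mult.assoc)
    then show ?case by (simp add: T mult.assoc)
  qed simp
  \<comment> \<open>By cyclicity the traces cut out by Y T and T Y agree, hence so do those of the
    complements p and q.\<close>
  have "tr (p * word \<phi> w) = tr (q * word \<psi> w)" for w
  proof -
    have "tr (Y * T * word \<phi> w) = tr (Y * word \<psi> w * T)" by (simp add: wT mult.assoc)
    also have "\<dots> = tr (T * Y * word \<psi> w)" using tr_comm[of T "Y * word \<psi> w"] by (simp add: mult.assoc)
    finally show ?thesis using words by (simp add: p_def q_def left_diff_distrib tr_diff)
  qed
  note ex = intertwiner_exists[OF rp rq pp _ pc qq qc this]
  have "p = 0"
  proof (rule ccontr)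
    assume "p \<noteq> 0"
    from ex[OF this] obtain S where S: "S \<noteq> 0" "q * S * p = S" "\<forall>x. \<psi> x * S = S * \<phi> x" by blast
    have "?I (T + S)" using T S(3) by (simp add: distrib_left distrib_right)
    then have le: "vec.dim (?ker T) \<le> vec.dim (?ker (T + S))" using TT by blast
    have qT: "q * T = 0" by (simp add: q_def left_diff_distrib Y(2))
    have qS: "q * S = S" using S(2) qq by (metis mult.assoc)
    have Tp: "T * p = 0" using Y(2) by (simp add: p_def right_diff_distrib flip: mult.assoc)
    have Sp: "S * p = S" using S(2) pp by (metis mult.assoc)
    \<comment> \<open>q annihilates T and fixes S, so T + S vanishes at v only if both do. The
      inclusion in the kernel of T is strict because T p = 0, while S p = S is nonzero.\<close>
    have k: "?ker (T + S) = ?ker T \<inter> ?ker S"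
    proof (intro equalityI subsetI)
      fix v assume "v \<in> ?ker (T + S)"
      then have 0: "act (T + S) v = 0" by simp
      then have "act (q * (T + S)) v = 0" by (simp add: act_mult)
      then have "act S v = 0" by (simp add: distrib_left qT qS)
      then show "v \<in> ?ker T \<inter> ?ker S" using 0 by (simp add: act_add)
    qed (simp add: act_add)
    obtain v where v: "act S v \<noteq> 0" using S(1) by (metis act_0 cmat_ext)
    have "act T (act p v) = 0" "act S (act p v) \<noteq> 0" using v Tp Sp by (simp_all flip: act_mult)
    then have "?ker (T + S) \<subset> ?ker T" unfolding k by blast
    then have "vec.dim (?ker (T + S)) < vec.dim (?ker T)"
      by (intro vec.dim_psubset) (simp add: vec.span_eq_iff[THEN iffD2, OF kersub])
    then show False using le by simp
  qed
  then have YT: "Y * T = 1" by (simp add: p_def)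
  \<comment> \<open>T Y is an idempotent with the trace of Y T = 1, so its complement q has rank
    0.\<close>
  have "tr q = 0" using YT tr_comm[of T Y] by (simp add: q_def tr_diff)
  then have "q = 0" using tr_idempotent_nat[OF qq] by fastforce
  then have "T * Y = 1" by (simp add: q_def)
  then show ?thesis using T YT by blast
qed

end

section \<open>From characteristic polynomials to the module isomorphism\<close>

lemma rep_Cm:
  assumes "is_rep B \<phi>"
  shows "rep B (\<lambda>x. Cm (\<phi> x))"
  using assms unfolding is_rep_def rep_def
  by (auto simp: mat_of_inject[symmetric] Cm_inverse plus_cmat.rep_eq times_cmat.rep_eq minus_cmat.rep_eq cs.rep_eq smat_mat)

lemma is_rep_0:
  assumes "is_rep B \<phi>"
  shows "\<phi> 0 = 0"
proof -
  have "\<phi> (0 *s 0) = smat 0 (\<phi> 0)" using assms unfolding is_rep_def by blast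
  then show ?thesis by (simp add: smat_def vec_eq_iff)
qed

lemma is_rep_sum:
  assumes "is_rep B \<phi>"
  shows "\<phi> (\<Sum>i\<in>I. c i *s v i) = (\<Sum>i\<in>I. smat (c i) (\<phi> (v i)))"
proof (induction I rule: infinite_finite_induct)
  case (insert i I)
  then show ?case using assms unfolding is_rep_def by simp
qed (simp_all add: is_rep_0[OF assms])

lemma char_fun_cdet:
  assumes "is_rep B \<phi>"
  shows "char_fun B H n hc E \<phi> z0 zh zr
    = cdet (cs z0 + Cm (\<phi> ((\<Sum>i<n. zh i *s hc i) + (\<Sum>\<beta>\<in>roots B H. zr \<beta> *s E \<beta>))))"
proof -
  have "\<phi> ((\<Sum>i<n. zh i *s hc i) + (\<Sum>\<beta>\<in>roots B H. zr \<beta> *s E \<beta>))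
      = (\<Sum>i<n. smat (zh i) (\<phi> (hc i))) + (\<Sum>\<beta>\<in>roots B H. smat (zr \<beta>) (\<phi> (E \<beta>)))"
  proof -
    have add: "\<phi> (a + b) = \<phi> a + \<phi> b" for a b using assms by (simp add: is_rep_def)
    show ?thesis by (simp add: add is_rep_sum[OF assms])
  qed
  then show ?thesis by (simp add: char_fun_def cdet.rep_eq plus_cmat.rep_eq cs.rep_eq Cm_inverse add.assoc)
qed

theorem theorem3p3:
  fixes B :: "complex^'d \<Rightarrow> complex^'d \<Rightarrow> complex^'d"
    and H :: "(complex^'d) set" and n :: nat
    and al :: "nat \<Rightarrow> complex^'d \<Rightarrow> complex" and hc :: "nat \<Rightarrow> complex^'d"
    and E :: "(complex^'d \<Rightarrow> complex) \<Rightarrow> complex^'d"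
    and \<phi> :: "complex^'d \<Rightarrow> complex^'v^'v" and \<psi> :: "complex^'d \<Rightarrow> complex^'w^'w"
  assumes "simple_lie B"
    and "canonical_data B H n al hc E"
    and "is_rep B \<phi>" and "is_rep B \<psi>"
    and "\<forall>z0 zh zr. char_fun B H n hc E \<phi> z0 zh zr = char_fun B H n hc E \<psi> z0 zh zr"
  shows "\<exists>T :: complex^'v \<Rightarrow> complex^'w. clin T \<and> bij T \<and> (\<forall>x v. T (\<phi> x *v v) = \<psi> x *v T v)"
proof -
  interpret simple_cartan B H
    using assms(1,2)
    by unfold_locales (auto simp: simple_lie_def canonical_data_def cartan_subalgebra_def)
  obtain F wt where "weights B H (ad B) F wt" using weights_exist[OF rep_ad] by blast
  then interpret A: adj_weights B H F wt by (rule adj_weights.intro)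
  interpret R: root_setup B H F wt ..
  note rp = rep_Cm[OF assms(3)]
  have ch: "cdet (cs z + Cm (\<phi> x)) = cdet (cs z + Cm (\<psi> x))" for z x
  proof -
    obtain zh zr where x: "x = (\<Sum>i<n. zh i *s hc i) + (\<Sum>\<beta>\<in>roots B H. zr \<beta> *s E \<beta>)"
      using R.canonical_span[OF assms(2)] by blast
    show ?thesis unfolding x char_fun_cdet[OF assms(3), symmetric] char_fun_cdet[OF assms(4), symmetric]
      using assms(5) by blast
  qed
  \<comment> \<open>At x = 0 and z = 2 both determinants are powers of 2, whose exponents are the
    dimensions.\<close>
  have "(2::complex) ^ CARD('v) = 2 ^ CARD('w)"
    using ch[of 2 0] by (simp add: is_rep_0[OF assms(3)] is_rep_0[OF assms(4)] cdet_cs flip: zero_cmat_def)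
  then have "(of_nat (2 ^ CARD('v)) :: complex) = of_nat (2 ^ CARD('w))" by simp
  then have card: "CARD('v) = CARD('w)" by (simp only: of_nat_eq_iff) simp
  then obtain b :: "'v \<Rightarrow> 'w" where b: "bij b"
    using finite_same_card_bij[of "UNIV :: 'v set" "UNIV :: 'w set"] by auto
  \<comment> \<open>Reindexing along b is a ring isomorphism that respects scalars and traces. It
    moves \<psi> to the index type of \<phi>, where \<open>isomorphic_if_word_traces_eq\<close>
    applies.\<close>
  define tc :: "'w cmat \<Rightarrow> 'v cmat" where "tc X = Cm (\<chi> i j. mat_of X $ b i $ b j)" for X
  have re: "(\<Sum>i\<in>UNIV. f (b i)) = (\<Sum>j\<in>UNIV. f j)" for f :: "'w \<Rightarrow> complex"
    using sum.reindex_bij_betw[OF b] .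
  have tc_mult: "tc (X * Y) = tc X * tc Y" for X Y
    by (simp add: tc_def mat_of_inject[symmetric] Cm_inverse times_cmat.rep_eq matrix_matrix_mult_def vec_eq_iff re[symmetric])
  have tc_1: "tc 1 = 1"
    using b by (simp add: tc_def mat_of_inject[symmetric] Cm_inverse one_cmat.rep_eq mat_def vec_eq_iff bij_def inj_eq)
  have tc_add: "tc (X + Y) = tc X + tc Y" "tc (X - Y) = tc X - tc Y" for X Y
    by (simp_all add: tc_def mat_of_inject[symmetric] Cm_inverse plus_cmat.rep_eq minus_cmat.rep_eq vec_eq_iff)
  have tc_cs: "tc (cs c) = cs c" for c
    using b by (simp add: tc_def mat_of_inject[symmetric] Cm_inverse cs.rep_eq mat_def vec_eq_iff bij_def inj_eq)
  have tc_tr: "tr (tc X) = tr X" for X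
    by (simp add: tc_def tr.rep_eq Cm_inverse trace_def re[of "\<lambda>i. mat_of X $ i $ i"])
  have tc_pow: "tc (X ^ k) = tc X ^ k" for X k
    by (induction k) (simp_all add: tc_1 tc_mult)
  define \<sigma> where "\<sigma> x = tc (Cm (\<psi> x))" for x
  have rq: "rep B \<sigma>"
    using rep_Cm[OF assms(4)] unfolding rep_def \<sigma>_def by (simp add: tc_add tc_mult tc_cs)
  have "tr (Cm (\<phi> x) ^ k) = tr (\<sigma> x ^ k)" for x k
    using charpoly_eq_imp_power_traces_eq[OF ch card, of x k] by (simp add: \<sigma>_def tc_tr flip: tc_pow)
  then obtain T Y where T: "\<And>x. \<sigma> x * T = T * Cm (\<phi> x)" and TY: "T * Y = 1" "Y * T = 1"
    using isomorphic_if_word_traces_eq[OF rp rq word_traces_eq[OF rp rq]] by blast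
  define R where "R = (\<lambda>w :: complex^'w. \<chi> i. w $ b i)"
  define \<tau> where "\<tau> = (\<lambda>v. \<chi> j. act T v $ inv b j)"
  have R\<tau>: "R (\<tau> v) = act T v" for v
    using b by (simp add: R_def \<tau>_def vec_eq_iff bij_def)
  have Rinj: "w = w'" if "R w = R w'" for w w'
    using that bij_is_surj[OF b] by (simp add: R_def vec_eq_iff) (metis surjD)
  have R\<psi>: "R (\<psi> x *v w) = act (\<sigma> x) (R w)" for x w
    by (simp add: R_def \<sigma>_def tc_def act.rep_eq Cm_inverse matrix_vector_mult_def vec_eq_iff re[symmetric])
  have "clin \<tau>" by (rule clinI) (simp_all add: \<tau>_def vec_eq_iff act_vadd act_scale)
  moreover have "bij \<tau>"
  proof (rule o_bij[of "\<lambda>w. act Y (R w)"])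
    show "(\<lambda>w. act Y (R w)) \<circ> \<tau> = id" by (simp add: fun_eq_iff R\<tau> TY flip: act_mult)
    have "R (\<tau> (act Y (R w))) = R w" for w by (simp add: R\<tau> TY flip: act_mult)
    then show "\<tau> \<circ> (\<lambda>w. act Y (R w)) = id" using Rinj by (auto simp: fun_eq_iff)
  qed
  moreover have "\<tau> (\<phi> x *v v) = \<psi> x *v \<tau> v" for x v
  proof (rule Rinj)
    have "R (\<tau> (\<phi> x *v v)) = act (T * Cm (\<phi> x)) v" by (simp add: R\<tau> act_mult act.rep_eq[of "Cm (\<phi> x)"] Cm_inverse)
    then show "R (\<tau> (\<phi> x *v v)) = R (\<psi> x *v \<tau> v)" by (simp add: R\<psi> R\<tau> act_mult flip: T)
  qed
  ultimately show ?thesis by blast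
qed

end
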